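(* Let $\star\in\{\mathrm{inj},\le\}$ and let $f\colon\mathscr{C}\to\mathscr{D}$ be a functor between small categories. Then the functors $i\colon\mathscr{C}\to\mathscr{H}_\star(f)$, $X\mapsto(X,[0],f(X))$, and $q\colon\mathscr{H}_\star(f)\to\mathscr{C}$, $(X,[n],\underline{Y})\mapsto X$, induce homotopy equivalences $B(\mathscr{C})\rightleftarrows B(\mathscr{H}_\star(f))$, homotopy inverse to each other. Therefore the categories $\mathscr{C}$ and $\mathscr{H}_\star(f)$ are $\simeq_B$-homotopy equivalent.
   Context: $B\mathscr{C}=|N\mathscr{C}|$ is the classifying space (geometric realization of the nerve) of a small category. Two functors $g,g'\colon\mathscr{C}_1\to\mathscr{C}_2$ satisfy $g\simeq_B g'$ if $Bg,Bg'$ are homotopic maps of topological spaces; two categories are $\simeq_B$-homotopy equivalent if there are functors in both directions whose two composites are $\simeq_B$ to the identity functors. For $n\ge0$, an object $\underline{Y}$ of $\Lambda_n\mathscr{D}$ is a zig-zag in $\mathscr{D}$ $$\bar Y_0\to Y_1\leftarrow\bar Y_1\to Y_2\leftarrow\bar Y_2\to\dots\to Y_n\leftarrow\bar Y_n,$$ and a morphism $\underline{Y}\to\underline{Z}$ is a family of maps $Y_i\to Z_i$, $\bar Y_i\to\bar Z_i$ making all squares commute; in particular $\Lambda_0\mathscr{D}=\mathscr{D}$. $\Delta_{\mathrm{inj}}$ is the category with objects $[0],[1],[2],\dots$ and morphisms $[m]\to[n]$ the strictly order-preserving maps $\{0<\dots<m\}\to\{0<\dots<n\}$. $\Delta_{\le}$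 has the same objects, a single morphism $[m]\to[n]$ if $m\le n$, interpreted as the map $\phi(i)=n-m+i$, and no morphism otherwise. A morphism $\phi\colon[m]\to[n]$ of either category induces a functor $\Lambda(\phi)\colon\Lambda_m\mathscr{D}\to\Lambda_n\mathscr{D}$: the zig-zag $\Lambda(\phi)(\underline{Y})$ has $\bar Y_i$ as its $\phi(i)$-th barred entry; it is padded by identity zig-zags $\bar Y_0\xrightarrow{\mathrm{id}}\bar Y_0\xleftarrow{\mathrm{id}}\bar Y_0$ up to position $\phi(0)$; between positions $\phi(i-1)$ and $\phi(i)$ it consists of identity zig-zags on $\bar Y_{i-1}$ followed by one final step $\bar Y_{i-1}\to Y_i\leftarrow\bar Y_i$; after position $\phi(m)$ it is padded by identity zig-zags on $\bar Y_m$. $\Lambda_\star\mathscr{D}$ is the (cofibred) Grothendieck construction of $[n]\mapsto\Lambda_n\mathscr{D}$ on $\Delta_\star$: objects are pairs $([n],\underline{Y})$ with $\underline{Y}\in\Lambda_n\mathscr{D}$, and a morphism $([m],\underline{Y})\to([n],\underline{Z})$ is a pair of a morphism $\phi\colon[m]\to[n]$ in $\Delta_\star$ and a morphism $\Lambda(\phi)(\underline{Y})\to\underline{Z}$ in $\Lambda_n\mathscr{D}$. Let $p_0\colon\Lambda_\star\mathscr{D}\to\mathscr{D}$ be $p_0([n],\underline{Y})=\bar Y_0$. $\mathscr{H}_\star(f)$ is the pullback $\mathscr{C}\times_{\mathscr{D}}\Lambda_\star\mathscr{D}$ along $f$ and $p_0$; its objects are triples $(X,[n],\underline{Y})$ with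 $X\in\mathscr{C}$, $\underline{Y}\in\Lambda_n\mathscr{D}$, $\bar Y_0=f(X)$. *)

theory Defs
  imports "HOL-Homology.Simplices"
begin

section \<open>Small categories and functors\<close>

text \<open>A small category has a set of objects and a set of arrows;
  \<open>Comp C g f\<close> is the composite \<open>g \<circ> f\<close>, meaningful when \<open>Dom C g = Cod C f\<close>.\<close>

record ('o, 'a) cat =
  Obj :: "'o set"
  Arr :: "'a set"
  Dom :: "'a \<Rightarrow> 'o"
  Cod :: "'a \<Rightarrow> 'o"
  Ident :: "'o \<Rightarrow> 'a"
  Comp :: "'a \<Rightarrow> 'a \<Rightarrow> 'a"

locale category =
  fixes C :: "('o, 'a) cat"
  assumes Dom_in: "a \<in> Arr C \<Longrightarrow> Dom C a \<in> Obj C"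
    and Cod_in: "a \<in> Arr C \<Longrightarrow> Cod C a \<in> Obj C"
    and Ident_in: "X \<in> Obj C \<Longrightarrow> Ident C X \<in> Arr C"
    and Dom_Ident: "X \<in> Obj C \<Longrightarrow> Dom C (Ident C X) = X"
    and Cod_Ident: "X \<in> Obj C \<Longrightarrow> Cod C (Ident C X) = X"
    and Comp_in: "\<lbrakk>f \<in> Arr C; g \<in> Arr C; Dom C g = Cod C f\<rbrakk> \<Longrightarrow> Comp C g f \<in> Arr C"
    and Dom_Comp: "\<lbrakk>f \<in> Arr C; g \<in> Arr C; Dom C g = Cod C f\<rbrakk> \<Longrightarrow> Dom C (Comp C g f) = Dom C f"
    and Cod_Comp: "\<lbrakk>f \<in> Arr C; g \<in> Arr C; Dom C g = Cod C f\<rbrakk> \<Longrightarrow> Cod C (Comp C g f) = Cod C g"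
    and Ident_left: "f \<in> Arr C \<Longrightarrow> Comp C (Ident C (Cod C f)) f = f"
    and Ident_right: "f \<in> Arr C \<Longrightarrow> Comp C f (Ident C (Dom C f)) = f"
    and Comp_assoc: "\<lbrakk>f \<in> Arr C; g \<in> Arr C; h \<in> Arr C; Dom C g = Cod C f; Dom C h = Cod C g\<rbrakk>
      \<Longrightarrow> Comp C h (Comp C g f) = Comp C (Comp C h g) f"

record ('o1, 'a1, 'o2, 'a2) func =
  FObj :: "'o1 \<Rightarrow> 'o2"
  FArr :: "'a1 \<Rightarrow> 'a2"

locale cat_functor = A: category A + B: category B
  for A :: "('o1, 'a1) cat" and B :: "('o2, 'a2) cat" +
  fixes F :: "('o1, 'a1, 'o2, 'a2) func"
  assumes FObj_in: "X \<in> Obj A \<Longrightarrow> FObj F X \<in> Obj B"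
    and FArr_in: "a \<in> Arr A \<Longrightarrow> FArr F a \<in> Arr B"
    and Dom_FArr: "a \<in> Arr A \<Longrightarrow> Dom B (FArr F a) = FObj F (Dom A a)"
    and Cod_FArr: "a \<in> Arr A \<Longrightarrow> Cod B (FArr F a) = FObj F (Cod A a)"
    and FArr_Ident: "X \<in> Obj A \<Longrightarrow> FArr F (Ident A X) = Ident B (FObj F X)"
    and FArr_Comp: "\<lbrakk>f \<in> Arr A; g \<in> Arr A; Dom A g = Cod A f\<rbrakk>
      \<Longrightarrow> FArr F (Comp A g f) = Comp B (FArr F g) (FArr F f)"

definition id_func :: "('o, 'a, 'o, 'a) func" where
  "id_func = \<lparr>FObj = (\<lambda>X. X), FArr = (\<lambda>a. a)\<rparr>"

definition comp_func ::
    "('o2, 'a2, 'o3, 'a3) func \<Rightarrow> ('o1, 'a1, 'o2, 'a2) func \<Rightarrow> ('o1, 'a1, 'o3, 'a3) func" where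
  "comp_func G F = \<lparr>FObj = FObj G \<circ> FObj F, FArr = FArr G \<circ> FArr F\<rparr>"

text \<open>The strict pullback \<open>C \<times>\<^sub>D L\<close> of categories along \<open>f: C \<rightarrow> D\<close> and \<open>p: L \<rightarrow> D\<close>.\<close>

definition pullback_cat ::
    "('o1, 'a1) cat \<Rightarrow> ('o2, 'a2) cat \<Rightarrow> ('o1, 'a1, 'o3, 'a3) func \<Rightarrow> ('o2, 'a2, 'o3, 'a3) func
     \<Rightarrow> ('o1 \<times> 'o2, 'a1 \<times> 'a2) cat" where
  "pullback_cat C L f p = \<lparr>
     Obj = {(X, y). X \<in> Obj C \<and> y \<in> Obj L \<and> FObj f X = FObj p y},
     Arr = {(a, b). a \<in> Arr C \<and> b \<in> Arr L \<and> FArr f a = FArr p b},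
     Dom = (\<lambda>(a, b). (Dom C a, Dom L b)),
     Cod = (\<lambda>(a, b). (Cod C a, Cod L b)),
     Ident = (\<lambda>(X, y). (Ident C X, Ident L y)),
     Comp = (\<lambda>(a', b') (a, b). (Comp C a' a, Comp L b' b))\<rparr>"

text \<open>In the categories constructed below, the data describing an arrow do not determine its
  source and target; an arrow therefore carries both.\<close>

datatype ('o, 'd) hom = Hom (src: 'o) (dat: 'd) (tgt: 'o)

text \<open>The cofibred Grothendieck construction of a functor from \<open>I\<close> to small categories, given on
  objects by \<open>E\<close> and on arrows by \<open>T\<close>. An arrow \<open>(i, Y) \<rightarrow> (j, Z)\<close> is a pair of an arrow
  \<open>\<phi>: i \<rightarrow> j\<close> of \<open>I\<close> and an arrow \<open>T \<phi> Y \<rightarrow> Z\<close> of \<open>E j\<close>.\<close>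

definition grothendieck ::
    "('i, 'j) cat \<Rightarrow> ('i \<Rightarrow> ('o, 'a) cat) \<Rightarrow> ('j \<Rightarrow> ('o, 'a, 'o, 'a) func)
     \<Rightarrow> ('i \<times> 'o, ('i \<times> 'o, 'j \<times> 'a) hom) cat" where
  "grothendieck I E T = \<lparr>
     Obj = {(i, Y). i \<in> Obj I \<and> Y \<in> Obj (E i)},
     Arr = {Hom (i, Y) (\<phi>, u) (j, Z) | i Y \<phi> u j Z.
              \<phi> \<in> Arr I \<and> Dom I \<phi> = i \<and> Cod I \<phi> = j \<and> Y \<in> Obj (E i) \<and> Z \<in> Obj (E j) \<and>
              u \<in> Arr (E j) \<and> Dom (E j) u = FObj (T \<phi>) Y \<and> Cod (E j) u = Z},
     Dom = src,
     Cod = tgt,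
     Ident = (\<lambda>(i, Y). Hom (i, Y) (Ident I i, Ident (E i) Y) (i, Y)),
     Comp = (\<lambda>b a. case (dat b, dat a) of ((\<psi>, v), (\<phi>, u)) \<Rightarrow>
              Hom (src a) (Comp I \<psi> \<phi>, Comp (E (fst (tgt b))) v (FArr (T \<psi>) u)) (tgt b))\<rparr>"


section \<open>Classifying spaces\<close>

text \<open>Simplicial sets: for monotone \<open>\<alpha>: [m] \<rightarrow> [n]\<close> and an \<open>n\<close>-simplex \<open>x\<close>, the \<open>m\<close>-simplex
  \<open>\<alpha>\<^sup>* x\<close> is \<open>act S m \<alpha> x\<close>.\<close>

record 'x sset =
  simplices :: "nat \<Rightarrow> 'x set"
  act :: "nat \<Rightarrow> (nat \<Rightarrow> nat) \<Rightarrow> 'x \<Rightarrow> 'x"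

definition mono_maps :: "nat \<Rightarrow> nat \<Rightarrow> (nat \<Rightarrow> nat) set" where
  "mono_maps m n = {\<alpha>. mono_on {..m} \<alpha> \<and> \<alpha> ` {..m} \<subseteq> {..n}}"

definition simplex_map :: "nat \<Rightarrow> (nat \<Rightarrow> nat) \<Rightarrow> (nat \<Rightarrow> real) \<Rightarrow> nat \<Rightarrow> real" where
  "simplex_map m \<alpha> t = (\<lambda>j. \<Sum>i | i \<le> m \<and> \<alpha> i = j. t i)"

text \<open>The disjoint union of the \<open>S\<^sub>n \<times> \<Delta>\<^sup>n\<close>, with \<open>S\<^sub>n\<close> discrete.\<close>

definition cells :: "'x sset \<Rightarrow> ((nat \<times> 'x) \<times> (nat \<Rightarrow> real)) topology" where
  "cells S = sum_topology (\<lambda>(n, x). subtopology (powertop_real UNIV) (standard_simplex n))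
     {(n, x). x \<in> simplices S n}"

definition glue :: "'x sset \<Rightarrow> ((nat \<times> 'x) \<times> (nat \<Rightarrow> real)) rel" where
  "glue S = {(((m, act S m \<alpha> x), t), ((n, x), simplex_map m \<alpha> t)) | m n \<alpha> x t.
     \<alpha> \<in> mono_maps m n \<and> x \<in> simplices S n \<and> t \<in> standard_simplex m}"

definition glue_equiv :: "'x sset \<Rightarrow> ((nat \<times> 'x) \<times> (nat \<Rightarrow> real)) rel" where
  "glue_equiv S = (glue S \<union> (glue S)\<inverse>)\<^sup>*"

definition quotient_topology :: "'a topology \<Rightarrow> ('a \<Rightarrow> 'b) \<Rightarrow> 'b topology" where
  "quotient_topology X f =
     topology (\<lambda>U. U \<subseteq> f ` topspace X \<and> openin X {x \<in> topspace X. f x \<in> U})"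

lemma istopology_quotient:
  "istopology (\<lambda>U. U \<subseteq> f ` topspace X \<and> openin X {x \<in> topspace X. f x \<in> U})"
proof -
  have 1: "{x \<in> topspace X. f x \<in> S \<inter> T}
      = {x \<in> topspace X. f x \<in> S} \<inter> {x \<in> topspace X. f x \<in> T}" for S T
    by auto
  have 2: "{x \<in> topspace X. f x \<in> \<Union> \<K>} = (\<Union>K\<in>\<K>. {x \<in> topspace X. f x \<in> K})" for \<K>
    by auto
  show ?thesis
    unfolding istopology_def 1 2 by blast
qed

lemma openin_quotient_topology:
  "openin (quotient_topology X f) U \<longleftrightarrow>
     U \<subseteq> f ` topspace X \<and> openin X {x \<in> topspace X. f x \<in> U}"
  by (simp add: quotient_topology_def istopology_quotient)

definition realization :: "'x sset \<Rightarrow> ((nat \<times> 'x) \<times> (nat \<Rightarrow> real)) set topology" where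
  "realization S = quotient_topology (cells S) (\<lambda>p. glue_equiv S `` {p})"

text \<open>The map \<open>[x, t] \<mapsto> [g x, t]\<close> into the realization of \<open>S'\<close>: the image of an equivalence class
  is saturated to an equivalence class.\<close>

definition realization_map ::
    "'y sset \<Rightarrow> (nat \<Rightarrow> 'x \<Rightarrow> 'y) \<Rightarrow> ((nat \<times> 'x) \<times> (nat \<Rightarrow> real)) set
     \<Rightarrow> ((nat \<times> 'y) \<times> (nat \<Rightarrow> real)) set" where
  "realization_map S' g c = glue_equiv S' `` ((\<lambda>((n, x), t). ((n, g n x), t)) ` c)"

text \<open>The poset \<open>[n] = {0 < \<dots> < n}\<close> as a category.\<close>

definition ordinal :: "nat \<Rightarrow> (nat, nat \<times> nat) cat" where
  "ordinal n = \<lparr>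
     Obj = {..n},
     Arr = {(i, j). i \<le> j \<and> j \<le> n},
     Dom = fst,
     Cod = snd,
     Ident = (\<lambda>i. (i, i)),
     Comp = (\<lambda>b a. (fst a, snd b))\<rparr>"

text \<open>The \<open>n\<close>-simplices of the nerve are the functors \<open>[n] \<rightarrow> C\<close>, made unique as HOL functions by
  extensionality.\<close>

definition nerve :: "('o, 'a) cat \<Rightarrow> (nat, nat \<times> nat, 'o, 'a) func sset" where
  "nerve C = \<lparr>
     simplices = (\<lambda>n. {x. cat_functor (ordinal n) C x \<and>
               FObj x \<in> extensional (Obj (ordinal n)) \<and> FArr x \<in> extensional (Arr (ordinal n))}),
     act = (\<lambda>m \<alpha> x. \<lparr>
       FObj = (\<lambda>i\<in>Obj (ordinal m). FObj x (\<alpha> i)),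
       FArr = (\<lambda>a\<in>Arr (ordinal m). FArr x (\<alpha> (fst a), \<alpha> (snd a)))\<rparr>)\<rparr>"

definition nerve_map ::
    "('o1, 'a1, 'o2, 'a2) func \<Rightarrow> nat \<Rightarrow> (nat, nat \<times> nat, 'o1, 'a1) func
     \<Rightarrow> (nat, nat \<times> nat, 'o2, 'a2) func" where
  "nerve_map F n x = \<lparr>
     FObj = (\<lambda>i\<in>Obj (ordinal n). FObj F (FObj x i)),
     FArr = (\<lambda>a\<in>Arr (ordinal n). FArr F (FArr x a))\<rparr>"

type_synonym ('o, 'a) class_pt =
  "((nat \<times> (nat, nat \<times> nat, 'o, 'a) func) \<times> (nat \<Rightarrow> real)) set"

definition classifying_space :: "('o, 'a) cat \<Rightarrow> ('o, 'a) class_pt topology" where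
  "classifying_space C = realization (nerve C)"

definition classifying_map ::
    "('o2, 'a2) cat \<Rightarrow> ('o1, 'a1, 'o2, 'a2) func \<Rightarrow> ('o1, 'a1) class_pt \<Rightarrow> ('o2, 'a2) class_pt" where
  "classifying_map B F = realization_map (nerve B) (nerve_map F)"

definition B_homotopic ::
    "('o1, 'a1) cat \<Rightarrow> ('o2, 'a2) cat \<Rightarrow> ('o1, 'a1, 'o2, 'a2) func \<Rightarrow> ('o1, 'a1, 'o2, 'a2) func
     \<Rightarrow> bool" where
  "B_homotopic A B g g' \<longleftrightarrow>
     homotopic_with (\<lambda>_. True) (classifying_space A) (classifying_space B)
       (classifying_map B g) (classifying_map B g')"

definition B_homotopy_equivalent :: "('o1, 'a1) cat \<Rightarrow> ('o2, 'a2) cat \<Rightarrow> bool" where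
  "B_homotopy_equivalent A B \<longleftrightarrow>
     (\<exists>g h. cat_functor A B g \<and> cat_functor B A h \<and>
        B_homotopic A A (comp_func h g) id_func \<and> B_homotopic B B (comp_func g h) id_func)"


section \<open>The index categories\<close>

datatype shape = Inj | Le

text \<open>The object \<open>[n]\<close> is represented by \<open>n\<close>. In both cases an arrow \<open>[m] \<rightarrow> [n]\<close> is given by its
  underlying map; for \<open>Le\<close> there is exactly one arrow if \<open>m \<le> n\<close>, and none otherwise.\<close>

fun Delta_arrows :: "shape \<Rightarrow> (nat, nat \<Rightarrow> nat) hom set" where
  "Delta_arrows Inj = {Hom m \<phi> n | m \<phi> n.
     \<phi> \<in> extensional {..m} \<and> strict_mono_on {..m} \<phi> \<and> \<phi> ` {..m} \<subseteq> {..n}}"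
| "Delta_arrows Le = {Hom m (\<lambda>i\<in>{..m}. n - m + i) n | m n. m \<le> n}"

definition Delta :: "shape \<Rightarrow> (nat, (nat, nat \<Rightarrow> nat) hom) cat" where
  "Delta s = \<lparr>
     Obj = UNIV,
     Arr = Delta_arrows s,
     Dom = src,
     Cod = tgt,
     Ident = (\<lambda>n. Hom n (\<lambda>i\<in>{..n}. i) n),
     Comp = (\<lambda>g f. Hom (src f) (compose {..src f} (dat g) (dat f)) (tgt g))\<rparr>"


section \<open>Zig-zags\<close>

text \<open>A zig-zag of length \<open>n\<close> has objects \<open>bar i\<close> for \<open>0 \<le> i \<le> n\<close> and \<open>mid i\<close> for \<open>1 \<le> i \<le> n\<close>;
  its \<open>i\<close>-th step, \<open>1 \<le> i \<le> n\<close>, consists of \<open>fwd i: bar (i - 1) \<rightarrow> mid i\<close> and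
  \<open>bwd i: bar i \<rightarrow> mid i\<close>.\<close>

record ('o, 'a) zigzag =
  bar :: "nat \<Rightarrow> 'o"
  mid :: "nat \<Rightarrow> 'o"
  fwd :: "nat \<Rightarrow> 'a"
  bwd :: "nat \<Rightarrow> 'a"

record 'a zigmor =
  bar_mor :: "nat \<Rightarrow> 'a"
  mid_mor :: "nat \<Rightarrow> 'a"

definition zigzags :: "('o, 'a) cat \<Rightarrow> nat \<Rightarrow> ('o, 'a) zigzag set" where
  "zigzags D n = {Y.
     bar Y \<in> {0..n} \<rightarrow>\<^sub>E Obj D \<and> mid Y \<in> {1..n} \<rightarrow>\<^sub>E Obj D \<and>
     fwd Y \<in> {1..n} \<rightarrow>\<^sub>E Arr D \<and> bwd Y \<in> {1..n} \<rightarrow>\<^sub>E Arr D \<and>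
     (\<forall>i\<in>{1..n}. Dom D (fwd Y i) = bar Y (i - 1) \<and> Cod D (fwd Y i) = mid Y i \<and>
                 Dom D (bwd Y i) = bar Y i \<and> Cod D (bwd Y i) = mid Y i)}"

definition zigmors ::
    "('o, 'a) cat \<Rightarrow> nat \<Rightarrow> ('o, 'a) zigzag \<Rightarrow> ('o, 'a) zigzag \<Rightarrow> 'a zigmor set" where
  "zigmors D n Y Z = {u.
     bar_mor u \<in> {0..n} \<rightarrow>\<^sub>E Arr D \<and> mid_mor u \<in> {1..n} \<rightarrow>\<^sub>E Arr D \<and>
     (\<forall>i\<in>{0..n}. Dom D (bar_mor u i) = bar Y i \<and> Cod D (bar_mor u i) = bar Z i) \<and>
     (\<forall>i\<in>{1..n}. Dom D (mid_mor u i) = mid Y i \<and> Cod D (mid_mor u i) = mid Z i \<and>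
        Comp D (fwd Z i) (bar_mor u (i - 1)) = Comp D (mid_mor u i) (fwd Y i) \<and>
        Comp D (bwd Z i) (bar_mor u i) = Comp D (mid_mor u i) (bwd Y i))}"

type_synonym ('o, 'a) zighom = "(('o, 'a) zigzag, 'a zigmor) hom"

definition Lam :: "('o, 'a) cat \<Rightarrow> nat \<Rightarrow> (('o, 'a) zigzag, ('o, 'a) zighom) cat" where
  "Lam D n = \<lparr>
     Obj = zigzags D n,
     Arr = {Hom Y u Z | Y u Z. Y \<in> zigzags D n \<and> Z \<in> zigzags D n \<and> u \<in> zigmors D n Y Z},
     Dom = src,
     Cod = tgt,
     Ident = (\<lambda>Y. Hom Y
       \<lparr>bar_mor = (\<lambda>i\<in>{0..n}. Ident D (bar Y i)), mid_mor = (\<lambda>i\<in>{1..n}. Ident D (mid Y i))\<rparr> Y),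
     Comp = (\<lambda>v u. Hom (src u)
       \<lparr>bar_mor = (\<lambda>i\<in>{0..n}. Comp D (bar_mor (dat v) i) (bar_mor (dat u) i)),
        mid_mor = (\<lambda>i\<in>{1..n}. Comp D (mid_mor (dat v) i) (mid_mor (dat u) i))\<rparr> (tgt v))\<rparr>"

text \<open>For \<open>\<phi>: [m] \<rightarrow> [n]\<close>, the \<open>j\<close>-th barred entry of \<open>\<Lambda>(\<phi>)(Y)\<close> is the \<open>i\<close>-th barred entry of
  \<open>Y\<close>, where \<open>i\<close> is the largest index with \<open>\<phi> i \<le> j\<close>, or \<open>0\<close> if \<open>j < \<phi> 0\<close>. The \<open>j\<close>-th step
  is the \<open>i\<close>-th step of \<open>Y\<close> if \<open>j = \<phi> i\<close> for some \<open>i \<ge> 1\<close>, and an identity step otherwise.\<close>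

definition pos :: "nat \<Rightarrow> (nat \<Rightarrow> nat) \<Rightarrow> nat \<Rightarrow> nat" where
  "pos m \<phi> j = Max (insert 0 {i. i \<le> m \<and> \<phi> i \<le> j})"

definition Lam_zigzag ::
    "('o, 'a) cat \<Rightarrow> (nat, nat \<Rightarrow> nat) hom \<Rightarrow> ('o, 'a) zigzag \<Rightarrow> ('o, 'a) zigzag" where
  "Lam_zigzag D h Y = (let m = src h; \<phi> = dat h; n = tgt h; s = pos m \<phi>; S = \<phi> ` {1..m} in \<lparr>
     bar = (\<lambda>j\<in>{0..n}. bar Y (s j)),
     mid = (\<lambda>j\<in>{1..n}. if j \<in> S then mid Y (s j) else bar Y (s j)),
     fwd = (\<lambda>j\<in>{1..n}. if j \<in> S then fwd Y (s j) else Ident D (bar Y (s j))),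
     bwd = (\<lambda>j\<in>{1..n}. if j \<in> S then bwd Y (s j) else Ident D (bar Y (s j)))\<rparr>)"

definition Lam_zigmor :: "(nat, nat \<Rightarrow> nat) hom \<Rightarrow> 'a zigmor \<Rightarrow> 'a zigmor" where
  "Lam_zigmor h u = (let m = src h; \<phi> = dat h; n = tgt h; s = pos m \<phi>; S = \<phi> ` {1..m} in \<lparr>
     bar_mor = (\<lambda>j\<in>{0..n}. bar_mor u (s j)),
     mid_mor = (\<lambda>j\<in>{1..n}. if j \<in> S then mid_mor u (s j) else bar_mor u (s j))\<rparr>)"

definition Lam_func ::
    "('o, 'a) cat \<Rightarrow> (nat, nat \<Rightarrow> nat) hom
     \<Rightarrow> (('o, 'a) zigzag, ('o, 'a) zighom, ('o, 'a) zigzag, ('o, 'a) zighom) func" where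
  "Lam_func D h = \<lparr>
     FObj = Lam_zigzag D h,
     FArr = (\<lambda>a. Hom (Lam_zigzag D h (src a)) (Lam_zigmor h (dat a)) (Lam_zigzag D h (tgt a)))\<rparr>"


section \<open>The category \<open>\<H>\<^sub>\<star>(f)\<close>\<close>

type_synonym ('o, 'a) starobj = "nat \<times> ('o, 'a) zigzag"
type_synonym ('o, 'a) starhom =
  "(('o, 'a) starobj, (nat, nat \<Rightarrow> nat) hom \<times> ('o, 'a) zighom) hom"

definition Lam_star :: "shape \<Rightarrow> ('o, 'a) cat \<Rightarrow> (('o, 'a) starobj, ('o, 'a) starhom) cat" where
  "Lam_star s D = grothendieck (Delta s) (Lam D) (Lam_func D)"

text \<open>On an arrow \<open>(\<phi>, u)\<close>, the functor \<open>p\<^sub>0\<close> returns the \<open>0\<close>-th barred component of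
  \<open>u: \<Lambda>(\<phi>)(Y) \<rightarrow> Z\<close>, the \<open>0\<close>-th barred entry of \<open>\<Lambda>(\<phi>)(Y)\<close> being that of \<open>Y\<close>.\<close>

definition p0 :: "(('o, 'a) starobj, ('o, 'a) starhom, 'o, 'a) func" where
  "p0 = \<lparr>
     FObj = (\<lambda>(n, Y). bar Y 0),
     FArr = (\<lambda>a. bar_mor (dat (snd (dat a))) 0)\<rparr>"

definition H_cat ::
    "shape \<Rightarrow> ('o1, 'a1) cat \<Rightarrow> ('o2, 'a2) cat \<Rightarrow> ('o1, 'a1, 'o2, 'a2) func
     \<Rightarrow> ('o1 \<times> ('o2, 'a2) starobj, 'a1 \<times> ('o2, 'a2) starhom) cat" where
  "H_cat s C D f = pullback_cat C (Lam_star s D) f p0"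

text \<open>The identification of \<open>D\<close> with \<open>\<Lambda>\<^sub>0 D\<close>.\<close>

definition zigzag0 :: "'o \<Rightarrow> ('o, 'a) zigzag" where
  "zigzag0 X = \<lparr>bar = (\<lambda>i\<in>{0}. X), mid = (\<lambda>_. undefined),
     fwd = (\<lambda>_. undefined), bwd = (\<lambda>_. undefined)\<rparr>"

definition zigmor0 :: "'a \<Rightarrow> 'a zigmor" where
  "zigmor0 a = \<lparr>bar_mor = (\<lambda>i\<in>{0}. a), mid_mor = (\<lambda>_. undefined)\<rparr>"

definition i_func ::
    "shape \<Rightarrow> ('o1, 'a1) cat \<Rightarrow> ('o1, 'a1, 'o2, 'a2) func
     \<Rightarrow> ('o1, 'a1, 'o1 \<times> ('o2, 'a2) starobj, 'a1 \<times> ('o2, 'a2) starhom) func" where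
  "i_func s C f = \<lparr>
     FObj = (\<lambda>X. (X, 0, zigzag0 (FObj f X))),
     FArr = (\<lambda>a. let Y = zigzag0 (FObj f (Dom C a)); Z = zigzag0 (FObj f (Cod C a)) in
       (a, Hom (0, Y) (Ident (Delta s) 0, Hom Y (zigmor0 (FArr f a)) Z) (0, Z)))\<rparr>"

definition q_func ::
    "('o1 \<times> ('o2, 'a2) starobj, 'a1 \<times> ('o2, 'a2) starhom, 'o1, 'a1) func" where
  "q_func = \<lparr>FObj = fst, FArr = fst\<rparr>"

end

theory Submission
  imports Defs "HOL-Analysis.Abstract_Topological_Spaces"
begin

text \<open>The composite \<open>q \<circ> i\<close> is the identity, so everything rests on a homotopy from the identity of
  \<open>B(\<H>\<^sub>\<star>(f))\<close> to \<open>B(i \<circ> q)\<close>.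

  A zig-zag of length \<open>n\<close> can be shortened to the constant zig-zag on its first object: let \<open>T\<^sub>z Y\<close>
  agree with \<open>Y\<close> up to the position \<open>z \<in> {0, \<dots>, 2n}\<close> and be constant afterwards. Then
  \<open>Y = T\<^bsub>2n\<^esub> Y\<close>, the zig-zag \<open>T\<^sub>0 Y\<close> is constant, and \<open>T\<^sub>z Y\<close> and \<open>T\<^bsub>z+1\<^esub> Y\<close> are joined by a map
  that points from the even to the odd index. Two things keep this from being a chain of natural
  transformations. The lengths \<open>n\<close> are unbounded, and for injective index maps \<open>T\<^sub>z\<close> is not functorial:
  \<open>\<Lambda>(\<phi>)\<close> inserts identities and so moves the positions. It only holds that
  \<open>T\<^sub>z \<Lambda>(\<phi>) Y = \<Lambda>(\<phi>) T\<^bsub>\<sigma> z\<^esub> Y\<close>, where \<open>\<sigma>: {0, \<dots>, 2n} \<rightarrow> {0, \<dots>, 2m}\<close> is monotone and either keeps or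
  collapses each unit step; both \<open>\<Lambda>(\<phi>)\<close> and \<open>T\<^sub>z\<close> are restrictions of zig-zags along such folds.

  The homotopy is therefore built by hand, on each simplex \<open>x\<^sub>0 \<rightarrow> \<dots> \<rightarrow> x\<^sub>p\<close> of the nerve. A real position
  \<open>r\<close> in the zig-zag of \<open>x\<^sub>p\<close> determines positions \<open>r\<^sub>i\<close> in those of all \<open>x\<^sub>i\<close>, and truncating everything
  there moves the point with barycentric coordinates \<open>t\<close>; between integral positions it moves through the
  prism of a natural transformation of functors on \<open>[p]\<close>. At time \<open>\<tau>\<close> the position is chosen so that
  the mean \<open>\<Sum>\<^sub>i t\<^sub>i r\<^sub>i\<close> is \<open>1 - \<tau>\<close> times its maximum. The mean is monotone in \<open>r\<close>, so it determines
  \<open>r\<^sub>i\<close> whenever \<open>t\<^sub>i > 0\<close>, and it does not see vertices with \<open>t\<^sub>i = 0\<close>; hence the moved point is well defined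
  (\<open>slide_point_unique\<close>) and compatible with faces and degeneracies (\<open>at_time_reindex\<close>,
  \<open>slide_point_reindex\<close>). The position itself may jump, but the moved point is continuous, because the
  admissible triples \<open>(\<tau>, t, r)\<close> form a compact space with quotient \<open>[0,1] \<times> \<Delta>\<^sup>p\<close>
  (\<open>continuous_map_contraction\<close>). This gives the homotopy from the identity to \<open>B(T\<^sub>0)\<close>
  (\<open>homotopic_id_truncate0\<close>).

  What remains concerns constant zig-zags only. The functors \<open>T\<^sub>0\<close> and \<open>i \<circ> q\<close> replace \<open>(X, [n], Y)\<close> by the
  constant zig-zags on \<open>f(X)\<close> of lengths \<open>n\<close> and \<open>0\<close>. They are induced by the identity and by the constant
  functor \<open>[0]\<close> on the index category, which are joined by natural transformations: directly if \<open>[0]\<close> is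
  initial, and through the cone functor \<open>[n] \<mapsto> [n + 1]\<close> in the injective case.\<close>


section \<open>Points of a realization\<close>

definition cell_class ::
    "'x sset \<Rightarrow> (nat \<times> 'x) \<times> (nat \<Rightarrow> real) \<Rightarrow> ((nat \<times> 'x) \<times> (nat \<Rightarrow> real)) set" where
  "cell_class S p = glue_equiv S `` {p}"

lemma glue_equiv_sym: "(p, q) \<in> glue_equiv S \<Longrightarrow> (q, p) \<in> glue_equiv S"
  unfolding glue_equiv_def
  by (metis converse_Un converse_converse converse_iff rtrancl_converse sup_commute)

lemma glue_equiv_trans:
  "\<lbrakk>(p, q) \<in> glue_equiv S; (q, r) \<in> glue_equiv S\<rbrakk> \<Longrightarrow> (p, r) \<in> glue_equiv S"
  unfolding glue_equiv_def by (rule rtrancl_trans)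

lemma glue_equiv_refl: "(p, p) \<in> glue_equiv S"
  by (simp add: glue_equiv_def)

lemma cell_class_eq_iff: "cell_class S p = cell_class S q \<longleftrightarrow> (p, q) \<in> glue_equiv S"
  unfolding cell_class_def
  using glue_equiv_sym glue_equiv_trans glue_equiv_refl by blast

lemma cell_class_act:
  assumes "\<alpha> \<in> mono_maps m n" "x \<in> simplices S n" "t \<in> standard_simplex m"
  shows "cell_class S ((m, act S m \<alpha> x), t) = cell_class S ((n, x), simplex_map m \<alpha> t)"
proof -
  have "(((m, act S m \<alpha> x), t), ((n, x), simplex_map m \<alpha> t)) \<in> glue S"
    using assms unfolding glue_def by blast
  then show ?thesis
    unfolding cell_class_eq_iff glue_equiv_def by blast
qed

lemma in_topspace_cells:
  "((n, x), t) \<in> topspace (cells S) \<longleftrightarrow> x \<in> simplices S n \<and> t \<in> standard_simplex n"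
  by (auto simp: cells_def)

lemma quotient_map_quotient_topology: "quotient_map X (quotient_topology X f) f"
proof -
  have "openin (quotient_topology X f) (f ` topspace X)"
    by (auto simp: openin_quotient_topology intro: back_subst[of "openin X", OF openin_topspace])
  then have "topspace (quotient_topology X f) = f ` topspace X"
    by (metis openin_quotient_topology openin_subset openin_topspace subset_antisym)
  then show ?thesis
    by (auto simp: quotient_map_def openin_quotient_topology)
qed

lemma quotient_map_cell_class: "quotient_map (cells S) (realization S) (cell_class S)"
  unfolding realization_def cell_class_def[abs_def] by (rule quotient_map_quotient_topology)

lemma continuous_map_cell:
  assumes "x \<in> simplices S n"
  shows "continuous_map (top_of_set (standard_simplex n)) (realization S)
    (\<lambda>t. cell_class S ((n, x), t))"
proof -
  have "continuous_map (subtopology (powertop_real UNIV) (standard_simplex n)) (cells S)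
      (\<lambda>t. ((n, x), t))"
    unfolding cells_def
    using continuous_map_component_injection[of "(n, x)" "{(n, x). x \<in> simplices S n}"
        "\<lambda>(n, x). subtopology (powertop_real UNIV) (standard_simplex n)"] assms by simp
  from continuous_map_compose[OF this quotient_imp_continuous_map[OF quotient_map_cell_class]]
  show ?thesis by (simp add: o_def euclidean_product_topology)
qed

text \<open>Since the unit interval is locally compact, \<open>[0,1] \<times> |S|\<close> carries the quotient topology of
  \<open>[0,1] \<times> cells S\<close>; this is why a homotopy may be given cell by cell.\<close>

lemma realization_homotopy:
  fixes h :: "real \<Rightarrow> (nat \<times> 'x) \<times> (nat \<Rightarrow> real) \<Rightarrow> 'y"
  assumes cont: "\<And>n x. x \<in> simplices S n \<Longrightarrow>
      continuous_map (prod_topology (top_of_set {0..1}) (top_of_set (standard_simplex n))) Y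
        (\<lambda>(\<tau>, t). h \<tau> ((n, x), t))"
    and resp: "\<And>\<tau> m n \<alpha> x t. \<lbrakk>\<tau> \<in> {0..1}; \<alpha> \<in> mono_maps m n; x \<in> simplices S n;
      t \<in> standard_simplex m\<rbrakk> \<Longrightarrow> h \<tau> ((m, act S m \<alpha> x), t) = h \<tau> ((n, x), simplex_map m \<alpha> t)"
  obtains H where "continuous_map (prod_topology (top_of_set {0..1}) (realization S)) Y H"
    "\<And>\<tau> p. \<lbrakk>\<tau> \<in> {0..1}; p \<in> topspace (cells S)\<rbrakk> \<Longrightarrow> H (\<tau>, cell_class S p) = h \<tau> p"
proof -
  let ?I = "top_of_set {0..1::real}"
  have q: "quotient_map (prod_topology ?I (cells S)) (prod_topology ?I (realization S))
      (\<lambda>(\<tau>, p). (\<tau>, cell_class S p))"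
  proof (rule quotient_map_prod_right)
    show "locally_compact_space ?I"
      by (intro compact_imp_locally_compact_space compact_space_subtopology) simp
    show "Hausdorff_space ?I \<or> regular_space ?I"
      by (simp add: Hausdorff_space_subtopology)
  qed (rule quotient_map_cell_class)
  \<comment> \<open>The cells are open in their disjoint union, so continuity may be checked on each of them.\<close>
  have c: "continuous_map (prod_topology ?I (cells S)) Y (\<lambda>(\<tau>, p). h \<tau> p)"
  proof (rule pasting_lemma[where I = "{(n, x). x \<in> simplices S n}"
        and T = "\<lambda>k. UNIV \<times> ({k} \<times> UNIV) \<inter> topspace (prod_topology ?I (cells S))"
        and f = "\<lambda>_ (\<tau>, p). h \<tau> p"])
    let ?X = "\<lambda>k::nat \<times> 'x. top_of_set (standard_simplex (fst k))"
    have cells: "cells S = sum_topology ?X {(n, x). x \<in> simplices S n}"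
      by (simp add: cells_def case_prod_unfold euclidean_product_topology)
    fix k assume k: "k \<in> {(n, x). x \<in> simplices S n}"
    let ?P = "{k} \<times> standard_simplex (fst k)"
    have op: "openin (cells S) ?P"
    proof -
      have "{x. (l, x) \<in> ?P} = (if l = k then standard_simplex (fst l) else {})" for l
        by auto
      then show ?thesis
        using k unfolding cells openin_sum_topology by auto
    qed
    have T: "UNIV \<times> ({k} \<times> UNIV) \<inter> topspace (prod_topology ?I (cells S)) = {0..1} \<times> ?P"
      using k by (auto simp: cells)
    show "openin (prod_topology ?I (cells S))
        (UNIV \<times> ({k} \<times> UNIV) \<inter> topspace (prod_topology ?I (cells S)))"
      unfolding T using op by (simp add: openin_prod_Times_iff)
    have "continuous_map (subtopology (cells S) ?P) (?X k) snd"
      unfolding continuous_map_def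
    proof (intro conjI allI impI)
      fix U assume U: "openin (?X k) U"
      then have "openin (cells S) (Pair k ` U)"
        using open_map_component_injection[OF k, of ?X] unfolding open_map_def cells by blast
      moreover have "{p \<in> topspace (subtopology (cells S) ?P). snd p \<in> U} = Pair k ` U"
        using openin_subset[OF U] openin_subset[OF op] by auto
      moreover have "Pair k ` U \<subseteq> ?P"
        using openin_subset[OF U] by auto
      ultimately show "openin (subtopology (cells S) ?P)
          {p \<in> topspace (subtopology (cells S) ?P). snd p \<in> U}"
        by (metis openin_subset openin_open_subtopology op)
    qed auto
    then have "continuous_map (prod_topology ?I (subtopology (cells S) ?P))
        (prod_topology ?I (?X k)) (\<lambda>(\<tau>, p). (\<tau>, snd p))"
      by (subst continuous_map_prod_top) (simp add: continuous_map_id[unfolded id_def])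
    moreover have "continuous_map (prod_topology ?I (?X k)) Y (\<lambda>(\<tau>, t). h \<tau> (k, t))"
      using cont[of "snd k" "fst k"] k by (auto simp: case_prod_unfold)
    ultimately have "continuous_map (prod_topology ?I (subtopology (cells S) ?P)) Y
        ((\<lambda>(\<tau>, t). h \<tau> (k, t)) \<circ> (\<lambda>(\<tau>, p). (\<tau>, snd p)))"
      by (rule continuous_map_compose)
    then have "continuous_map (prod_topology ?I (subtopology (cells S) ?P)) Y (\<lambda>(\<tau>, p). h \<tau> p)"
      by (rule continuous_map_eq) auto
    moreover have "subtopology (prod_topology ?I (cells S)) ({0..1} \<times> ?P)
        = prod_topology ?I (subtopology (cells S) ?P)"
      by (simp add: subtopology_Times subtopology_subtopology)
    ultimately show "continuous_map (subtopology (prod_topology ?I (cells S))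
        (UNIV \<times> ({k} \<times> UNIV) \<inter> topspace (prod_topology ?I (cells S)))) Y (\<lambda>(\<tau>, p). h \<tau> p)"
      unfolding T by simp
  next
    fix z assume z: "z \<in> topspace (prod_topology ?I (cells S))"
    obtain \<tau> n x t where "z = (\<tau>, ((n, x), t))"
      by (metis prod.exhaust)
    with z show "\<exists>k. k \<in> {(n, x). x \<in> simplices S n}
        \<and> z \<in> UNIV \<times> ({k} \<times> UNIV) \<inter> topspace (prod_topology ?I (cells S))
        \<and> (\<lambda>(\<tau>, p). h \<tau> p) z = (\<lambda>(\<tau>, p). h \<tau> p) z"
      by (auto simp: in_topspace_cells)
  qed auto
  have e: "h \<tau> p = h \<tau> q" if "cell_class S p = cell_class S q" "\<tau> \<in> {0..1}" for \<tau> p q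
  proof -
    have "(p, q) \<in> (glue S \<union> (glue S)\<inverse>)\<^sup>*"
      using that by (simp add: cell_class_eq_iff glue_equiv_def)
    then show ?thesis
    proof induction
      case (step y z)
      have "h \<tau> y = h \<tau> z"
        using step.hyps(2) resp[OF that(2)] unfolding glue_def by force
      with step.IH show ?case by simp
    qed simp
  qed
  obtain H where H: "continuous_map (prod_topology ?I (realization S)) Y H"
    and H2: "\<And>z. z \<in> topspace (prod_topology ?I (cells S))
      \<Longrightarrow> H ((\<lambda>(\<tau>, p). (\<tau>, cell_class S p)) z) = (\<lambda>(\<tau>, p). h \<tau> p) z"
    by (rule quotient_map_lift_exists[OF q c]) (auto dest: e)
  show ?thesis
    using that[OF H] H2 by force
qed

text \<open>A simplicial map sends glued points to glued points, so the image of an equivalence class lies in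
  one class, and saturating it adds nothing new.\<close>

lemma realization_map_cell_class:
  assumes simp: "\<And>n x. x \<in> simplices S n \<Longrightarrow> g n x \<in> simplices S' n"
    and act: "\<And>m n \<alpha> x. \<lbrakk>\<alpha> \<in> mono_maps m n; x \<in> simplices S n\<rbrakk>
      \<Longrightarrow> g m (act S m \<alpha> x) = act S' m \<alpha> (g n x)"
  shows "realization_map S' g (cell_class S ((n, x), t)) = cell_class S' ((n, g n x), t)"
proof -
  let ?G = "\<lambda>((n, x), t::nat \<Rightarrow> real). ((n, g n x), t)"
  have glue: "(?G p, ?G q) \<in> glue S'" if "(p, q) \<in> glue S" for p q
    using that simp act unfolding glue_def by fastforce
  have "(?G p, ?G q) \<in> glue_equiv S'" if "(p, q) \<in> glue_equiv S" for p q
    using that unfolding glue_equiv_def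
  proof induction
    case (step y z)
    have "(?G y, ?G z) \<in> glue S' \<union> (glue S')\<inverse>"
      using step.hyps(2) glue by blast
    then show ?case
      using step.IH by (rule rtrancl_into_rtrancl[rotated])
  qed simp
  then have 1: "?G ` cell_class S p \<subseteq> cell_class S' (?G p)" for p
    unfolding cell_class_def by (rule_tac image_subsetI) (simp only: Image_singleton_iff)
  have 2: "?G p \<in> ?G ` cell_class S p" for p
    unfolding cell_class_def by (rule imageI) (simp add: glue_equiv_refl)
  have "glue_equiv S' `` (?G ` cell_class S p) = cell_class S' (?G p)" for p
  proof
    show "glue_equiv S' `` (?G ` cell_class S p) \<subseteq> cell_class S' (?G p)"
      using 1[of p] unfolding cell_class_def by (meson Image_singleton_iff ImageE glue_equiv_trans subset_iff)
    show "cell_class S' (?G p) \<subseteq> glue_equiv S' `` (?G ` cell_class S p)"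
      using 2[of p] unfolding cell_class_def[of S'] by (meson Image_mono empty_subsetI insert_subset order_refl)
  qed
  from this[of "((n, x), t)"] show ?thesis
    unfolding realization_map_def by simp
qed


section \<open>Points of a classifying space\<close>

type_synonym ('o, 'a) diagram = "(nat, nat \<times> nat, 'o, 'a) func"

lemma category_ordinal: "category (ordinal n)"
  by unfold_locales (auto simp: ordinal_def)

lemma cat_functor_comp_func:
  assumes "cat_functor A B F" "cat_functor B C G"
  shows "cat_functor A C (comp_func G F)"
proof -
  interpret F: cat_functor A B F by fact
  interpret G: cat_functor B C G by fact
  show ?thesis
    by unfold_locales
      (simp_all add: comp_func_def F.FObj_in F.FArr_in G.FObj_in G.FArr_in F.Dom_FArr F.Cod_FArr
        G.Dom_FArr G.Cod_FArr F.FArr_Ident G.FArr_Ident F.FArr_Comp G.FArr_Comp)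
qed

lemma cat_functor_id_func: "category A \<Longrightarrow> cat_functor A A id_func"
  by (simp add: cat_functor_def cat_functor_axioms_def id_func_def)

lemma cat_functor_cong:
  assumes "cat_functor A B F"
    and "\<And>X. X \<in> Obj A \<Longrightarrow> FObj F' X = FObj F X" "\<And>a. a \<in> Arr A \<Longrightarrow> FArr F' a = FArr F a"
  shows "cat_functor A B F'"
proof -
  interpret F: cat_functor A B F by fact
  show ?thesis
    by unfold_locales
      (simp_all add: assms(2,3) F.FObj_in F.FArr_in F.Dom_FArr F.Cod_FArr F.FArr_Ident F.FArr_Comp
        F.A.Dom_in F.A.Cod_in F.A.Ident_in F.A.Comp_in)
qed

lemma Obj_ordinal: "Obj (ordinal n) = {..n}"
  and Arr_ordinal: "Arr (ordinal n) = {(i, j). i \<le> j \<and> j \<le> n}"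
  by (simp_all add: ordinal_def)

text \<open>Points of \<open>BC\<close> are named by arbitrary functors \<open>[n] \<rightarrow> C\<close>, so that composites can be used as they
  stand; only \<open>simplex_of\<close> cuts them down to the extensional functors that form the nerve.\<close>

definition simplex_of ::
    "nat \<Rightarrow> ('o, 'a) diagram \<Rightarrow> ('o, 'a) diagram" where
  "simplex_of n G = \<lparr>FObj = (\<lambda>i\<in>Obj (ordinal n). FObj G i), FArr = (\<lambda>a\<in>Arr (ordinal n). FArr G a)\<rparr>"

definition point ::
    "('o, 'a) cat \<Rightarrow> nat \<Rightarrow> ('o, 'a) diagram \<Rightarrow> (nat \<Rightarrow> real) \<Rightarrow> ('o, 'a) class_pt" where
  "point B n G t = cell_class (nerve B) ((n, simplex_of n G), t)"

definition ordinal_map :: "(nat \<Rightarrow> nat) \<Rightarrow> (nat, nat \<times> nat, nat, nat \<times> nat) func" where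
  "ordinal_map \<alpha> = \<lparr>FObj = \<alpha>, FArr = (\<lambda>a. (\<alpha> (fst a), \<alpha> (snd a)))\<rparr>"

lemma mono_mapsD:
  assumes "\<alpha> \<in> mono_maps m n"
  shows "i \<le> j \<Longrightarrow> j \<le> m \<Longrightarrow> \<alpha> i \<le> \<alpha> j" "i \<le> m \<Longrightarrow> \<alpha> i \<le> n"
  using assms by (auto simp: mono_maps_def mono_on_def)

lemma mono_mapsI:
  assumes "\<And>i j. \<lbrakk>i \<le> j; j \<le> m\<rbrakk> \<Longrightarrow> \<alpha> i \<le> \<alpha> j" "\<And>i. i \<le> m \<Longrightarrow> \<alpha> i \<le> n"
  shows "\<alpha> \<in> mono_maps m n"
  using assms by (auto simp: mono_maps_def mono_on_def)

lemma cat_functor_ordinal_map: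
  assumes "\<alpha> \<in> mono_maps m n"
  shows "cat_functor (ordinal m) (ordinal n) (ordinal_map \<alpha>)"
  unfolding cat_functor_def cat_functor_axioms_def
  by (auto simp: category_ordinal) (auto simp: ordinal_def ordinal_map_def mono_mapsD[OF assms])

lemma simplex_of_in_nerve:
  assumes "cat_functor (ordinal n) B G"
  shows "simplex_of n G \<in> simplices (nerve B) n"
proof -
  have "cat_functor (ordinal n) B (simplex_of n G)"
    by (rule cat_functor_cong[OF assms]) (auto simp: simplex_of_def)
  then show ?thesis
    by (simp add: nerve_def) (simp add: simplex_of_def)
qed

lemma nerve_simplex_functor: "x \<in> simplices (nerve B) n \<Longrightarrow> cat_functor (ordinal n) B x"
  by (simp add: nerve_def)

lemma simplex_of_nerve_simplex: "x \<in> simplices (nerve B) n \<Longrightarrow> simplex_of n x = x"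
  by (auto simp: nerve_def simplex_of_def extensional_restrict)

lemma simplex_of_cong:
  assumes "\<And>i. i \<le> n \<Longrightarrow> FObj G' i = FObj G i"
    and "\<And>i j. \<lbrakk>i \<le> j; j \<le> n\<rbrakk> \<Longrightarrow> FArr G' (i, j) = FArr G (i, j)"
  shows "simplex_of n G' = simplex_of n G"
  unfolding simplex_of_def by (auto simp: Obj_ordinal Arr_ordinal intro!: restrict_ext assms)

lemma act_nerve_simplex_of:
  assumes "\<alpha> \<in> mono_maps m n"
  shows "act (nerve B) m \<alpha> (simplex_of n G) = simplex_of m (comp_func G (ordinal_map \<alpha>))"
  by (auto simp: nerve_def simplex_of_def comp_func_def ordinal_map_def Obj_ordinal Arr_ordinal
      mono_mapsD[OF assms] intro!: restrict_ext)

lemma point_cong: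
  assumes "\<And>i. i \<le> n \<Longrightarrow> FObj G' i = FObj G i"
    and "\<And>i j. \<lbrakk>i \<le> j; j \<le> n\<rbrakk> \<Longrightarrow> FArr G' (i, j) = FArr G (i, j)"
  shows "point B n G' t = point B n G t"
  using simplex_of_cong[of n G' G] assms by (simp add: point_def)

text \<open>The gluing relation for nerves. The functor \<open>G'\<close> need only agree with \<open>G \<circ> \<alpha>\<close> on \<open>[m]\<close>.\<close>

lemma point_reindex:
  assumes \<alpha>: "\<alpha> \<in> mono_maps m n" and G: "cat_functor (ordinal n) B G"
    and t: "t \<in> standard_simplex m" "simplex_map m \<alpha> t = t'"
    and o: "\<And>i. i \<le> m \<Longrightarrow> FObj G' i = FObj G (\<alpha> i)"
    and a: "\<And>i j. \<lbrakk>i \<le> j; j \<le> m\<rbrakk> \<Longrightarrow> FArr G' (i, j) = FArr G (\<alpha> i, \<alpha> j)"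
  shows "point B m G' t = point B n G t'"
proof -
  have "simplex_of m G' = act (nerve B) m \<alpha> (simplex_of n G)"
    unfolding act_nerve_simplex_of[OF \<alpha>]
    by (rule simplex_of_cong) (simp_all add: o a comp_func_def ordinal_map_def)
  then show ?thesis
    using cell_class_act[OF \<alpha> simplex_of_in_nerve[OF G] t(1)] by (simp add: point_def t(2))
qed

lemma continuous_map_point:
  assumes "cat_functor (ordinal n) B G"
  shows "continuous_map (top_of_set (standard_simplex n)) (classifying_space B) (point B n G)"
  unfolding point_def[abs_def] classifying_space_def
  by (rule continuous_map_cell[OF simplex_of_in_nerve[OF assms]])

lemma topspace_classifying_space:
  assumes "c \<in> topspace (classifying_space A)"
  obtains n x t where "cat_functor (ordinal n) A x" "t \<in> standard_simplex n" "c = point A n x t"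
proof -
  have "c \<in> cell_class (nerve A) ` topspace (cells (nerve A))"
    using assms quotient_imp_surjective_map[OF quotient_map_cell_class[of "nerve A"]]
    by (simp add: classifying_space_def)
  then obtain n x t where "x \<in> simplices (nerve A) n" "t \<in> standard_simplex n"
      "c = cell_class (nerve A) ((n, x), t)"
    by (metis (no_types, lifting) imageE in_topspace_cells surj_pair)
  then show ?thesis
    by (intro that[of n x t]) (simp_all add: nerve_simplex_functor point_def simplex_of_nerve_simplex)
qed

lemma classifying_map_point:
  assumes F: "cat_functor A B F" and x: "cat_functor (ordinal n) A x"
  shows "classifying_map B F (point A n x t) = point B n (comp_func F x) t"
proof -
  have nm: "nerve_map F k (simplex_of k z) = simplex_of k (comp_func F z)" for k z
    by (auto simp: nerve_map_def simplex_of_def comp_func_def intro!: restrict_ext)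
  have "classifying_map B F (cell_class (nerve A) ((n, simplex_of n x), t))
      = cell_class (nerve B) ((n, nerve_map F n (simplex_of n x)), t)"
    unfolding classifying_map_def
  proof (rule realization_map_cell_class)
    fix k z assume z: "z \<in> simplices (nerve A) k"
    have f: "cat_functor (ordinal k) B (comp_func F z)"
      using cat_functor_comp_func[OF nerve_simplex_functor[OF z] F] .
    show "nerve_map F k z \<in> simplices (nerve B) k"
      using simplex_of_in_nerve[OF f] nm[of k z] by (simp add: simplex_of_nerve_simplex[OF z])
    fix m \<alpha> assume \<alpha>: "\<alpha> \<in> mono_maps m k"
    have "nerve_map F m (act (nerve A) m \<alpha> (simplex_of k z))
        = act (nerve B) m \<alpha> (nerve_map F k (simplex_of k z))"
      unfolding nm act_nerve_simplex_of[OF \<alpha>]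
      by (rule simplex_of_cong) (simp_all add: comp_func_def)
    then show "nerve_map F m (act (nerve A) m \<alpha> z) = act (nerve B) m \<alpha> (nerve_map F k z)"
      by (simp add: simplex_of_nerve_simplex[OF z])
  qed
  then show ?thesis
    by (simp add: point_def nm)
qed

lemma classifying_map_comp_func:
  assumes "cat_functor A B F" "cat_functor B C G" "c \<in> topspace (classifying_space A)"
  shows "classifying_map C (comp_func G F) c = classifying_map C G (classifying_map B F c)"
  using assms(3)
proof (rule topspace_classifying_space)
  fix n x t assume "cat_functor (ordinal n) A x" "c = point A n x t"
  moreover have "comp_func (comp_func G F) x = comp_func G (comp_func F x)"
    by (simp add: comp_func_def o_assoc)
  ultimately show ?thesis
    using assms(1,2) by (simp add: classifying_map_point cat_functor_comp_func)
qed

lemma classifying_map_eq_id: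
  assumes F: "cat_functor A A F"
    and o: "\<And>X. X \<in> Obj A \<Longrightarrow> FObj F X = X" and a: "\<And>a. a \<in> Arr A \<Longrightarrow> FArr F a = a"
    and c: "c \<in> topspace (classifying_space A)"
  shows "classifying_map A F c = c"
  using c
proof (rule topspace_classifying_space)
  fix n x t assume x: "cat_functor (ordinal n) A x" and c: "c = point A n x t"
  have "point A n (comp_func F x) t = point A n x t"
    by (rule point_cong)
      (auto simp: comp_func_def Obj_ordinal Arr_ordinal intro!: o a
        cat_functor.FObj_in[OF x] cat_functor.FArr_in[OF x])
  with c x F show ?thesis
    by (simp add: classifying_map_point)
qed

lemma simplex_map_ident:
  assumes "t \<in> standard_simplex m" shows "simplex_map m (\<lambda>i. i) t = t"
proof
  fix j
  have "{i. i \<le> m \<and> i = j} = (if j \<le> m then {j} else {})" by auto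
  then show "simplex_map m (\<lambda>i. i) t j = t j"
    using assms by (auto simp: simplex_map_def standard_simplex_def)
qed

text \<open>The form of \<open>realization_homotopy\<close> for nerves. Compatibility is asked for every functor \<open>x'\<close> that
  agrees with \<open>x \<circ> \<alpha>\<close> on \<open>[m]\<close>; with \<open>\<alpha>\<close> the identity this includes that \<open>h\<close> ignores values outside \<open>[n]\<close>,
  so that \<open>h\<close> may be evaluated at functors that are not extensional.\<close>

lemma classifying_homotopy:
  fixes h :: "real \<Rightarrow> nat \<Rightarrow> ('o, 'a) diagram \<Rightarrow> (nat \<Rightarrow> real) \<Rightarrow> 'y"
  assumes cont: "\<And>n x. cat_functor (ordinal n) A x \<Longrightarrow>
      continuous_map (prod_topology (top_of_set {0..1}) (top_of_set (standard_simplex n))) Y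
        (\<lambda>(\<tau>, t). h \<tau> n x t)"
    and resp: "\<And>\<tau> m n \<alpha> x x' t. \<lbrakk>0 \<le> \<tau>; \<tau> \<le> 1; \<alpha> \<in> mono_maps m n; cat_functor (ordinal n) A x;
      cat_functor (ordinal m) A x'; t \<in> standard_simplex m;
      \<And>i. i \<le> m \<Longrightarrow> FObj x' i = FObj x (\<alpha> i);
      \<And>i j. \<lbrakk>i \<le> j; j \<le> m\<rbrakk> \<Longrightarrow> FArr x' (i, j) = FArr x (\<alpha> i, \<alpha> j)\<rbrakk>
      \<Longrightarrow> h \<tau> m x' t = h \<tau> n x (simplex_map m \<alpha> t)"
    and 0: "\<And>n x t. \<lbrakk>cat_functor (ordinal n) A x; t \<in> standard_simplex n\<rbrakk>
      \<Longrightarrow> h 0 n x t = u (point A n x t)"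
    and 1: "\<And>n x t. \<lbrakk>cat_functor (ordinal n) A x; t \<in> standard_simplex n\<rbrakk>
      \<Longrightarrow> h 1 n x t = v (point A n x t)"
  shows "homotopic_with (\<lambda>_. True) (classifying_space A) Y u v"
proof -
  let ?h = "\<lambda>\<tau> ((n, x), t). h \<tau> n x t"
  obtain H where H: "continuous_map (prod_topology (top_of_set {0..1}) (realization (nerve A))) Y H"
    and H2: "\<And>\<tau> p. \<lbrakk>\<tau> \<in> {0..1}; p \<in> topspace (cells (nerve A))\<rbrakk>
      \<Longrightarrow> H (\<tau>, cell_class (nerve A) p) = ?h \<tau> p"
  proof (rule realization_homotopy[of "nerve A" Y ?h])
    fix n x assume "x \<in> simplices (nerve A) n"
    then show "continuous_map (prod_topology (top_of_set {0..1}) (top_of_set (standard_simplex n))) Y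
        (\<lambda>(\<tau>, t). ?h \<tau> ((n, x), t))"
      using cont[OF nerve_simplex_functor] by simp
  next
    fix \<tau> :: real and m n \<alpha> x t
    assume \<tau>: "\<tau> \<in> {0..1}" and \<alpha>: "\<alpha> \<in> mono_maps m n" and x: "x \<in> simplices (nerve A) n"
      and t: "t \<in> standard_simplex m"
    let ?x = "act (nerve A) m \<alpha> x"
    have eq: "?x = simplex_of m (comp_func x (ordinal_map \<alpha>))"
      using act_nerve_simplex_of[OF \<alpha>, of A x] simplex_of_nerve_simplex[OF x] by simp
    have "?x \<in> simplices (nerve A) m"
      unfolding eq by (intro simplex_of_in_nerve cat_functor_comp_func[OF cat_functor_ordinal_map[OF \<alpha>]
        nerve_simplex_functor[OF x]])
    then have "h \<tau> m ?x t = h \<tau> n x (simplex_map m \<alpha> t)"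
      using \<tau> by (intro resp \<alpha> nerve_simplex_functor[OF x] nerve_simplex_functor t)
        (auto simp: eq simplex_of_def comp_func_def ordinal_map_def Obj_ordinal Arr_ordinal)
    then show "?h \<tau> ((m, ?x), t) = ?h \<tau> ((n, x), simplex_map m \<alpha> t)"
      by simp
  qed blast
  have H3: "H (\<tau>, point A n x t) = h \<tau> n x t"
    if "\<tau> \<in> {0..1}" and x: "cat_functor (ordinal n) A x" and t: "t \<in> standard_simplex n" for \<tau> n x t
  proof -
    have "H (\<tau>, point A n x t) = h \<tau> n (simplex_of n x) t"
      using H2[OF that(1), of "((n, simplex_of n x), t)"] simplex_of_in_nerve[OF x] t
      by (simp add: in_topspace_cells point_def)
    also have "\<dots> = h \<tau> n x (simplex_map n (\<lambda>i. i) t)"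
      using that(1) by (intro resp x t nerve_simplex_functor[OF simplex_of_in_nerve[OF x]])
        (auto simp: simplex_of_def Obj_ordinal Arr_ordinal intro: mono_mapsI)
    finally show ?thesis
      by (simp add: simplex_map_ident[OF t])
  qed
  show ?thesis
  proof (subst homotopic_with, simp, intro exI conjI ballI)
    show "continuous_map (prod_topology (top_of_set {0..1}) (classifying_space A)) Y H"
      using H by (simp add: classifying_space_def)
    fix c assume "c \<in> topspace (classifying_space A)"
    then show "H (0, c) = u c" "H (1, c) = v c"
      by (auto elim!: topspace_classifying_space simp: H3 0 1)
  qed auto
qed


section \<open>Natural transformations and prisms\<close>

definition nat_trans ::
    "('o1, 'a1) cat \<Rightarrow> ('o2, 'a2) cat \<Rightarrow> ('o1, 'a1, 'o2, 'a2) func \<Rightarrow> ('o1, 'a1, 'o2, 'a2) func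
     \<Rightarrow> ('o1 \<Rightarrow> 'a2) \<Rightarrow> bool" where
  "nat_trans A B F G \<eta> \<longleftrightarrow> cat_functor A B F \<and> cat_functor A B G \<and>
     (\<forall>X\<in>Obj A. \<eta> X \<in> Arr B \<and> Dom B (\<eta> X) = FObj F X \<and> Cod B (\<eta> X) = FObj G X) \<and>
     (\<forall>a\<in>Arr A. Comp B (\<eta> (Cod A a)) (FArr F a) = Comp B (FArr G a) (\<eta> (Dom A a)))"

lemma nat_trans_comp_func:
  assumes "nat_trans A B F G \<eta>" "cat_functor C A x"
  shows "nat_trans C B (comp_func F x) (comp_func G x) (\<lambda>i. \<eta> (FObj x i))"
proof -
  interpret x: cat_functor C A x by fact
  show ?thesis
    using assms x.FObj_in x.FArr_in cat_functor_comp_func[OF assms(2)]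
    by (auto simp: nat_trans_def comp_func_def simp flip: x.Dom_FArr x.Cod_FArr)
qed

text \<open>The prism \<open>[n] \<times> [1]\<close> is the union of the simplices
  \<open>(0,0) < \<dots> < (j,0) < (j,1) < \<dots> < (n,1)\<close>. A point of \<open>\<Delta>\<^sup>n \<times> \<Delta>\<^sup>1\<close> with coordinates \<open>t\<close> and
  \<open>(\<mu>, 1 - \<mu>)\<close> lies in the \<open>j\<close>-th of them if \<open>\<mu>\<close> lies between the partial sums
  \<open>t\<^sub>0 + \<dots> + t\<^sub>j\<^sub>-\<^sub>1\<close> and \<open>t\<^sub>0 + \<dots> + t\<^sub>j\<close>; its coordinates are obtained by cutting the interval
  \<open>[0,1]\<close>, divided into pieces of lengths \<open>t\<^sub>i\<close>, at the point \<open>\<mu>\<close>. A point on the common boundary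
  of several simplices has several such \<open>j\<close>; by \<open>prism_point_eq\<close> the choice does not matter.\<close>

definition prism ::
    "('o, 'a) cat \<Rightarrow> nat \<Rightarrow> ('o, 'a) diagram \<Rightarrow> ('o, 'a) diagram
     \<Rightarrow> (nat \<Rightarrow> 'a) \<Rightarrow> ('o, 'a) diagram" where
  "prism B j G0 G1 \<eta> = \<lparr>
     FObj = (\<lambda>i. if i \<le> j then FObj G0 i else FObj G1 (i - 1)),
     FArr = (\<lambda>(i, k). if k \<le> j then FArr G0 (i, k)
       else if j < i then FArr G1 (i - 1, k - 1) else Comp B (FArr G1 (i, k - 1)) (\<eta> i))\<rparr>"

definition cut_coords :: "real \<Rightarrow> nat \<Rightarrow> (nat \<Rightarrow> real) \<Rightarrow> nat \<Rightarrow> real" where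
  "cut_coords \<mu> j t l = (if l < j then t l else if l = j then \<mu> - (\<Sum>k<j. t k)
     else if l = Suc j then (\<Sum>k\<le>j. t k) - \<mu> else t (l - 1))"

definition cuts_at :: "nat \<Rightarrow> (nat \<Rightarrow> real) \<Rightarrow> real \<Rightarrow> nat \<Rightarrow> bool" where
  "cuts_at n t \<mu> j \<longleftrightarrow> j \<le> n \<and> (\<Sum>k<j. t k) \<le> \<mu> \<and> \<mu> \<le> (\<Sum>k\<le>j. t k)"

definition prism_point ::
    "('o, 'a) cat \<Rightarrow> nat \<Rightarrow> ('o, 'a) diagram \<Rightarrow> ('o, 'a) diagram
     \<Rightarrow> (nat \<Rightarrow> 'a) \<Rightarrow> (nat \<Rightarrow> real) \<Rightarrow> real \<Rightarrow> ('o, 'a) class_pt" where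
  "prism_point B n G0 G1 \<eta> t \<mu> =
     (let j = (SOME j. cuts_at n t \<mu> j) in point B (Suc n) (prism B j G0 G1 \<eta>) (cut_coords \<mu> j t))"

lemma standard_simplexI:
  assumes "\<And>i. 0 \<le> t i" "\<And>i. n < i \<Longrightarrow> t i = 0" "(\<Sum>i\<le>n. t i) = (1::real)"
  shows "t \<in> standard_simplex n"
proof -
  have "t i \<le> 1" for i
  proof (cases "i \<le> n")
    case True
    then show ?thesis
      using assms(1,3) member_le_sum[of i "{..n}" t] by simp
  qed (simp add: assms(2))
  with assms show ?thesis
    by (simp add: standard_simplex_def)
qed

lemma standard_simplexD:
  assumes "t \<in> standard_simplex n"
  shows "0 \<le> t i" "n < i \<Longrightarrow> t i = 0" "(\<Sum>i\<le>n. t i) = 1"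
  using assms by (auto simp: standard_simplex_def)

lemma cut_coords_in_standard_simplex:
  assumes t: "t \<in> standard_simplex n" and j: "cuts_at n t \<mu> j"
  shows "cut_coords \<mu> j t \<in> standard_simplex (Suc n)"
proof (rule standard_simplexI)
  have "j \<le> n" using j by (simp add: cuts_at_def)
  have "(\<Sum>l\<le>Suc k. cut_coords \<mu> j t l) = (\<Sum>l\<le>k. t l)" if "j \<le> k" for k
    using that
  proof (induction k rule: dec_induct)
    case base
    have "(\<Sum>l<j. cut_coords \<mu> j t l) = (\<Sum>l<j. t l)"
      by (rule sum.cong) (simp_all add: cut_coords_def)
    moreover have "(\<Sum>l\<le>Suc j. cut_coords \<mu> j t l) = (\<Sum>l<j. cut_coords \<mu> j t l) + cut_coords \<mu> j t j + cut_coords \<mu> j t (Suc j)"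
      by (simp add: lessThan_Suc_atMost[symmetric])
    ultimately show ?case
      by (simp add: cut_coords_def)
  next
    case (step k)
    then show ?case by (simp add: cut_coords_def)
  qed
  from this[OF \<open>j \<le> n\<close>] show "(\<Sum>l\<le>Suc n. cut_coords \<mu> j t l) = 1"
    using standard_simplexD(3)[OF t] by simp
qed (use t j in \<open>auto simp: cut_coords_def cuts_at_def standard_simplexD\<close>)

lemma cuts_at_exists:
  assumes t: "t \<in> standard_simplex n" and \<mu>: "0 \<le> \<mu>" "\<mu> \<le> 1"
  shows "\<exists>j. cuts_at n t \<mu> j"
proof -
  let ?j = "LEAST j. \<mu> \<le> (\<Sum>k\<le>j. t k)"
  have n: "\<mu> \<le> (\<Sum>k\<le>n. t k)"
    using \<mu> standard_simplexD(3)[OF t] by simp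
  have "(\<Sum>k<?j. t k) \<le> \<mu>"
  proof (cases ?j)
    case (Suc i)
    then have "\<not> \<mu> \<le> (\<Sum>k\<le>i. t k)"
      using not_less_Least[of i "\<lambda>j. \<mu> \<le> (\<Sum>k\<le>j. t k)"] by simp
    then show ?thesis by (simp add: Suc lessThan_Suc_atMost)
  qed (simp add: \<mu>)
  then have "cuts_at n t \<mu> ?j"
    unfolding cuts_at_def by (auto intro: LeastI[of "\<lambda>j. \<mu> \<le> (\<Sum>k\<le>j. t k)", OF n] Least_le n)
  then show ?thesis ..
qed

locale prism_data =
  fixes B :: "('o, 'a) cat" and n :: nat and G0 G1 :: "('o, 'a) diagram"
    and \<eta> :: "nat \<Rightarrow> 'a"
  assumes nat: "nat_trans (ordinal n) B G0 G1 \<eta>"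
begin

sublocale G0: cat_functor "ordinal n" B G0 using nat by (simp add: nat_trans_def)
sublocale G1: cat_functor "ordinal n" B G1 using nat by (simp add: nat_trans_def)

lemma eta: "i \<le> n \<Longrightarrow> \<eta> i \<in> Arr B" "i \<le> n \<Longrightarrow> Dom B (\<eta> i) = FObj G0 i"
    "i \<le> n \<Longrightarrow> Cod B (\<eta> i) = FObj G1 i"
    "i \<le> k \<Longrightarrow> k \<le> n \<Longrightarrow> Comp B (\<eta> k) (FArr G0 (i, k)) = Comp B (FArr G1 (i, k)) (\<eta> i)"
  using nat by (auto simp: nat_trans_def ordinal_def)

lemma cat_functor_prism:
  assumes "j \<le> n" shows "cat_functor (ordinal (Suc n)) B (prism B j G0 G1 \<eta>)"
proof -
  note c = Obj_ordinal Arr_ordinal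
  have dc: "Dom (ordinal k) = fst" "Cod (ordinal k) = snd" "Ident (ordinal k) = (\<lambda>i. (i, i))"
      "Comp (ordinal k) = (\<lambda>b a. (fst a, snd b))" for k
    by (simp_all add: ordinal_def)
  have F0: "i \<le> n \<Longrightarrow> FObj G0 i \<in> Obj B" "i \<le> n \<Longrightarrow> FObj G1 i \<in> Obj B" for i
    using G0.FObj_in[of i] G1.FObj_in[of i] by (auto simp: c)
  have A0: "FArr G0 (i, k) \<in> Arr B \<and> Dom B (FArr G0 (i, k)) = FObj G0 i \<and> Cod B (FArr G0 (i, k)) = FObj G0 k"
    if "i \<le> k" "k \<le> n" for i k
    using that G0.FArr_in[of "(i, k)"] G0.Dom_FArr[of "(i, k)"] G0.Cod_FArr[of "(i, k)"] by (simp add: c dc)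
  have A1: "FArr G1 (i, k) \<in> Arr B \<and> Dom B (FArr G1 (i, k)) = FObj G1 i \<and> Cod B (FArr G1 (i, k)) = FObj G1 k"
    if "i \<le> k" "k \<le> n" for i k
    using that G1.FArr_in[of "(i, k)"] G1.Dom_FArr[of "(i, k)"] G1.Cod_FArr[of "(i, k)"] by (simp add: c dc)
  have I: "FArr G0 (i, i) = Ident B (FObj G0 i)" "FArr G1 (i, i) = Ident B (FObj G1 i)" if "i \<le> n" for i
    using that G0.FArr_Ident[of i] G1.FArr_Ident[of i] by (simp_all add: c dc)
  have K0: "FArr G0 (i, l) = Comp B (FArr G0 (k, l)) (FArr G0 (i, k))" if "i \<le> k" "k \<le> l" "l \<le> n" for i k l
    using that G0.FArr_Comp[of "(i, k)" "(k, l)"] by (simp add: c dc)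
  have K1: "FArr G1 (i, l) = Comp B (FArr G1 (k, l)) (FArr G1 (i, k))" if "i \<le> k" "k \<le> l" "l \<le> n" for i k l
    using that G1.FArr_Comp[of "(i, k)" "(k, l)"] by (simp add: c dc)
  let ?W = "prism B j G0 G1 \<eta>"
  have low: "FArr ?W (i, k) = FArr G0 (i, k)" if "k \<le> j" for i k
    using that by (simp add: prism_def)
  have high: "FArr ?W (i, k) = FArr G1 (i - 1, k - 1)" if "j < i" "i \<le> k" for i k
    using that by (simp add: prism_def)
  have mid: "FArr ?W (i, k) = Comp B (FArr G1 (i, k - 1)) (\<eta> i)" if "i \<le> j" "j < k" for i k
    using that by (simp add: prism_def)
  have W: "FArr ?W (i, k) \<in> Arr B \<and> Dom B (FArr ?W (i, k)) = FObj ?W i \<and> Cod B (FArr ?W (i, k)) = FObj ?W k"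
    if "i \<le> k" "k \<le> Suc n" for i k
  proof -
    consider "k \<le> j" | "j < i" | "i \<le> j" "j < k" by linarith
    then show ?thesis
    proof cases
      case 1
      then show ?thesis using that assms A0[of i k] by (simp add: prism_def)
    next
      case 2
      then show ?thesis using that assms A1[of "i - 1" "k - 1"] by (simp add: prism_def)
    next
      case 3
      then show ?thesis
        using that assms A1[of i "k - 1"] eta[of i]
        by (simp add: prism_def G0.B.Comp_in G0.B.Dom_Comp G0.B.Cod_Comp)
    qed
  qed
  have K: "FArr ?W (i, l) = Comp B (FArr ?W (k, l)) (FArr ?W (i, k))"
    if "i \<le> k" "k \<le> l" "l \<le> Suc n" for i k l
  proof -
    consider "l \<le> j" | "j < i" | "k \<le> j" "j < l" | "i \<le> j" "j < k" by linarith
    then show ?thesis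
    proof cases
      case 1
      then show ?thesis using that assms K0[of i k l] by (simp add: low)
    next
      case 2
      then show ?thesis using that assms K1[of "i - 1" "k - 1" "l - 1"] by (simp add: high)
    next
      case 3
      then have le: "i \<le> j" "i \<le> n" "k \<le> n" "l - 1 \<le> n" "k \<le> l - 1" using that assms by auto
      have "Comp B (FArr ?W (k, l)) (FArr ?W (i, k))
          = Comp B (Comp B (FArr G1 (k, l - 1)) (\<eta> k)) (FArr G0 (i, k))"
        using 3 by (simp add: mid low)
      also have "\<dots> = Comp B (FArr G1 (k, l - 1)) (Comp B (FArr G1 (i, k)) (\<eta> i))"
        using le that A0[of i k] A1[of k "l - 1"] eta[of k]
        by (simp add: eta(4) flip: G0.B.Comp_assoc)
      also have "\<dots> = Comp B (FArr G1 (i, l - 1)) (\<eta> i)"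
        using le that A1[of i k] A1[of k "l - 1"] eta[of i] K1[of i k "l - 1"]
        by (simp add: G0.B.Comp_assoc)
      finally show ?thesis using 3 le by (simp add: mid)
    next
      case 4
      then have le: "i \<le> n" "k - 1 \<le> n" "i \<le> k - 1" "k - 1 \<le> l - 1" "l - 1 \<le> n" "j < l"
        using that assms by auto
      have "Comp B (FArr ?W (k, l)) (FArr ?W (i, k))
          = Comp B (FArr G1 (k - 1, l - 1)) (Comp B (FArr G1 (i, k - 1)) (\<eta> i))"
        using 4 that by (simp add: mid high)
      also have "\<dots> = Comp B (FArr G1 (i, l - 1)) (\<eta> i)"
        using le A1[of i "k - 1"] A1[of "k - 1" "l - 1"] eta[of i] K1[of i "k - 1" "l - 1"]
        by (simp add: G0.B.Comp_assoc)
      finally show ?thesis using 4 le by (simp add: mid)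
    qed
  qed
  show ?thesis
  proof (intro cat_functor.intro cat_functor_axioms.intro category_ordinal G0.B.category_axioms)
    fix X assume X: "X \<in> Obj (ordinal (Suc n))"
    then show "FObj ?W X \<in> Obj B"
      using assms F0 by (auto simp: prism_def c)
    from X show "FArr ?W (Ident (ordinal (Suc n)) X) = Ident B (FObj ?W X)"
      using assms by (auto simp: dc prism_def c I)
  next
    fix f g
    assume "f \<in> Arr (ordinal (Suc n))" "g \<in> Arr (ordinal (Suc n))"
      "Dom (ordinal (Suc n)) g = Cod (ordinal (Suc n)) f"
    then show "FArr ?W (Comp (ordinal (Suc n)) g f) = Comp B (FArr ?W g) (FArr ?W f)"
      using K[of "fst f" "snd f" "snd g"] by (cases f; cases g) (simp add: c dc)
  qed (use W in \<open>auto simp: c dc\<close>)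
qed

text \<open>The \<open>j\<close>-th and the \<open>(j + 1)\<close>-st simplex of the prism differ only in the vertex \<open>j + 1\<close>. At a point
  that lies in both its coordinate is \<open>0\<close>, so the point comes from their common face opposite to it.\<close>

lemma point_prism_Suc:
  assumes t: "t \<in> standard_simplex n" and j: "cuts_at n t \<mu> j" "cuts_at n t \<mu> (Suc j)"
  shows "point B (Suc n) (prism B j G0 G1 \<eta>) (cut_coords \<mu> j t)
       = point B (Suc n) (prism B (Suc j) G0 G1 \<eta>) (cut_coords \<mu> (Suc j) t)"
proof -
  \<comment> \<open>the face map that omits the vertex \<open>j + 1\<close>\<close>
  let ?\<delta> = "\<lambda>i. if i \<le> j then i else Suc i"
  have \<delta>: "?\<delta> \<in> mono_maps n (Suc n)" by (rule mono_mapsI) auto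
  have \<mu>: "\<mu> = (\<Sum>k\<le>j. t k)" using j by (auto simp: cuts_at_def lessThan_Suc_atMost)
  have "simplex_map n ?\<delta> t l = cut_coords \<mu> j t l" for l
  proof -
    have "{i. i \<le> n \<and> ?\<delta> i = l} = (if l \<le> j \<and> l \<le> n then {l} else if Suc j < l \<and> l \<le> Suc n then {l - 1} else {})"
      by (auto split: if_splits)
    then show ?thesis
      using standard_simplexD(2)[OF t] j
      by (auto simp: simplex_map_def cut_coords_def \<mu> lessThan_Suc_atMost[symmetric] cuts_at_def)
  qed
  then have s: "simplex_map n ?\<delta> t = cut_coords \<mu> j t" by blast
  have s': "cut_coords \<mu> (Suc j) t = cut_coords \<mu> j t"
    by (auto simp: cut_coords_def fun_eq_iff \<mu> lessThan_Suc_atMost[symmetric])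
  have le: "j \<le> n" "Suc j \<le> n" using j by (auto simp: cuts_at_def)
  let ?K = "comp_func (prism B j G0 G1 \<eta>) (ordinal_map ?\<delta>)"
  have "point B n ?K t = point B (Suc n) (prism B j G0 G1 \<eta>) (cut_coords \<mu> j t)"
    by (rule point_reindex[OF \<delta> cat_functor_prism[OF le(1)] t s])
      (simp_all add: comp_func_def ordinal_map_def)
  moreover have "point B n ?K t = point B (Suc n) (prism B (Suc j) G0 G1 \<eta>) (cut_coords \<mu> j t)"
    by (rule point_reindex[OF \<delta> cat_functor_prism[OF le(2)] t s])
      (auto simp: comp_func_def ordinal_map_def prism_def)
  ultimately show ?thesis by (simp add: s')
qed

lemma prism_point_eq:
  assumes t: "t \<in> standard_simplex n" and j: "cuts_at n t \<mu> j"
  shows "prism_point B n G0 G1 \<eta> t \<mu> = point B (Suc n) (prism B j G0 G1 \<eta>) (cut_coords \<mu> j t)"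
proof -
  let ?p = "\<lambda>j. point B (Suc n) (prism B j G0 G1 \<eta>) (cut_coords \<mu> j t)"
  have mono: "(\<Sum>k<a. t k) \<le> (\<Sum>k<b. t k)" if "a \<le> b" for a b
    by (rule sum_mono2) (use that standard_simplexD(1)[OF t] in auto)
  have eq: "?p a = ?p b" if "a \<le> b" "cuts_at n t \<mu> a" "cuts_at n t \<mu> b" for a b
  proof -
    have c: "cuts_at n t \<mu> k" if "a \<le> k" "k \<le> b" for k
      using that \<open>cuts_at n t \<mu> a\<close> \<open>cuts_at n t \<mu> b\<close> mono[of k b] mono[of "Suc a" "Suc k"]
      by (auto simp: cuts_at_def lessThan_Suc_atMost)
    from \<open>a \<le> b\<close> show ?thesis
    proof (induction rule: dec_induct)
      case (step k)
      then show ?case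
        using point_prism_Suc[OF t, of \<mu> k] c[of k] c[of "Suc k"] by simp
    qed simp
  qed
  have "cuts_at n t \<mu> (SOME j. cuts_at n t \<mu> j)"
    using j by (rule someI)
  with j eq show ?thesis
    unfolding prism_point_def Let_def by (metis nle_le)
qed

lemma continuous_map_prism_point:
  "continuous_map (top_of_set (standard_simplex n \<times> {0..1})) (classifying_space B)
     (\<lambda>(t, \<mu>). prism_point B n G0 G1 \<eta> t \<mu>)"
proof -
  let ?P = "standard_simplex n \<times> {0..1::real}"
  let ?T = "\<lambda>j. {z \<in> ?P. (\<Sum>k<j. fst z k) \<le> snd z \<and> snd z \<le> (\<Sum>k\<le>j. fst z k)}"
  have snd: "continuous_on A (snd :: (nat \<Rightarrow> real) \<times> real \<Rightarrow> real)" for A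
    by (rule continuous_on_snd[OF continuous_on_id])
  have coord: "continuous_on A (\<lambda>z. fst z k)" for A :: "((nat \<Rightarrow> real) \<times> real) set" and k
    using continuous_on_fst[OF continuous_on_id] by (rule continuous_on_product_then_coordinatewise)
  have cont: "continuous_on A (\<lambda>z. \<Sum>k\<in>K. fst z k)" for A :: "((nat \<Rightarrow> real) \<times> real) set" and K
    by (rule continuous_on_sum) (rule coord)
  show ?thesis
  proof (rule pasting_lemma_closed[where I = "{..n}" and T = ?T
        and f = "\<lambda>j (t, \<mu>). point B (Suc n) (prism B j G0 G1 \<eta>) (cut_coords \<mu> j t)"])
    fix j assume j: "j \<in> {..n}"
    have eq: "?T j = ?P \<inter> ({z. (\<Sum>k<j. fst z k) \<le> snd z} \<inter> {z. snd z \<le> (\<Sum>k\<le>j. fst z k)})"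
      by auto
    have cl: "closed ({z::(nat \<Rightarrow> real) \<times> real. (\<Sum>k<j. fst z k) \<le> snd z} \<inter> {z. snd z \<le> (\<Sum>k\<le>j. fst z k)})"
      by (rule closed_Int; rule closed_Collect_le) (rule cont snd)+
    show "closedin (top_of_set ?P) (?T j)"
      unfolding eq by (rule closedin_closed_Int[OF cl])
    have "continuous_on (?T j) (\<lambda>z. cut_coords (snd z) j (fst z) l)" for l
      unfolding cut_coords_def
      by (cases "l < j"; cases "l = j"; cases "l = Suc j") (simp_all add: cont continuous_on_diff snd coord)
    then have "continuous_on (?T j) (\<lambda>z. cut_coords (snd z) j (fst z))"
      by (rule continuous_on_coordinatewise_then_product)
    moreover have "cut_coords (snd z) j (fst z) \<in> standard_simplex (Suc n)" if "z \<in> ?T j" for z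
      using that j by (intro cut_coords_in_standard_simplex) (auto simp: cuts_at_def)
    ultimately have "continuous_map (top_of_set (?T j)) (top_of_set (standard_simplex (Suc n)))
        (\<lambda>z. cut_coords (snd z) j (fst z))"
      by (auto simp: continuous_map_in_subtopology)
    then have "continuous_map (top_of_set (?T j)) (classifying_space B)
        (point B (Suc n) (prism B j G0 G1 \<eta>) \<circ> (\<lambda>z. cut_coords (snd z) j (fst z)))"
      by (rule continuous_map_compose) (use j in \<open>auto intro!: continuous_map_point cat_functor_prism\<close>)
    moreover have "subtopology (top_of_set ?P) (?T j) = top_of_set (?T j)"
      unfolding subtopology_subtopology by (rule arg_cong[where f = top_of_set]) blast
    ultimately show "continuous_map (subtopology (top_of_set ?P) (?T j)) (classifying_space B)
        (\<lambda>(t, \<mu>). point B (Suc n) (prism B j G0 G1 \<eta>) (cut_coords \<mu> j t))"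
      by (simp add: o_def case_prod_unfold)
  next
    fix i j z assume "i \<in> {..n}" "j \<in> {..n}" "z \<in> topspace (top_of_set ?P) \<inter> ?T i \<inter> ?T j"
    then show "(\<lambda>(t, \<mu>). point B (Suc n) (prism B i G0 G1 \<eta>) (cut_coords \<mu> i t)) z
        = (\<lambda>(t, \<mu>). point B (Suc n) (prism B j G0 G1 \<eta>) (cut_coords \<mu> j t)) z"
      using prism_point_eq[of "fst z" "snd z" i] prism_point_eq[of "fst z" "snd z" j]
      by (auto simp: cuts_at_def)
  next
    fix z assume "z \<in> topspace (top_of_set ?P)"
    then obtain t \<mu> where z: "z = (t, \<mu>)" "t \<in> standard_simplex n" "0 \<le> \<mu>" "\<mu> \<le> 1"
      by auto
    then obtain j where "cuts_at n t \<mu> j"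
      using cuts_at_exists by blast
    then show "\<exists>j. j \<in> {..n} \<and> z \<in> ?T j \<and> (\<lambda>(t, \<mu>). prism_point B n G0 G1 \<eta> t \<mu>) z
        = (\<lambda>(t, \<mu>). point B (Suc n) (prism B j G0 G1 \<eta>) (cut_coords \<mu> j t)) z"
      using z prism_point_eq[of t \<mu> j] by (auto simp: cuts_at_def intro!: exI[of _ j])
  qed simp
qed

lemma prism_point_source:
  assumes t: "t \<in> standard_simplex n"
  shows "prism_point B n G0 G1 \<eta> t 1 = point B n G0 t"
proof -
  have sum: "(\<Sum>k<n. t k) + t n = 1"
    using standard_simplexD(3)[OF t] by (simp add: lessThan_Suc_atMost[symmetric])
  then have j: "cuts_at n t 1 n"
    using standard_simplexD(1)[OF t, of n] standard_simplexD(3)[OF t] by (simp add: cuts_at_def)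
  have "cut_coords 1 n t = t"
    using sum standard_simplexD(2,3)[OF t] by (auto simp: cut_coords_def fun_eq_iff)
  then have s: "simplex_map n (\<lambda>i. i) t = cut_coords 1 n t"
    by (simp add: simplex_map_ident[OF t])
  have "point B n G0 t = point B (Suc n) (prism B n G0 G1 \<eta>) (cut_coords 1 n t)"
    by (rule point_reindex[OF _ cat_functor_prism[OF order_refl] t s])
      (auto simp: prism_def intro: mono_mapsI)
  then show ?thesis
    using prism_point_eq[OF t j] by simp
qed

lemma prism_point_target:
  assumes t: "t \<in> standard_simplex n"
  shows "prism_point B n G0 G1 \<eta> t 0 = point B n G1 t"
proof -
  have j: "cuts_at n t 0 0"
    using standard_simplexD[OF t] by (auto simp: cuts_at_def)
  have "simplex_map n Suc t l = cut_coords 0 0 t l" for l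
  proof -
    have "{i. i \<le> n \<and> Suc i = l} = (if 0 < l \<and> l \<le> Suc n then {l - 1} else {})"
      by auto
    then show ?thesis
      using standard_simplexD(2)[OF t] by (auto simp: simplex_map_def cut_coords_def)
  qed
  then have s: "simplex_map n Suc t = cut_coords 0 0 t" by blast
  have "point B n G1 t = point B (Suc n) (prism B 0 G0 G1 \<eta>) (cut_coords 0 0 t)"
    by (rule point_reindex[OF _ cat_functor_prism t s]) (auto simp: prism_def intro: mono_mapsI)
  then show ?thesis
    using prism_point_eq[OF t j] by simp
qed

end

lemma simplex_map_sum:
  assumes "finite K"
  shows "(\<Sum>k\<in>K. simplex_map m \<alpha> t k) = (\<Sum>i | i \<le> m \<and> \<alpha> i \<in> K. t i)"
proof -
  have "(\<Sum>i | i \<le> m \<and> \<alpha> i \<in> K. t i)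
      = (\<Sum>k\<in>K. \<Sum>i | i \<in> {i. i \<le> m \<and> \<alpha> i \<in> K} \<and> \<alpha> i = k. t i)"
    by (rule sum.group[symmetric]) (use assms in auto)
  also have "\<dots> = (\<Sum>k\<in>K. simplex_map m \<alpha> t k)"
    unfolding simplex_map_def by (intro sum.cong refl) auto
  finally show ?thesis ..
qed

lemma simplex_map_in_standard_simplex:
  assumes \<alpha>: "\<alpha> \<in> mono_maps m n" and t: "t \<in> standard_simplex m"
  shows "simplex_map m \<alpha> t \<in> standard_simplex n"
proof (rule standard_simplexI)
  show "0 \<le> simplex_map m \<alpha> t i" for i
    unfolding simplex_map_def by (intro sum_nonneg standard_simplexD(1)[OF t])
  show "simplex_map m \<alpha> t i = 0" if "n < i" for i
    unfolding simplex_map_def using that mono_mapsD(2)[OF \<alpha>] by (intro sum.neutral) force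
  have "{i. i \<le> m \<and> \<alpha> i \<in> {..n}} = {..m}"
    using mono_mapsD(2)[OF \<alpha>] by auto
  then show "(\<Sum>i\<le>n. simplex_map m \<alpha> t i) = 1"
    by (simp only: simplex_map_sum[OF finite_atMost] standard_simplexD(3)[OF t])
qed

text \<open>A monotone map \<open>\<alpha>\<close> sends the cut at \<open>j\<close> to the cut at \<open>\<alpha> j\<close>; on the vertices of the prism it
  is \<open>\<alpha>\<close> below the cut and a shifted copy of \<open>\<alpha>\<close> above it.\<close>

lemma cut_coords_simplex_map:
  assumes \<alpha>: "\<alpha> \<in> mono_maps m n" and t: "t \<in> standard_simplex m" and j: "cuts_at m t \<mu> j"
  defines "\<beta> \<equiv> \<lambda>i. if i \<le> j then \<alpha> i else Suc (\<alpha> (i - 1))"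
  shows "cuts_at n (simplex_map m \<alpha> t) \<mu> (\<alpha> j)"
    and "simplex_map (Suc m) \<beta> (cut_coords \<mu> j t) = cut_coords \<mu> (\<alpha> j) (simplex_map m \<alpha> t)"
proof -
  let ?J = "\<alpha> j" and ?S = "simplex_map m \<alpha> t"
  note nonneg = standard_simplexD(1)[OF t] and mono = mono_mapsD(1)[OF \<alpha>]
  have jm: "j \<le> m" and lo: "(\<Sum>k<j. t k) \<le> \<mu>" and hi: "\<mu> \<le> (\<Sum>k\<le>j. t k)"
    using j by (auto simp: cuts_at_def)
  have lt: "(\<Sum>k<?J. ?S k) = (\<Sum>i | i \<le> m \<and> \<alpha> i < ?J. t i)"
    and le: "(\<Sum>k\<le>?J. ?S k) = (\<Sum>i | i \<le> m \<and> \<alpha> i \<le> ?J. t i)"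
    by (simp_all add: simplex_map_sum)
  have below: "i < j" if "i \<le> m" "\<alpha> i < ?J" for i
    using mono[of j i] that by (meson leD not_less)
  have above: "j < i" if "i \<le> m" "?J < \<alpha> i" for i
    using mono[of i j] that jm by (meson leD not_less)
  have ge: "?J \<le> \<alpha> (i - 1)" if "j < i" "i \<le> Suc m" for i
    using that mono[of j "i - 1"] by simp
  have "(\<Sum>i | i \<le> m \<and> \<alpha> i < ?J. t i) \<le> (\<Sum>k<j. t k)"
    by (rule sum_mono2) (use below nonneg in auto)
  moreover have "(\<Sum>k\<le>j. t k) \<le> (\<Sum>i | i \<le> m \<and> \<alpha> i \<le> ?J. t i)"
    by (rule sum_mono2) (use jm mono nonneg in auto)
  ultimately show "cuts_at n ?S \<mu> ?J"
    using lo hi mono_mapsD(2)[OF \<alpha> jm] by (simp add: cuts_at_def lt le)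
  show "simplex_map (Suc m) \<beta> (cut_coords \<mu> j t) = cut_coords \<mu> ?J ?S"
  proof
    fix l
    consider "l < ?J" | "l = ?J" | "l = Suc ?J" | "Suc ?J < l" by linarith
    then show "simplex_map (Suc m) \<beta> (cut_coords \<mu> j t) l = cut_coords \<mu> ?J ?S l"
    proof cases
      case 1
      have "{i. i \<le> Suc m \<and> \<beta> i = l} = {i. i \<le> m \<and> \<alpha> i = l}"
      proof (intro Collect_cong iffI conjI)
        fix i assume i: "i \<le> Suc m \<and> \<beta> i = l"
        then show "i \<le> m" "\<alpha> i = l"
          using 1 ge[of i] jm by (auto simp: \<beta>_def not_le split: if_splits)
      next
        fix i assume i: "i \<le> m \<and> \<alpha> i = l"
        then show "i \<le> Suc m" "\<beta> i = l"
          using 1 below[of i] by (auto simp: \<beta>_def)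
      qed
      moreover have "cut_coords \<mu> j t i = t i" if "i \<in> {i. i \<le> m \<and> \<alpha> i = l}" for i
        using that 1 below[of i] by (simp add: cut_coords_def)
      ultimately show ?thesis
        using 1 by (simp add: simplex_map_def cut_coords_def)
    next
      case 2
      have "{i. i \<le> Suc m \<and> \<beta> i = l} = insert j {i. i < j \<and> \<alpha> i = ?J}" (is "_ = insert j ?E")
      proof (intro equalityI subsetI)
        fix i assume "i \<in> {i. i \<le> Suc m \<and> \<beta> i = l}"
        then show "i \<in> insert j ?E"
          using 2 ge[of i] by (cases "j < i") (auto simp: \<beta>_def)
      qed (use 2 jm in \<open>auto simp: \<beta>_def\<close>)
      then have "simplex_map (Suc m) \<beta> (cut_coords \<mu> j t) l = \<mu> - (\<Sum>k<j. t k) + (\<Sum>i\<in>?E. t i)"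
        by (simp add: simplex_map_def) (simp add: cut_coords_def)
      also have "(\<Sum>k<j. t k) = (\<Sum>i\<in>?E. t i) + (\<Sum>i | i \<le> m \<and> \<alpha> i < ?J. t i)"
      proof -
        have "{..<j} = ?E \<union> {i. i \<le> m \<and> \<alpha> i < ?J}"
          using below mono[of _ j] jm by (auto simp: order.order_iff_strict)
        then show ?thesis
          by (simp add: sum.union_disjoint[symmetric] disjoint_iff)
      qed
      also have "\<mu> - ((\<Sum>i\<in>?E. t i) + (\<Sum>i | i \<le> m \<and> \<alpha> i < ?J. t i)) + (\<Sum>i\<in>?E. t i) = cut_coords \<mu> ?J ?S l"
        using 2 lt by (simp add: cut_coords_def)
      finally show ?thesis .
    next
      case 3
      let ?E = "{k. j < k \<and> k \<le> m \<and> \<alpha> k = ?J}"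
      have "{i. i \<le> Suc m \<and> \<beta> i = l} = insert (Suc j) (Suc ` ?E)"
      proof (intro equalityI subsetI)
        fix i assume i: "i \<in> {i. i \<le> Suc m \<and> \<beta> i = l}"
        then have "j < i"
          using 3 mono[of i j] jm by (cases "j < i") (auto simp: \<beta>_def)
        then obtain k where "i = Suc k" by (cases i) auto
        with i \<open>j < i\<close> 3 show "i \<in> insert (Suc j) (Suc ` ?E)"
          by (cases "k = j") (auto simp: \<beta>_def)
      qed (use 3 jm in \<open>auto simp: \<beta>_def\<close>)
      moreover have "finite (Suc ` ?E)" "Suc j \<notin> Suc ` ?E"
        by auto
      ultimately have "simplex_map (Suc m) \<beta> (cut_coords \<mu> j t) l
          = cut_coords \<mu> j t (Suc j) + (\<Sum>i\<in>Suc ` ?E. cut_coords \<mu> j t i)"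
        by (simp only: simplex_map_def) (rule sum.insert)
      also have "cut_coords \<mu> j t (Suc j) = (\<Sum>k\<le>j. t k) - \<mu>"
        by (simp add: cut_coords_def)
      also have "(\<Sum>i\<in>Suc ` ?E. cut_coords \<mu> j t i) = (\<Sum>k\<in>?E. t k)"
        by (simp add: sum.reindex) (auto simp: cut_coords_def intro: sum.cong)
      also have "(\<Sum>k\<le>j. t k) - \<mu> + (\<Sum>k\<in>?E. t k) = (\<Sum>i | i \<le> m \<and> \<alpha> i \<le> ?J. t i) - \<mu>"
      proof -
        have "{i. i \<le> m \<and> \<alpha> i \<le> ?J} = {..j} \<union> ?E"
          using mono[of _ j] mono[of j] jm by (auto simp: not_le intro: antisym)
        then show ?thesis
          by (simp add: sum.union_disjoint disjoint_iff)
      qed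
      also have "\<dots> = cut_coords \<mu> ?J ?S l"
        using 3 le by (simp add: cut_coords_def)
      finally show ?thesis .
    next
      case 4
      let ?E = "{k. k \<le> m \<and> \<alpha> k = l - 1}"
      have "{i. i \<le> Suc m \<and> \<beta> i = l} = Suc ` ?E"
      proof (intro equalityI subsetI)
        fix i assume i: "i \<in> {i. i \<le> Suc m \<and> \<beta> i = l}"
        then have "j < i"
          using 4 mono[of i j] jm by (cases "j < i") (auto simp: \<beta>_def)
        then obtain k where "i = Suc k" by (cases i) auto
        with i \<open>j < i\<close> 4 show "i \<in> Suc ` ?E"
          by (auto simp: \<beta>_def)
      next
        fix i assume "i \<in> Suc ` ?E"
        then obtain k where k: "i = Suc k" "k \<le> m" "\<alpha> k = l - 1" by auto
        then have "?J < \<alpha> k" using 4 by linarith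
        with k 4 above[of k] show "i \<in> {i. i \<le> Suc m \<and> \<beta> i = l}"
          by (auto simp: \<beta>_def)
      qed
      then have "simplex_map (Suc m) \<beta> (cut_coords \<mu> j t) l = (\<Sum>k\<in>?E. cut_coords \<mu> j t (Suc k))"
        by (simp add: simplex_map_def sum.reindex)
      also have "\<dots> = (\<Sum>k\<in>?E. t k)"
        using 4 above by (intro sum.cong) (force simp: cut_coords_def)+
      also have "\<dots> = cut_coords \<mu> ?J ?S l"
        using 4 by (simp add: cut_coords_def simplex_map_def)
      finally show ?thesis .
    qed
  qed
qed

text \<open>Prisms are natural in \<open>[n]\<close>, so that the prisms over all simplices fit together to a homotopy.\<close>

lemma prism_point_reindex:
  assumes nt: "nat_trans (ordinal n) B G0 G1 \<eta>" "nat_trans (ordinal m) B G0' G1' \<eta>'"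
    and \<alpha>: "\<alpha> \<in> mono_maps m n" and t: "t \<in> standard_simplex m" and \<mu>: "0 \<le> \<mu>" "\<mu> \<le> 1"
    and o: "\<And>i. i \<le> m \<Longrightarrow> FObj G0' i = FObj G0 (\<alpha> i)" "\<And>i. i \<le> m \<Longrightarrow> FObj G1' i = FObj G1 (\<alpha> i)"
    and a: "\<And>i j. \<lbrakk>i \<le> j; j \<le> m\<rbrakk> \<Longrightarrow> FArr G0' (i, j) = FArr G0 (\<alpha> i, \<alpha> j)"
      "\<And>i j. \<lbrakk>i \<le> j; j \<le> m\<rbrakk> \<Longrightarrow> FArr G1' (i, j) = FArr G1 (\<alpha> i, \<alpha> j)"
    and e: "\<And>i. i \<le> m \<Longrightarrow> \<eta>' i = \<eta> (\<alpha> i)"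
  shows "prism_point B m G0' G1' \<eta>' t \<mu> = prism_point B n G0 G1 \<eta> (simplex_map m \<alpha> t) \<mu>"
proof -
  interpret N: prism_data B n G0 G1 \<eta> by unfold_locales fact
  interpret M: prism_data B m G0' G1' \<eta>' by unfold_locales fact
  obtain j where j: "cuts_at m t \<mu> j"
    using cuts_at_exists[OF t \<mu>] by blast
  then have jm: "j \<le> m" by (simp add: cuts_at_def)
  note mono = mono_mapsD(1)[OF \<alpha>]
  let ?\<beta> = "\<lambda>i. if i \<le> j then \<alpha> i else Suc (\<alpha> (i - 1))"
  note cut = cut_coords_simplex_map[OF \<alpha> t j]
  have \<beta>: "?\<beta> \<in> mono_maps (Suc m) (Suc n)"
  proof (rule mono_mapsI)
    fix i k :: nat assume ik: "i \<le> k" "k \<le> Suc m"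
    consider "k \<le> j" | "i \<le> j" "j < k" | "j < i" using ik by linarith
    then show "?\<beta> i \<le> ?\<beta> k"
    proof cases
      case 1
      then show ?thesis using ik jm mono[of i k] by simp
    next
      case 2
      then have "i \<le> k - 1" "k - 1 \<le> m" using ik by auto
      with 2 show ?thesis using mono[of i "k - 1"] by simp
    next
      case 3
      then show ?thesis using ik mono[of "i - 1" "k - 1"] by simp
    qed
  next
    fix i :: nat assume "i \<le> Suc m"
    then show "?\<beta> i \<le> Suc n"
      using jm mono_mapsD(2)[OF \<alpha>, of i] mono_mapsD(2)[OF \<alpha>, of "i - 1"] by (auto simp: le_diff_conv)
  qed
  have \<beta>j: "?\<beta> i \<le> \<alpha> j \<longleftrightarrow> i \<le> j" if "i \<le> Suc m" for i
  proof (cases "i \<le> j")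
    case False
    then have "\<alpha> j \<le> \<alpha> (i - 1)" using that mono[of j "i - 1"] by simp
    with False show ?thesis by simp
  qed (use mono[of i j] jm in simp)
  have "point B (Suc m) (prism B j G0' G1' \<eta>') (cut_coords \<mu> j t)
      = point B (Suc n) (prism B (\<alpha> j) G0 G1 \<eta>) (cut_coords \<mu> (\<alpha> j) (simplex_map m \<alpha> t))"
  proof (rule point_reindex[OF \<beta> N.cat_functor_prism cut_coords_in_standard_simplex[OF t j] cut(2)])
    show "\<alpha> j \<le> n" using mono_mapsD(2)[OF \<alpha> jm] .
    fix i assume i: "i \<le> Suc m"
    show "FObj (prism B j G0' G1' \<eta>') i = FObj (prism B (\<alpha> j) G0 G1 \<eta>) (?\<beta> i)"
      using \<beta>j[OF i] i jm o by (auto simp: prism_def)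
  next
    fix i k assume ik: "i \<le> k" "k \<le> Suc m"
    consider "k \<le> j" | "i \<le> j" "j < k" | "j < i" using ik by linarith
    then show "FArr (prism B j G0' G1' \<eta>') (i, k) = FArr (prism B (\<alpha> j) G0 G1 \<eta>) (?\<beta> i, ?\<beta> k)"
    proof cases
      case 1
      then show ?thesis using ik jm a(1)[of i k] \<beta>j[of k] by (simp add: prism_def)
    next
      case 2
      then have "\<alpha> i \<le> \<alpha> j" "\<not> Suc (\<alpha> (k - 1)) \<le> \<alpha> j"
        using ik \<beta>j[of k] \<beta>j[of i] by auto
      with 2 ik jm a(2)[of i "k - 1"] e[of i] show ?thesis by (simp add: prism_def)
    next
      case 3
      then have "\<not> Suc (\<alpha> (k - 1)) \<le> \<alpha> j" "\<alpha> j < Suc (\<alpha> (i - 1))"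
        using ik \<beta>j[of k] \<beta>j[of i] by auto
      with 3 ik a(2)[of "i - 1" "k - 1"] show ?thesis by (simp add: prism_def)
    qed
  qed
  then show ?thesis
    using M.prism_point_eq[OF t j] N.prism_point_eq[OF simplex_map_in_standard_simplex[OF \<alpha> t] cut(1)]
    by simp
qed

text \<open>The prism of an identity transformation is degenerate: each of its simplices is the image of \<open>G0\<close>
  under the degeneracy that doubles the vertex \<open>j\<close>.\<close>

lemma prism_point_ident:
  assumes nt: "nat_trans (ordinal n) B G0 G1 \<eta>" and t: "t \<in> standard_simplex n"
    and \<mu>: "0 \<le> \<mu>" "\<mu> \<le> 1"
    and o: "\<And>i. i \<le> n \<Longrightarrow> FObj G1 i = FObj G0 i"
    and a: "\<And>i j. \<lbrakk>i \<le> j; j \<le> n\<rbrakk> \<Longrightarrow> FArr G1 (i, j) = FArr G0 (i, j)"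
    and e: "\<And>i. i \<le> n \<Longrightarrow> \<eta> i = Ident B (FObj G0 i)"
  shows "prism_point B n G0 G1 \<eta> t \<mu> = point B n G0 t"
proof -
  interpret N: prism_data B n G0 G1 \<eta> by unfold_locales fact
  obtain j where j: "cuts_at n t \<mu> j"
    using cuts_at_exists[OF t \<mu>] by blast
  then have jn: "j \<le> n" by (simp add: cuts_at_def)
  let ?\<sigma> = "\<lambda>i. if i \<le> j then i else i - 1"
  have "simplex_map (Suc n) ?\<sigma> (cut_coords \<mu> j t) l = t l" for l
  proof -
    have "{i. i \<le> Suc n \<and> ?\<sigma> i = l}
        = (if l < j then {l} else if l = j then {j, Suc j} else if l \<le> n then {Suc l} else {})"
      using jn by (auto split: if_splits)
    then show ?thesis
      using standard_simplexD(2)[OF t] jn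
      by (auto simp: simplex_map_def cut_coords_def lessThan_Suc_atMost[symmetric])
  qed
  then have s: "simplex_map (Suc n) ?\<sigma> (cut_coords \<mu> j t) = t" by blast
  have "point B (Suc n) (prism B j G0 G1 \<eta>) (cut_coords \<mu> j t) = point B n G0 t"
  proof (rule point_reindex[OF _ N.G0.cat_functor_axioms cut_coords_in_standard_simplex[OF t j] s])
    fix i k assume ik: "i \<le> k" "k \<le> Suc n"
    have "Comp B (FArr G0 (i, k - 1)) (Ident B (FObj G0 i)) = FArr G0 (i, k - 1)" if "i \<le> j" "j < k"
    proof -
      have "i \<le> k - 1" "k - 1 \<le> n" using that ik by auto
      then show ?thesis
        using N.G0.FArr_in[of "(i, k - 1)"] N.G0.Dom_FArr[of "(i, k - 1)"]
          N.G0.B.Ident_right[of "FArr G0 (i, k - 1)"] by (simp add: ordinal_def)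
    qed
    then show "FArr (prism B j G0 G1 \<eta>) (i, k) = FArr G0 (?\<sigma> i, ?\<sigma> k)"
      using ik jn by (auto simp: prism_def a e)
  qed (use jn in \<open>auto simp: prism_def o intro!: mono_mapsI\<close>)
  then show ?thesis
    using N.prism_point_eq[OF t j] by simp
qed

lemma continuous_map_reverse_time:
  fixes S :: "(nat \<Rightarrow> real) set"
  assumes "continuous_map (top_of_set (S \<times> {0..1::real})) Y g"
  shows "continuous_map (prod_topology (top_of_set {0..1}) (top_of_set S)) Y (\<lambda>(\<tau>, t). g (t, 1 - \<tau>))"
proof -
  have "continuous_on ({0..1} \<times> S) (\<lambda>z::real \<times> (nat \<Rightarrow> real). (snd z, 1 - fst z))"
    by (intro continuous_on_Pair continuous_on_diff continuous_on_const continuous_on_fst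
        continuous_on_snd continuous_on_id)
  then have "continuous_map (top_of_set ({0..1} \<times> S)) (top_of_set (S \<times> {0..1}))
      (\<lambda>z::real \<times> (nat \<Rightarrow> real). (snd z, 1 - fst z))"
    by (auto simp: continuous_map_in_subtopology)
  from continuous_map_compose[OF this assms] show ?thesis
    by (simp add: o_def case_prod_unfold prod_topology_subtopology_eu)
qed

text \<open>The homotopy moves the points of each simplex of \<open>A\<close> through the prism of the transformation,
  with weight \<open>1 - \<tau>\<close> on the side of \<open>F\<close> at time \<open>\<tau>\<close>.\<close>

proposition nat_trans_imp_B_homotopic:
  assumes "nat_trans A B F G \<eta>"
  shows "B_homotopic A B F G"
  unfolding B_homotopic_def
proof (rule classifying_homotopy[where h = "\<lambda>\<tau> n x t.
      prism_point B n (comp_func F x) (comp_func G x) (\<lambda>i. \<eta> (FObj x i)) t (1 - \<tau>)"])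
  have F: "cat_functor A B F" and G: "cat_functor A B G"
    using assms by (auto simp: nat_trans_def)
  note N = nat_trans_comp_func[OF assms]
  fix n and x :: "('a, 'b) diagram" assume x: "cat_functor (ordinal n) A x"
  interpret prism_data B n "comp_func F x" "comp_func G x" "\<lambda>i. \<eta> (FObj x i)"
    by unfold_locales (rule N[OF x])
  show "continuous_map (prod_topology (top_of_set {0..1}) (top_of_set (standard_simplex n)))
      (classifying_space B) (\<lambda>(\<tau>, t).
        prism_point B n (comp_func F x) (comp_func G x) (\<lambda>i. \<eta> (FObj x i)) t (1 - \<tau>))"
    using continuous_map_reverse_time[OF continuous_map_prism_point] by simp
  fix t assume t: "t \<in> standard_simplex n"
  show "prism_point B n (comp_func F x) (comp_func G x) (\<lambda>i. \<eta> (FObj x i)) t (1 - 0)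
      = classifying_map B F (point A n x t)"
    using prism_point_source[OF t] by (simp add: classifying_map_point[OF F x])
  show "prism_point B n (comp_func F x) (comp_func G x) (\<lambda>i. \<eta> (FObj x i)) t (1 - 1)
      = classifying_map B G (point A n x t)"
    using prism_point_target[OF t] by (simp add: classifying_map_point[OF G x])
next
  fix \<tau> :: real and m n \<alpha> and x x' :: "('a, 'b) diagram" and t
  assume *: "0 \<le> \<tau>" "\<tau> \<le> 1" "\<alpha> \<in> mono_maps m n" "cat_functor (ordinal n) A x"
    "cat_functor (ordinal m) A x'" "t \<in> standard_simplex m"
    and xo: "\<And>i. i \<le> m \<Longrightarrow> FObj x' i = FObj x (\<alpha> i)"
    and xa: "\<And>i j. \<lbrakk>i \<le> j; j \<le> m\<rbrakk> \<Longrightarrow> FArr x' (i, j) = FArr x (\<alpha> i, \<alpha> j)"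
  show "prism_point B m (comp_func F x') (comp_func G x') (\<lambda>i. \<eta> (FObj x' i)) t (1 - \<tau>)
      = prism_point B n (comp_func F x) (comp_func G x) (\<lambda>i. \<eta> (FObj x i)) (simplex_map m \<alpha> t) (1 - \<tau>)"
    by (rule prism_point_reindex[OF nat_trans_comp_func[OF assms *(4)]
        nat_trans_comp_func[OF assms *(5)] *(3,6)]) (use *(1,2) in \<open>auto simp: comp_func_def xo xa\<close>)
qed


section \<open>Piecewise linear interpolation\<close>

definition interp :: "(nat \<Rightarrow> real) \<Rightarrow> real \<Rightarrow> real" where
  "interp f r = f (nat \<lfloor>r\<rfloor>) + (r - nat \<lfloor>r\<rfloor>) * (f (Suc (nat \<lfloor>r\<rfloor>)) - f (nat \<lfloor>r\<rfloor>))"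

lemma nat_floor_cases:
  fixes r :: real
  assumes "real k \<le> r" "r \<le> real k + 1"
  obtains "nat \<lfloor>r\<rfloor> = k" | "r = real (Suc k)" "nat \<lfloor>r\<rfloor> = Suc k"
proof (cases "r = real (Suc k)")
  case False
  then have "\<lfloor>r\<rfloor> = int k" using assms by linarith
  then show ?thesis using that by simp
qed (use that in simp)

lemma nat_floor_bounds:
  fixes r :: real
  assumes "0 \<le> r" shows "real (nat \<lfloor>r\<rfloor>) \<le> r" "r \<le> real (nat \<lfloor>r\<rfloor>) + 1"
  using assms by linarith+

lemma interp_eq:
  assumes "real k \<le> r" "r \<le> real k + 1"
  shows "interp f r = f k + (r - k) * (f (Suc k) - f k)"
  using assms by (rule nat_floor_cases) (simp_all add: interp_def)

lemma interp_of_nat: "interp f (real k) = f k"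
  by (simp add: interp_def)

lemma interp_mono:
  assumes f: "mono f" and r: "0 \<le> r" "r \<le> s"
  shows "interp f r \<le> interp f s"
proof -
  let ?k = "nat \<lfloor>r\<rfloor>" and ?l = "nat \<lfloor>s\<rfloor>"
  have b: "0 \<le> r - ?k" "r - ?k \<le> 1" "0 \<le> s - ?l"
    using r nat_floor_bounds[of r] nat_floor_bounds[of s] by linarith+
  have inc: "f i \<le> f (Suc i)" for i using f by (simp add: monoD)
  have kl: "?k \<le> ?l" using r by (simp add: floor_mono nat_mono)
  show ?thesis
  proof (cases "?k = ?l")
    case True
    then show ?thesis
      using r inc[of ?k] by (simp add: interp_def mult_right_mono)
  next
    case False
    have "interp f r \<le> f ?k + 1 * (f (Suc ?k) - f ?k)"
      unfolding interp_def using b inc[of ?k] by (intro add_left_mono mult_right_mono) auto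
    also have "\<dots> \<le> f ?l" using f False kl by (simp add: monoD)
    also have "\<dots> \<le> interp f s"
      unfolding interp_def using b inc[of ?l] by simp
    finally show ?thesis .
  qed
qed

text \<open>These maps describe how an arrow folds the zig-zag of its target onto that of its source;
  \<open>slide \<sigma>\<close> extends \<open>\<sigma>\<close> to positions between two objects of the zig-zag.\<close>

definition collapse :: "(nat \<Rightarrow> nat) \<Rightarrow> bool" where
  "collapse \<sigma> \<longleftrightarrow> (\<forall>z. \<sigma> (Suc z) = \<sigma> z \<or> \<sigma> (Suc z) = Suc (\<sigma> z))"

abbreviation slide :: "(nat \<Rightarrow> nat) \<Rightarrow> real \<Rightarrow> real" where
  "slide \<sigma> \<equiv> interp (\<lambda>z. real (\<sigma> z))"

lemma collapse_mono: "collapse \<sigma> \<Longrightarrow> mono \<sigma>"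
  unfolding mono_iff_le_Suc collapse_def by (metis le_Suc_eq order_refl)

lemma slide_mono: "\<lbrakk>collapse \<sigma>; 0 \<le> r; r \<le> s\<rbrakk> \<Longrightarrow> slide \<sigma> r \<le> slide \<sigma> s"
  by (intro interp_mono) (use collapse_mono in \<open>auto simp: mono_def\<close>)

text \<open>Both \<open>slide \<sigma>\<close> and \<open>r - slide \<sigma> r\<close> are monotone, so \<open>slide \<sigma>\<close> is 1-Lipschitz.\<close>

lemma continuous_on_slide:
  assumes "collapse \<sigma>"
  shows "continuous_on {0..} (slide \<sigma>)"
proof -
  have lip: "\<bar>slide \<sigma> s - slide \<sigma> r\<bar> \<le> s - r" if "0 \<le> r" "r \<le> s" for r s
  proof -
    have "interp (\<lambda>z. real z - \<sigma> z) r' = r' - slide \<sigma> r'" for r'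
      by (simp add: interp_def algebra_simps)
    moreover have "mono (\<lambda>z. real z - \<sigma> z)"
      unfolding mono_iff_le_Suc
    proof
      fix z show "real z - \<sigma> z \<le> real (Suc z) - \<sigma> (Suc z)"
        using assms[unfolded collapse_def, rule_format, of z] by auto
    qed
    ultimately show ?thesis
      using interp_mono[of "\<lambda>z. real z - \<sigma> z", OF _ that] slide_mono[OF assms that] by auto
  qed
  have "dist (slide \<sigma> s) (slide \<sigma> r) \<le> dist s r" if "0 \<le> r" "0 \<le> s" for r s
    using lip[of r s] lip[of s r] that by (cases "r \<le> s") (auto simp: dist_real_def)
  then show ?thesis
    unfolding continuous_on_iff by (metis atLeast_iff le_less_trans)
qed

text \<open>Interpolation commutes with composition because \<open>\<rho>\<close> maps each unit interval onto a unit interval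
  or to a point; for general maps it does not.\<close>

lemma slide_comp:
  assumes "collapse \<sigma>" "collapse \<rho>" "0 \<le> r"
  shows "slide \<sigma> (slide \<rho> r) = slide (\<lambda>z. \<sigma> (\<rho> z)) r"
proof -
  let ?k = "nat \<lfloor>r\<rfloor>"
  note b = nat_floor_bounds[OF assms(3)]
  have r: "slide \<rho> r = real (\<rho> ?k) + (r - ?k) * (real (\<rho> (Suc ?k)) - \<rho> ?k)"
    by (simp add: interp_def)
  consider "\<rho> (Suc ?k) = \<rho> ?k" | "\<rho> (Suc ?k) = Suc (\<rho> ?k)"
    using assms(2) unfolding collapse_def by blast
  then show ?thesis
  proof cases
    case 1
    with r have "slide \<rho> r = real (\<rho> ?k)" by simp
    with 1 show ?thesis by (simp add: interp_of_nat) (simp add: interp_def)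
  next
    case 2
    with r have s: "slide \<rho> r = real (\<rho> ?k) + (r - ?k)" by simp
    then have "slide \<sigma> (slide \<rho> r)
        = real (\<sigma> (\<rho> ?k)) + (slide \<rho> r - \<rho> ?k) * (real (\<sigma> (Suc (\<rho> ?k))) - \<sigma> (\<rho> ?k))"
      using b s by (intro interp_eq) linarith+
    with 2 s show ?thesis by (simp add: interp_def)
  qed
qed


section \<open>Contracting along an unbounded zig-zag of natural transformations\<close>

text \<open>Each object \<open>X\<close> carries a finite zig-zag \<open>X = T\<^sub>n X, \<dots>, T\<^sub>1 X, T\<^sub>0 X\<close> with \<open>n = len X\<close>, joined
  by arrows \<open>step z X\<close> pointing from even to odd indices. An arrow \<open>a: X \<rightarrow> X'\<close> collapses the zig-zag
  of \<open>X'\<close> to that of \<open>X\<close> by \<open>shift a\<close> and induces arrows from \<open>T\<^bsub>shift a z\<^esub> X\<close> to \<open>T\<^sub>z X'\<close>.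
  The individual \<open>T\<^sub>z\<close>, apart from \<open>T\<^sub>0\<close>, need not be functors on the whole category, and the lengths
  \<open>len X\<close> need not be bounded.\<close>

locale sliding = H: category H for H :: "('o, 'a) cat" +
  fixes len :: "'o \<Rightarrow> nat" and shift :: "'a \<Rightarrow> nat \<Rightarrow> nat"
    and Tobj :: "nat \<Rightarrow> 'o \<Rightarrow> 'o" and Tarr :: "nat \<Rightarrow> 'a \<Rightarrow> 'a" and step :: "nat \<Rightarrow> 'o \<Rightarrow> 'a"
  assumes shift_0: "a \<in> Arr H \<Longrightarrow> shift a 0 = 0"
    and shift_len: "a \<in> Arr H \<Longrightarrow> shift a (len (Cod H a)) = len (Dom H a)"
    and shift_collapse: "a \<in> Arr H \<Longrightarrow> collapse (shift a)"
    and shift_parity: "\<lbrakk>a \<in> Arr H; shift a (Suc z) \<noteq> shift a z\<rbrakk> \<Longrightarrow> even (shift a z) \<longleftrightarrow> even z"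
    and shift_Comp: "\<lbrakk>a \<in> Arr H; b \<in> Arr H; Dom H b = Cod H a\<rbrakk>
      \<Longrightarrow> shift (Comp H b a) z = shift a (shift b z)"
    and Tobj_in: "X \<in> Obj H \<Longrightarrow> Tobj z X \<in> Obj H"
    and Tarr_in: "a \<in> Arr H \<Longrightarrow> Tarr z a \<in> Arr H"
    and Dom_Tarr: "a \<in> Arr H \<Longrightarrow> Dom H (Tarr z a) = Tobj (shift a z) (Dom H a)"
    and Cod_Tarr: "a \<in> Arr H \<Longrightarrow> Cod H (Tarr z a) = Tobj z (Cod H a)"
    and Tarr_Ident: "X \<in> Obj H \<Longrightarrow> Tarr z (Ident H X) = Ident H (Tobj z X)"
    and Tarr_Comp: "\<lbrakk>a \<in> Arr H; b \<in> Arr H; Dom H b = Cod H a\<rbrakk>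
      \<Longrightarrow> Tarr z (Comp H b a) = Comp H (Tarr z b) (Tarr (shift b z) a)"
    and Tobj_len: "X \<in> Obj H \<Longrightarrow> Tobj (len X) X = X"
    and Tarr_len: "a \<in> Arr H \<Longrightarrow> Tarr (len (Cod H a)) a = a"
    and step_in: "X \<in> Obj H \<Longrightarrow> step z X \<in> Arr H"
    and step_even: "\<lbrakk>X \<in> Obj H; even z\<rbrakk> \<Longrightarrow> Dom H (step z X) = Tobj z X \<and> Cod H (step z X) = Tobj (Suc z) X"
    and step_odd: "\<lbrakk>X \<in> Obj H; odd z\<rbrakk> \<Longrightarrow> Dom H (step z X) = Tobj (Suc z) X \<and> Cod H (step z X) = Tobj z X"
    and step_natural_even: "\<lbrakk>a \<in> Arr H; even z\<rbrakk> \<Longrightarrow>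
      Comp H (step z (Cod H a)) (Tarr z a) = Comp H (Tarr (Suc z) a)
        (if shift a (Suc z) = shift a z then Ident H (Tobj (shift a z) (Dom H a))
         else step (shift a z) (Dom H a))"
    and step_natural_odd: "\<lbrakk>a \<in> Arr H; odd z\<rbrakk> \<Longrightarrow>
      Comp H (step z (Cod H a)) (Tarr (Suc z) a) = Comp H (Tarr z a)
        (if shift a (Suc z) = shift a z then Ident H (Tobj (shift a z) (Dom H a))
         else step (shift a z) (Dom H a))"
begin

text \<open>On the simplex \<open>x\<^sub>0 \<rightarrow> \<dots> \<rightarrow> x\<^sub>p\<close> a position \<open>k\<close> in the zig-zag of \<open>x\<^sub>p\<close> determines positions
  in those of all \<open>x\<^sub>i\<close>, and hence a truncated simplex.\<close>

definition pos_at :: "nat \<Rightarrow> ('o, 'a) diagram \<Rightarrow> nat \<Rightarrow> nat \<Rightarrow> nat" where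
  "pos_at p x i = shift (FArr x (i, p))"

definition chain ::
    "nat \<Rightarrow> ('o, 'a) diagram \<Rightarrow> nat \<Rightarrow> ('o, 'a) diagram" where
  "chain p x k = \<lparr>
     FObj = (\<lambda>i. Tobj (pos_at p x i k) (FObj x i)),
     FArr = (\<lambda>(i, j). Tarr (pos_at p x j k) (FArr x (i, j)))\<rparr>"

definition chain_step :: "nat \<Rightarrow> ('o, 'a) diagram \<Rightarrow> nat \<Rightarrow> nat \<Rightarrow> 'a" where
  "chain_step p x k i =
     (if pos_at p x i (Suc k) = pos_at p x i k then Ident H (Tobj (pos_at p x i k) (FObj x i))
      else step (pos_at p x i k) (FObj x i))"

definition chain_prism ::
    "nat \<Rightarrow> ('o, 'a) diagram \<Rightarrow> nat \<Rightarrow> (nat \<Rightarrow> real) \<Rightarrow> real \<Rightarrow> ('o, 'a) class_pt" where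
  "chain_prism p x k t r =
     (if even k then prism_point H p (chain p x k) (chain p x (Suc k)) (chain_step p x k) t (1 - r)
      else prism_point H p (chain p x (Suc k)) (chain p x k) (chain_step p x k) t r)"

definition slide_point ::
    "nat \<Rightarrow> ('o, 'a) diagram \<Rightarrow> (nat \<Rightarrow> real) \<Rightarrow> real \<Rightarrow> ('o, 'a) class_pt" where
  "slide_point p x t r = chain_prism p x (nat \<lfloor>r\<rfloor>) t (r - nat \<lfloor>r\<rfloor>)"

definition truncate0 :: "('o, 'a, 'o, 'a) func" where
  "truncate0 = \<lparr>FObj = Tobj 0, FArr = Tarr 0\<rparr>"

lemma cat_functor_truncate0: "cat_functor H H truncate0"
  by unfold_locales
    (simp_all add: truncate0_def Tobj_in Tarr_in Dom_Tarr Cod_Tarr shift_0 Tarr_Ident Tarr_Comp)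

context
  fixes p :: nat and x :: "('o, 'a) diagram"
  assumes x: "cat_functor (ordinal p) H x"
begin

lemma x_obj: "i \<le> p \<Longrightarrow> FObj x i \<in> Obj H"
  using cat_functor.FObj_in[OF x, of i] by (simp add: Obj_ordinal)

lemma x_arr:
  assumes "i \<le> j" "j \<le> p"
  shows "FArr x (i, j) \<in> Arr H" "Dom H (FArr x (i, j)) = FObj x i" "Cod H (FArr x (i, j)) = FObj x j"
  using cat_functor.FArr_in[OF x, of "(i, j)"] cat_functor.Dom_FArr[OF x, of "(i, j)"]
    cat_functor.Cod_FArr[OF x, of "(i, j)"] assms by (auto simp: ordinal_def)

lemma x_ident: "i \<le> p \<Longrightarrow> FArr x (i, i) = Ident H (FObj x i)"
  using cat_functor.FArr_Ident[OF x, of i] by (simp add: ordinal_def)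

lemma x_comp:
  "\<lbrakk>i \<le> j; j \<le> k; k \<le> p\<rbrakk> \<Longrightarrow> FArr x (i, k) = Comp H (FArr x (j, k)) (FArr x (i, j))"
  using cat_functor.FArr_Comp[OF x, of "(i, j)" "(j, k)"] by (simp add: ordinal_def)

lemma pos_at_trans:
  "\<lbrakk>i \<le> j; j \<le> p\<rbrakk> \<Longrightarrow> pos_at p x i k = shift (FArr x (i, j)) (pos_at p x j k)"
  unfolding pos_at_def by (simp add: x_comp[of i j p] shift_Comp x_arr)

lemma collapse_pos_at: "i \<le> p \<Longrightarrow> collapse (pos_at p x i)"
  unfolding pos_at_def by (simp add: shift_collapse x_arr)

lemma pos_at_0: "i \<le> p \<Longrightarrow> pos_at p x i 0 = 0"
  unfolding pos_at_def by (simp add: shift_0 x_arr)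

lemma pos_at_len: "i \<le> p \<Longrightarrow> pos_at p x i (len (FObj x p)) = len (FObj x i)"
  unfolding pos_at_def using shift_len[of "FArr x (i, p)"] by (simp add: x_arr)

lemma pos_at_parity:
  "\<lbrakk>i \<le> p; pos_at p x i (Suc k) \<noteq> pos_at p x i k\<rbrakk> \<Longrightarrow> even (pos_at p x i k) \<longleftrightarrow> even k"
  unfolding pos_at_def using shift_parity[of "FArr x (i, p)"] by (simp add: x_arr)

lemma cat_functor_chain: "cat_functor (ordinal p) H (chain p x k)"
proof (intro cat_functor.intro cat_functor_axioms.intro category_ordinal H.category_axioms)
  fix f g
  assume "f \<in> Arr (ordinal p)" "g \<in> Arr (ordinal p)" "Dom (ordinal p) g = Cod (ordinal p) f"
  then show "FArr (chain p x k) (Comp (ordinal p) g f) = Comp H (FArr (chain p x k) g) (FArr (chain p x k) f)"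
    using x_comp[of "fst f" "snd f" "snd g"] pos_at_trans[of "snd f" "snd g" k]
    by (cases f; cases g) (simp add: ordinal_def chain_def Tarr_Comp x_arr)
qed (auto simp: ordinal_def chain_def Tobj_in Tarr_in Dom_Tarr Cod_Tarr x_obj x_arr
    pos_at_trans[symmetric] x_ident Tarr_Ident)

lemma nat_trans_chain_step:
  shows "even k \<Longrightarrow> nat_trans (ordinal p) H (chain p x k) (chain p x (Suc k)) (chain_step p x k)"
    and "odd k \<Longrightarrow> nat_trans (ordinal p) H (chain p x (Suc k)) (chain p x k) (chain_step p x k)"
proof -
  have s: "chain_step p x k i \<in> Arr H
      \<and> (even k \<longrightarrow> Dom H (chain_step p x k i) = FObj (chain p x k) i
          \<and> Cod H (chain_step p x k i) = FObj (chain p x (Suc k)) i)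
      \<and> (odd k \<longrightarrow> Dom H (chain_step p x k i) = FObj (chain p x (Suc k)) i
          \<and> Cod H (chain_step p x k i) = FObj (chain p x k) i)" if "i \<le> p" for i
  proof (cases "pos_at p x i (Suc k) = pos_at p x i k")
    case True
    then show ?thesis
      using that by (simp add: chain_step_def chain_def H.Ident_in H.Dom_Ident H.Cod_Ident Tobj_in x_obj)
  next
    case False
    then have "pos_at p x i (Suc k) = Suc (pos_at p x i k)"
      using collapse_pos_at[OF that] unfolding collapse_def by blast
    with False pos_at_parity[OF that False] show ?thesis
      using that by (simp add: chain_step_def chain_def step_in step_even step_odd x_obj)
  qed
  have n: "(even k \<longrightarrow> Comp H (chain_step p x k j) (FArr (chain p x k) (i, j))
        = Comp H (FArr (chain p x (Suc k)) (i, j)) (chain_step p x k i))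
      \<and> (odd k \<longrightarrow> Comp H (chain_step p x k j) (FArr (chain p x (Suc k)) (i, j))
        = Comp H (FArr (chain p x k) (i, j)) (chain_step p x k i))" if ij: "i \<le> j" "j \<le> p" for i j
  proof (cases "pos_at p x j (Suc k) = pos_at p x j k")
    case True
    let ?b = "Tarr (pos_at p x j k) (FArr x (i, j))"
    have "?b \<in> Arr H" "Dom H ?b = Tobj (pos_at p x i k) (FObj x i)"
        "Cod H ?b = Tobj (pos_at p x j k) (FObj x j)"
      using ij by (simp_all add: Tarr_in Dom_Tarr Cod_Tarr x_arr pos_at_trans[symmetric])
    moreover have "pos_at p x i (Suc k) = pos_at p x i k"
      using True ij by (simp add: pos_at_trans[of i j])
    ultimately show ?thesis
      using True H.Ident_left[of ?b] H.Ident_right[of ?b] by (simp add: chain_step_def chain_def)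
  next
    case False
    let ?z = "pos_at p x j k" and ?a = "FArr x (i, j)"
    have z: "pos_at p x j (Suc k) = Suc ?z"
      using False collapse_pos_at[OF ij(2)] unfolding collapse_def by blast
    have i: "pos_at p x i k = shift ?a ?z" "pos_at p x i (Suc k) = shift ?a (Suc ?z)"
      using ij z by (simp_all add: pos_at_trans[of i j])
    have e: "even ?z \<longleftrightarrow> even k" by (rule pos_at_parity[OF ij(2) False])
    show ?thesis
      using step_natural_even[of ?a ?z] step_natural_odd[of ?a ?z] ij e
      by (simp add: chain_step_def chain_def x_arr z i)
  qed
  show "even k \<Longrightarrow> nat_trans (ordinal p) H (chain p x k) (chain p x (Suc k)) (chain_step p x k)"
    "odd k \<Longrightarrow> nat_trans (ordinal p) H (chain p x (Suc k)) (chain p x k) (chain_step p x k)"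
    using cat_functor_chain s n by (auto simp: nat_trans_def) (auto simp: ordinal_def)
qed

lemma chain_prism_0:
  assumes t: "t \<in> standard_simplex p"
  shows "chain_prism p x k t 0 = point H p (chain p x k) t"
proof (cases "even k")
  case True
  interpret prism_data H p "chain p x k" "chain p x (Suc k)" "chain_step p x k"
    using nat_trans_chain_step(1)[OF True] by (rule prism_data.intro)
  show ?thesis using True prism_point_source[OF t] by (simp add: chain_prism_def)
next
  case False
  interpret prism_data H p "chain p x (Suc k)" "chain p x k" "chain_step p x k"
    using nat_trans_chain_step(2)[OF False] by (rule prism_data.intro)
  show ?thesis using False prism_point_target[OF t] by (simp add: chain_prism_def)
qed

lemma chain_prism_1:
  assumes t: "t \<in> standard_simplex p"
  shows "chain_prism p x k t 1 = point H p (chain p x (Suc k)) t"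
proof (cases "even k")
  case True
  interpret prism_data H p "chain p x k" "chain p x (Suc k)" "chain_step p x k"
    using nat_trans_chain_step(1)[OF True] by (rule prism_data.intro)
  show ?thesis using True prism_point_target[OF t] by (simp add: chain_prism_def)
next
  case False
  interpret prism_data H p "chain p x (Suc k)" "chain p x k" "chain_step p x k"
    using nat_trans_chain_step(2)[OF False] by (rule prism_data.intro)
  show ?thesis using False prism_point_source[OF t] by (simp add: chain_prism_def)
qed

lemma slide_point_eq:
  assumes t: "t \<in> standard_simplex p" and r: "real k \<le> r" "r \<le> real k + 1"
  shows "slide_point p x t r = chain_prism p x k t (r - k)"
  using r
proof (rule nat_floor_cases)
  assume "r = real (Suc k)" "nat \<lfloor>r\<rfloor> = Suc k"
  then show ?thesis
    using chain_prism_0[OF t, of "Suc k"] chain_prism_1[OF t, of k] by (simp add: slide_point_def)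
qed (simp add: slide_point_def)

lemma slide_point_of_nat:
  "t \<in> standard_simplex p \<Longrightarrow> slide_point p x t (real k) = point H p (chain p x k) t"
  by (simp add: slide_point_eq[where k = k] chain_prism_0)

end

lemma continuous_map_slide_point:
  assumes x: "cat_functor (ordinal p) H x"
  shows   "continuous_map (top_of_set (standard_simplex p \<times> {0..real N})) (classifying_space H)
     (\<lambda>(t, r). slide_point p x t r)"
proof -
  let ?P = "standard_simplex p \<times> {0..real N}"
  let ?T = "\<lambda>k. standard_simplex p \<times> ({0..real N} \<inter> {real k..real k + 1})"
  show ?thesis
  proof (rule pasting_lemma_closed[where I = "{..N}" and T = ?T
        and f = "\<lambda>k (t, r). chain_prism p x k t (r - k)"])
    fix k
    have eq: "?P \<inter> UNIV \<times> {real k..real k + 1} = ?T k" by auto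
    show "closedin (top_of_set ?P) (?T k)"
      by (subst eq[symmetric], rule closedin_closed_Int, rule closed_Times) auto
    have snd: "continuous_on A (snd :: (nat \<Rightarrow> real) \<times> real \<Rightarrow> real)" for A
      by (rule continuous_on_snd[OF continuous_on_id])
    have fst: "continuous_on A (fst :: (nat \<Rightarrow> real) \<times> real \<Rightarrow> _)" for A
      by (rule continuous_on_fst[OF continuous_on_id])
    have "continuous_map (top_of_set (?T k)) (classifying_space H) (\<lambda>z. chain_prism p x k (fst z) (snd z - k))"
    proof (cases "even k")
      case True
      interpret prism_data H p "chain p x k" "chain p x (Suc k)" "chain_step p x k"
        using nat_trans_chain_step(1)[OF x True] by (rule prism_data.intro)
      have "continuous_on (?T k) (\<lambda>z. (fst z, 1 - (snd z - real k)))"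
        by (rule continuous_on_Pair[OF fst continuous_on_diff[OF continuous_on_const
              continuous_on_diff[OF snd continuous_on_const]]])
      then have "continuous_map (top_of_set (?T k)) (top_of_set (standard_simplex p \<times> {0..1}))
          (\<lambda>z. (fst z, 1 - (snd z - real k)))"
        by (auto simp: continuous_map_in_subtopology)
      from continuous_map_compose[OF this continuous_map_prism_point] True show ?thesis
        by (simp add: o_def chain_prism_def)
    next
      case False
      interpret prism_data H p "chain p x (Suc k)" "chain p x k" "chain_step p x k"
        using nat_trans_chain_step(2)[OF x False] by (rule prism_data.intro)
      have "continuous_on (?T k) (\<lambda>z. (fst z, snd z - real k))"
        by (rule continuous_on_Pair[OF fst continuous_on_diff[OF snd continuous_on_const]])
      then have "continuous_map (top_of_set (?T k)) (top_of_set (standard_simplex p \<times> {0..1}))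
          (\<lambda>z. (fst z, snd z - real k))"
        by (auto simp: continuous_map_in_subtopology)
      from continuous_map_compose[OF this continuous_map_prism_point] False show ?thesis
        by (simp add: o_def chain_prism_def)
    qed
    moreover have "subtopology (top_of_set ?P) (?T k) = top_of_set (?T k)"
      unfolding subtopology_subtopology by (rule arg_cong[where f = top_of_set]) blast
    ultimately show "continuous_map (subtopology (top_of_set ?P) (?T k)) (classifying_space H)
        (\<lambda>(t, r). chain_prism p x k t (r - k))"
      by (simp add: case_prod_unfold)
  next
    fix k l z assume "z \<in> topspace (top_of_set ?P) \<inter> ?T k \<inter> ?T l"
    then show "(\<lambda>(t, r). chain_prism p x k t (r - k)) z = (\<lambda>(t, r). chain_prism p x l t (r - l)) z"
      using slide_point_eq[OF x, of "fst z" k "snd z"] slide_point_eq[OF x, of "fst z" l "snd z"] by auto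
  next
    fix z assume z: "z \<in> topspace (top_of_set ?P)"
    let ?k = "nat \<lfloor>snd z\<rfloor>"
    have b: "real ?k \<le> snd z" "snd z \<le> real ?k + 1" using z nat_floor_bounds[of "snd z"] by auto
    moreover from b(1) z have "real ?k \<le> real N" by auto
    ultimately show "\<exists>k. k \<in> {..N} \<and> z \<in> ?T k \<and> (\<lambda>(t, r). slide_point p x t r) z
        = (\<lambda>(t, r). chain_prism p x k t (r - k)) z"
      using z by (intro exI[of _ ?k]) (auto simp: slide_point_def)
  qed simp
qed

text \<open>The positions in the vertices of \<open>x \<circ> \<alpha>\<close> are determined by the one in \<open>x (\<alpha> m)\<close>, its last vertex,
  so the truncations of \<open>x\<close> restrict along \<open>\<alpha>\<close> to truncations of \<open>x \<circ> \<alpha>\<close>. If the unit step of \<open>x\<^sub>n\<close> that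
  contains \<open>r\<close> is collapsed in \<open>x (\<alpha> m)\<close>, it is collapsed in all earlier vertices, and the prism becomes
  degenerate.\<close>

lemma slide_point_reindex:
  assumes x: "cat_functor (ordinal n) H x" and x': "cat_functor (ordinal m) H x'"
    and \<alpha>: "\<alpha> \<in> mono_maps m n" and t: "t \<in> standard_simplex m" and r: "0 \<le> r"
    and o: "\<And>i. i \<le> m \<Longrightarrow> FObj x' i = FObj x (\<alpha> i)"
    and a: "\<And>i j. \<lbrakk>i \<le> j; j \<le> m\<rbrakk> \<Longrightarrow> FArr x' (i, j) = FArr x (\<alpha> i, \<alpha> j)"
  shows "slide_point n x (simplex_map m \<alpha> t) r = slide_point m x' t (slide (pos_at n x (\<alpha> m)) r)"
proof -
  define k \<epsilon> where "k = nat \<lfloor>r\<rfloor>" and "\<epsilon> = r - real k"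
  define \<sigma> where "\<sigma> = pos_at n x (\<alpha> m)"
  have \<epsilon>: "0 \<le> \<epsilon>" "\<epsilon> \<le> 1"
    using nat_floor_bounds[OF r] unfolding k_def \<epsilon>_def by linarith+
  note mono = mono_mapsD[OF \<alpha>]
  have pos: "pos_at n x (\<alpha> i) z = pos_at m x' i (\<sigma> z)" if "i \<le> m" for i z
    using that pos_at_trans[OF x, of "\<alpha> i" "\<alpha> m" z] mono by (simp add: \<sigma>_def pos_at_def a)
  have chain_o: "FObj (chain m x' (\<sigma> z)) i = FObj (chain n x z) (\<alpha> i)" if "i \<le> m" for i z
    using that by (simp add: chain_def pos o)
  have chain_a: "FArr (chain m x' (\<sigma> z)) (i, j) = FArr (chain n x z) (\<alpha> i, \<alpha> j)" if "i \<le> j" "j \<le> m" for i j z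
    using that by (simp add: chain_def pos a)
  have st: "simplex_map m \<alpha> t \<in> standard_simplex n"
    by (rule simplex_map_in_standard_simplex[OF \<alpha> t])
  have sl: "slide \<sigma> r = real (\<sigma> k) + \<epsilon> * (real (\<sigma> (Suc k)) - \<sigma> k)"
    by (simp add: interp_def k_def \<epsilon>_def)
  have L: "slide_point n x (simplex_map m \<alpha> t) r = chain_prism n x k (simplex_map m \<alpha> t) \<epsilon>"
    by (simp add: slide_point_def k_def \<epsilon>_def)
  have "\<sigma> (Suc k) = \<sigma> k \<or> \<sigma> (Suc k) = Suc (\<sigma> k)"
    using collapse_pos_at[OF x] mono(2) unfolding collapse_def \<sigma>_def by simp
  then have "chain_prism n x k (simplex_map m \<alpha> t) \<epsilon> = slide_point m x' t (slide \<sigma> r)"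
  proof
    assume eq: "\<sigma> (Suc k) = \<sigma> k"
    let ?c = "chain m x' (\<sigma> k)"
    have c: "cat_functor (ordinal m) H ?c" by (rule cat_functor_chain[OF x'])
    have N: "nat_trans (ordinal m) H ?c ?c (\<lambda>i. Ident H (FObj ?c i))"
      using c cat_functor.FObj_in[OF c] cat_functor.FArr_in[OF c] cat_functor.Dom_FArr[OF c]
        cat_functor.Cod_FArr[OF c]
      by (auto simp: nat_trans_def H.Ident_in H.Dom_Ident H.Cod_Ident)
        (metis H.Ident_left H.Ident_right)
    have step: "Ident H (FObj ?c i) = chain_step n x k (\<alpha> i)" if "i \<le> m" for i
      using that eq by (simp add: chain_step_def pos chain_def o)
    note ch = chain_o[of _ k] chain_o[of _ "Suc k", unfolded eq] chain_a[of _ _ k]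
      chain_a[of _ _ "Suc k", unfolded eq]
    have "chain_prism n x k (simplex_map m \<alpha> t) \<epsilon> = point H m ?c t"
    proof (cases "even k")
      case True
      have "prism_point H m ?c ?c (\<lambda>i. Ident H (FObj ?c i)) t (1 - \<epsilon>)
          = prism_point H n (chain n x k) (chain n x (Suc k)) (chain_step n x k) (simplex_map m \<alpha> t) (1 - \<epsilon>)"
        by (rule prism_point_reindex[OF nat_trans_chain_step(1)[OF x True] N \<alpha> t])
          (use \<epsilon> ch step in auto)
      moreover have "prism_point H m ?c ?c (\<lambda>i. Ident H (FObj ?c i)) t (1 - \<epsilon>) = point H m ?c t"
        by (rule prism_point_ident[OF N t]) (use \<epsilon> in auto)
      ultimately show ?thesis using True by (simp add: chain_prism_def)
    next
      case False
      have "prism_point H m ?c ?c (\<lambda>i. Ident H (FObj ?c i)) t \<epsilon>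
          = prism_point H n (chain n x (Suc k)) (chain n x k) (chain_step n x k) (simplex_map m \<alpha> t) \<epsilon>"
        by (rule prism_point_reindex[OF nat_trans_chain_step(2)[OF x False] N \<alpha> t])
          (use \<epsilon> ch step in auto)
      moreover have "prism_point H m ?c ?c (\<lambda>i. Ident H (FObj ?c i)) t \<epsilon> = point H m ?c t"
        by (rule prism_point_ident[OF N t]) (use \<epsilon> in auto)
      ultimately show ?thesis using False by (simp add: chain_prism_def)
    qed
    then show ?thesis
      using sl eq slide_point_of_nat[OF x' t, of "\<sigma> k"] by simp
  next
    assume eq: "\<sigma> (Suc k) = Suc (\<sigma> k)"
    have par: "even (\<sigma> k) \<longleftrightarrow> even k"
      using pos_at_parity[OF x, of "\<alpha> m" k] mono(2) eq by (simp add: \<sigma>_def)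
    have step: "chain_step m x' (\<sigma> k) i = chain_step n x k (\<alpha> i)" if "i \<le> m" for i
      using that by (simp add: chain_step_def pos o flip: eq)
    note ch = chain_o[of _ k] chain_o[of _ "Suc k", unfolded eq] chain_a[of _ _ k]
      chain_a[of _ _ "Suc k", unfolded eq]
    have "chain_prism m x' (\<sigma> k) t \<epsilon> = chain_prism n x k (simplex_map m \<alpha> t) \<epsilon>"
    proof (cases "even k")
      case True
      have "prism_point H m (chain m x' (\<sigma> k)) (chain m x' (Suc (\<sigma> k))) (chain_step m x' (\<sigma> k)) t (1 - \<epsilon>)
          = prism_point H n (chain n x k) (chain n x (Suc k)) (chain_step n x k) (simplex_map m \<alpha> t) (1 - \<epsilon>)"
        by (rule prism_point_reindex[OF nat_trans_chain_step(1)[OF x] nat_trans_chain_step(1)[OF x'] \<alpha> t])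
          (use True par \<epsilon> ch step in auto)
      then show ?thesis using True par by (simp add: chain_prism_def)
    next
      case False
      have "prism_point H m (chain m x' (Suc (\<sigma> k))) (chain m x' (\<sigma> k)) (chain_step m x' (\<sigma> k)) t \<epsilon>
          = prism_point H n (chain n x (Suc k)) (chain n x k) (chain_step n x k) (simplex_map m \<alpha> t) \<epsilon>"
        by (rule prism_point_reindex[OF nat_trans_chain_step(2)[OF x] nat_trans_chain_step(2)[OF x'] \<alpha> t])
          (use False par \<epsilon> ch step in auto)
      then show ?thesis using False par by (simp add: chain_prism_def)
    qed
    then show ?thesis
      using sl eq \<epsilon> slide_point_eq[OF x' t, of "\<sigma> k" "slide \<sigma> r"] by simp
  qed
  with L show ?thesis by (simp add: \<sigma>_def)
qed

text \<open>At time \<open>\<tau>\<close> the point of a simplex with coordinates \<open>t\<close> moves to a position for which the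
  average of the positions in all \<open>x\<^sub>i\<close>, weighted by \<open>t\<^sub>i\<close>, is \<open>1 - \<tau>\<close> times its maximum. All
  vertices with \<open>t\<^sub>i = 0\<close> drop out of the average, so that the condition is compatible with faces.
  The position need not be unique.\<close>

definition mean_pos :: "nat \<Rightarrow> ('o, 'a) diagram \<Rightarrow> (nat \<Rightarrow> real) \<Rightarrow> real \<Rightarrow> real" where
  "mean_pos p x t r = (\<Sum>i\<le>p. t i * slide (pos_at p x i) r)"

definition at_time ::
    "nat \<Rightarrow> ('o, 'a) diagram \<Rightarrow> (nat \<Rightarrow> real) \<Rightarrow> real \<Rightarrow> real \<Rightarrow> bool" where
  "at_time p x t \<tau> r \<longleftrightarrow> 0 \<le> r \<and> r \<le> len (FObj x p) \<and>
     mean_pos p x t r = (1 - \<tau>) * (\<Sum>i\<le>p. t i * len (FObj x i))"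

lemma mean_pos_len:
  assumes "cat_functor (ordinal p) H x"
  shows "mean_pos p x t (len (FObj x p)) = (\<Sum>i\<le>p. t i * len (FObj x i))"
  unfolding mean_pos_def by (intro sum.cong refl) (simp add: interp_of_nat pos_at_len[OF assms])

lemma mean_pos_0:
  assumes "cat_functor (ordinal p) H x"
  shows "mean_pos p x t 0 = 0"
  unfolding mean_pos_def
  using interp_of_nat[of _ 0] by (intro sum.neutral) (simp add: pos_at_0[OF assms])

lemma continuous_on_mean_pos:
  assumes "cat_functor (ordinal p) H x"
  shows "continuous_on (UNIV \<times> {0..}) (\<lambda>(t, r). mean_pos p x t r)"
proof -
  have 1: "continuous_on (UNIV \<times> {0..}) (\<lambda>z::(nat \<Rightarrow> real) \<times> real. fst z i)" for i
    using continuous_on_fst[OF continuous_on_id] by (rule continuous_on_product_then_coordinatewise)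
  have "continuous_on (UNIV \<times> {0..}) (\<lambda>z::(nat \<Rightarrow> real) \<times> real. slide (pos_at p x i) (snd z))"
    if "i \<le> p" for i
    by (rule continuous_on_compose2[OF continuous_on_slide[OF collapse_pos_at[OF assms that]]
          continuous_on_snd[OF continuous_on_id]]) auto
  then show ?thesis
    unfolding mean_pos_def case_prod_unfold
    by (intro continuous_on_sum) (rule continuous_on_mult[OF 1], simp)
qed

lemma at_time_exists:
  assumes x: "cat_functor (ordinal p) H x" and t: "t \<in> standard_simplex p" and \<tau>: "0 \<le> \<tau>" "\<tau> \<le> 1"
  shows "\<exists>r. at_time p x t \<tau> r"
proof -
  let ?L = "real (len (FObj x p))" and ?M = "\<Sum>i\<le>p. t i * len (FObj x i)"
  have M: "0 \<le> ?M"
    by (intro sum_nonneg mult_nonneg_nonneg standard_simplexD(1)[OF t]) simp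
  have "continuous_on {0..?L} (\<lambda>r. mean_pos p x t r)"
    by (rule continuous_on_compose2[OF continuous_on_mean_pos[OF x], of _ "\<lambda>r. (t, r)", simplified])
      (auto intro!: continuous_on_Pair continuous_on_const continuous_on_id)
  moreover have "mean_pos p x t 0 \<le> (1 - \<tau>) * ?M" "(1 - \<tau>) * ?M \<le> mean_pos p x t ?L"
    using M \<tau> mult_right_mono[of "1 - \<tau>" 1 ?M] by (simp_all add: mean_pos_0[OF x] mean_pos_len[OF x])
  ultimately have "\<exists>r\<ge>0. r \<le> ?L \<and> mean_pos p x t r = (1 - \<tau>) * ?M"
    by (intro IVT') auto
  then show ?thesis by (auto simp: at_time_def)
qed

text \<open>Summing the weights over the fibres of \<open>\<alpha>\<close> turns the mean for \<open>x\<close> into the mean for \<open>x \<circ> \<alpha>\<close>.\<close>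

lemma at_time_reindex:
  assumes x: "cat_functor (ordinal n) H x" and x': "cat_functor (ordinal m) H x'"
    and \<alpha>: "\<alpha> \<in> mono_maps m n"
    and r: "at_time n x (simplex_map m \<alpha> t) \<tau> r"
    and o: "\<And>i. i \<le> m \<Longrightarrow> FObj x' i = FObj x (\<alpha> i)"
    and a: "\<And>i j. \<lbrakk>i \<le> j; j \<le> m\<rbrakk> \<Longrightarrow> FArr x' (i, j) = FArr x (\<alpha> i, \<alpha> j)"
  shows "at_time m x' t \<tau> (slide (pos_at n x (\<alpha> m)) r)"
proof -
  note mono = mono_mapsD[OF \<alpha>]
  have r0: "0 \<le> r" "r \<le> len (FObj x n)" using r by (auto simp: at_time_def)
  have sum: "(\<Sum>i\<le>n. simplex_map m \<alpha> t i * g i) = (\<Sum>i\<le>m. t i * g (\<alpha> i))" for g :: "nat \<Rightarrow> real"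
  proof -
    have "(\<Sum>i\<le>n. simplex_map m \<alpha> t i * g i) = (\<Sum>i\<le>n. \<Sum>l | l \<in> {..m} \<and> \<alpha> l = i. t l * g (\<alpha> l))"
      unfolding simplex_map_def sum_distrib_right by (intro sum.cong) auto
    also have "\<dots> = (\<Sum>i\<le>m. t i * g (\<alpha> i))"
      by (rule sum.group) (use mono(2) in auto)
    finally show ?thesis .
  qed
  let ?s = "slide (pos_at n x (\<alpha> m))"
  have c: "collapse (pos_at n x (\<alpha> m))" using collapse_pos_at[OF x] mono(2) by simp
  have "?s 0 = 0" "?s (len (FObj x n)) = len (FObj x' m)"
    using interp_of_nat[of _ 0] mono(2) by (simp_all add: pos_at_0[OF x] interp_of_nat pos_at_len[OF x] o)
  then have "0 \<le> ?s r" "?s r \<le> len (FObj x' m)"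
    using slide_mono[OF c, of 0 r] slide_mono[OF c r0] r0 by auto
  moreover have "mean_pos m x' t (?s r) = mean_pos n x (simplex_map m \<alpha> t) r"
    unfolding mean_pos_def sum
  proof (intro sum.cong refl arg_cong2[where f = times])
    fix i assume i: "i \<in> {..m}"
    have "slide (pos_at m x' i) (?s r) = slide (\<lambda>z. pos_at m x' i (pos_at n x (\<alpha> m) z)) r"
      using i r0 collapse_pos_at[OF x'] c by (intro slide_comp) auto
    also have "(\<lambda>z. pos_at m x' i (pos_at n x (\<alpha> m) z)) = pos_at n x (\<alpha> i)"
      using i mono pos_at_trans[OF x, of "\<alpha> i" "\<alpha> m"] by (auto simp: pos_at_def a)
    finally show "slide (pos_at m x' i) (?s r) = slide (pos_at n x (\<alpha> i)) r" .
  qed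
  moreover have "(\<Sum>i\<le>n. simplex_map m \<alpha> t i * len (FObj x i)) = (\<Sum>i\<le>m. t i * len (FObj x' i))"
    unfolding sum by (intro sum.cong) (simp_all add: o)
  ultimately show ?thesis
    using r by (simp add: at_time_def)
qed

text \<open>The admissible positions form an interval on which the positions of all vertices with
  \<open>t\<^sub>i > 0\<close> are constant, since they are monotone with constant weighted mean. The slid point depends
  only on the position in the last such vertex, because it lies on the face that ends there.\<close>

lemma slide_point_unique:
  assumes x: "cat_functor (ordinal p) H x" and t: "t \<in> standard_simplex p"
    and r: "at_time p x t \<tau> r" and s: "at_time p x t \<tau> s"
  shows "slide_point p x t r = slide_point p x t s"
proof -
  have 1: "slide_point p x t r = slide_point p x t s"
    if r: "at_time p x t \<tau> r" and s: "at_time p x t \<tau> s" and rs: "r \<le> s" for r s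
  proof -
    have r0: "0 \<le> r" using r by (simp add: at_time_def)
    have "\<exists>i\<le>p. t i \<noteq> 0"
      using standard_simplexD(3)[OF t] by (metis atMost_iff sum.neutral zero_neq_one)
    then have ex: "\<exists>i. i \<le> p \<and> t i \<noteq> 0" by blast
    define q where "q = (GREATEST i. i \<le> p \<and> t i \<noteq> 0)"
    have q: "q \<le> p" "t q \<noteq> 0"
      using GreatestI_ex_nat[OF ex, of p] by (auto simp: q_def)
    have above: "t i = 0" if "q < i" for i
    proof (rule ccontr)
      assume "t i \<noteq> 0"
      moreover from this have "i \<le> p" using standard_simplexD(2)[OF t, of i] by (meson not_less)
      ultimately show False
        using Greatest_le_nat[of "\<lambda>i. i \<le> p \<and> t i \<noteq> 0" i p] that by (auto simp: q_def)
    qed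
    have "(\<Sum>i\<le>q. t i) = (\<Sum>i\<le>p. t i)"
      by (rule sum.mono_neutral_left) (use q above in auto)
    then have tq: "t \<in> standard_simplex q"
      using standard_simplexD[OF t] above by (intro standard_simplexI) auto
    \<comment> \<open>The inclusion of \<open>[q]\<close> into \<open>[p]\<close> does not change the coordinates \<open>t\<close>, which vanish beyond \<open>q\<close>.\<close>
    have id: "(\<lambda>i. i) \<in> mono_maps q p" using q by (intro mono_mapsI) auto
    have xq: "cat_functor (ordinal q) H (comp_func x (ordinal_map (\<lambda>i. i)))"
      by (rule cat_functor_comp_func[OF cat_functor_ordinal_map[OF id] x])
    have R: "slide_point p x t r' = slide_point q (comp_func x (ordinal_map (\<lambda>i. i))) t (slide (pos_at p x q) r')"
      if "0 \<le> r'" for r'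
      using slide_point_reindex[OF x xq id tq that]
      by (simp add: simplex_map_ident[OF tq] comp_func_def ordinal_map_def)
    have "slide (pos_at p x q) r = slide (pos_at p x q) s"
    proof (rule ccontr)
      assume "slide (pos_at p x q) r \<noteq> slide (pos_at p x q) s"
      then have "slide (pos_at p x q) r < slide (pos_at p x q) s"
        using slide_mono[OF collapse_pos_at[OF x q(1)] r0 rs] by simp
      then have "t q * slide (pos_at p x q) r < t q * slide (pos_at p x q) s"
        using q standard_simplexD(1)[OF t, of q] by simp
      then have "mean_pos p x t r < mean_pos p x t s"
        unfolding mean_pos_def
        by (intro sum_strict_mono_ex1)
          (use q in \<open>auto intro!: mult_left_mono slide_mono collapse_pos_at[OF x] r0 rs standard_simplexD(1)[OF t]\<close>)
      then show False using r s by (simp add: at_time_def)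
    qed
    then show ?thesis using R[of r] R[of s] r0 rs by simp
  qed
  show ?thesis
    using linear[of r s] 1[OF r s] 1[OF s r, symmetric] by (rule disjE)
qed

definition contraction :: "real \<Rightarrow> nat \<Rightarrow> ('o, 'a) diagram \<Rightarrow> (nat \<Rightarrow> real) \<Rightarrow> ('o, 'a) class_pt" where
  "contraction \<tau> p x t = slide_point p x t (SOME r. at_time p x t \<tau> r)"

lemma contraction_eq:
  assumes "cat_functor (ordinal p) H x" "t \<in> standard_simplex p" "at_time p x t \<tau> r"
  shows "contraction \<tau> p x t = slide_point p x t r"
  unfolding contraction_def
  by (rule slide_point_unique[OF assms(1,2) someI[of "at_time p x t \<tau>", OF assms(3)] assms(3)])

text \<open>The position is not a continuous function of \<open>\<tau>\<close> and \<open>t\<close>, because it jumps where weights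
  vanish. But the triples of a time, a point and an admissible position form a compact space, of which
  the space of times and points is a quotient.\<close>

lemma continuous_map_contraction:
  assumes x: "cat_functor (ordinal p) H x"
  shows "continuous_map (prod_topology (top_of_set {0..1}) (top_of_set (standard_simplex p)))
    (classifying_space H) (\<lambda>(\<tau>, t). contraction \<tau> p x t)"
proof -
  let ?D = "standard_simplex p" and ?L = "{0..real (len (FObj x p))}"
  let ?K = "{0..1::real} \<times> ?D \<times> ?L"
  let ?g = "\<lambda>z::real \<times> (nat \<Rightarrow> real) \<times> real. mean_pos p x (fst (snd z)) (snd (snd z))
    - (1 - fst z) * (\<Sum>i\<le>p. fst (snd z) i * len (FObj x i))"
  define Q where "Q = {z \<in> ?K. at_time p x (fst (snd z)) (fst z) (snd (snd z))}"
  let ?\<pi> = "\<lambda>z::real \<times> (nat \<Rightarrow> real) \<times> real. (fst z, fst (snd z))"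
  have "compact ?D"
    using compactin_standard_simplex[of p] by (simp add: euclidean_product_topology)
  then have K: "compact ?K" by (intro compact_Times) auto
  have c1: "continuous_on A (fst :: real \<times> (nat \<Rightarrow> real) \<times> real \<Rightarrow> _)" for A
    by (rule continuous_on_fst[OF continuous_on_id])
  have c2: "continuous_on A (\<lambda>z::real \<times> (nat \<Rightarrow> real) \<times> real. fst (snd z))" for A
    by (rule continuous_on_fst[OF continuous_on_snd[OF continuous_on_id]])
  have c3: "continuous_on A (snd :: real \<times> (nat \<Rightarrow> real) \<times> real \<Rightarrow> _)" for A
    by (rule continuous_on_snd[OF continuous_on_id])
  have c4: "continuous_on A (\<lambda>z::real \<times> (nat \<Rightarrow> real) \<times> real. fst (snd z) i)" for A i
    by (rule continuous_on_product_then_coordinatewise[OF c2])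
  have "continuous_on ?K (\<lambda>z. (\<lambda>(t, r). mean_pos p x t r) (snd z))"
    by (rule continuous_on_compose2[OF continuous_on_mean_pos[OF x] c3]) auto
  then have c5: "continuous_on ?K (\<lambda>z. mean_pos p x (fst (snd z)) (snd (snd z)))"
    by (simp add: case_prod_unfold)
  have "continuous_on ?K ?g"
    by (rule continuous_on_diff[OF c5 continuous_on_mult[OF continuous_on_diff[OF continuous_on_const c1]
            continuous_on_sum[OF continuous_on_mult[OF c4 continuous_on_const]]]])
  then have "closed (?K \<inter> ?g -` {0})"
    by (intro continuous_closed_preimage compact_imp_closed[OF K]) auto
  then have "compact (?K \<inter> (?K \<inter> ?g -` {0}))"
    by (rule compact_Int_closed[OF K])
  moreover have "Q = ?K \<inter> (?K \<inter> ?g -` {0})"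
    by (auto simp: Q_def at_time_def)
  ultimately have Qc: "compact Q" by (simp only:)
  have surj: "?\<pi> ` Q = {0..1} \<times> ?D"
  proof (intro equalityI subsetI)
    fix y assume "y \<in> {0..1::real} \<times> ?D"
    then obtain \<tau> t where y: "y = (\<tau>, t)" "0 \<le> \<tau>" "\<tau> \<le> 1" "t \<in> ?D" by auto
    then obtain r where "at_time p x t \<tau> r" using at_time_exists[OF x] by blast
    with y have "(\<tau>, t, r) \<in> Q" by (auto simp: Q_def at_time_def)
    with y show "y \<in> ?\<pi> ` Q" by force
  qed (auto simp: Q_def)
  have \<pi>: "continuous_map (top_of_set Q) (top_of_set ({0..1} \<times> ?D)) ?\<pi>"
    using surj continuous_on_Pair[OF c1 c2, of Q] by (auto simp: continuous_map_in_subtopology)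
  have q: "quotient_map (top_of_set Q) (top_of_set ({0..1} \<times> ?D)) ?\<pi>"
  proof (rule continuous_closed_imp_quotient_map[OF \<pi>])
    show "closed_map (top_of_set Q) (top_of_set ({0..1} \<times> ?D)) ?\<pi>"
      by (intro continuous_imp_closed_map_gen[OF _ _ \<pi>] Hausdorff_imp_kc_space Hausdorff_space_subtopology)
        (simp_all add: Qc compact_space_subtopology)
  qed (use surj in simp)
  have "continuous_map (top_of_set Q) (top_of_set (?D \<times> ?L)) snd"
    using c3 by (auto simp: continuous_map_in_subtopology Q_def)
  from continuous_map_compose[OF this continuous_map_slide_point[OF x]]
  have "continuous_map (top_of_set Q) (classifying_space H)
      (\<lambda>z. slide_point p x (fst (snd z)) (snd (snd z)))"
    by (simp add: o_def case_prod_unfold)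
  then have "continuous_map (top_of_set Q) (classifying_space H)
      ((\<lambda>(\<tau>, t). contraction \<tau> p x t) \<circ> ?\<pi>)"
    by (rule continuous_map_eq) (auto simp: Q_def contraction_eq[OF x])
  then show ?thesis
    using continuous_compose_quotient_map[OF q] by simp
qed

text \<open>At time \<open>0\<close> the maximal position is admissible, where nothing is truncated; at time \<open>1\<close> the position
  \<open>0\<close> is.\<close>

proposition homotopic_id_truncate0:
  "homotopic_with (\<lambda>_. True) (classifying_space H) (classifying_space H) (\<lambda>c. c)
     (classifying_map H truncate0)"
proof (rule classifying_homotopy[where h = contraction])
  fix p t and x :: "('o, 'a) diagram"
  assume x: "cat_functor (ordinal p) H x" and t: "t \<in> standard_simplex p"
  have "at_time p x t 0 (real (len (FObj x p)))"
    by (simp add: at_time_def mean_pos_len[OF x])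
  then have "contraction 0 p x t = point H p (chain p x (len (FObj x p))) t"
    by (simp add: contraction_eq[OF x t] slide_point_of_nat[OF x t])
  also have "\<dots> = point H p x t"
  proof (rule point_cong)
    fix i j assume "i \<le> j" "j \<le> p"
    then show "FArr (chain p x (len (FObj x p))) (i, j) = FArr x (i, j)"
      using Tarr_len[of "FArr x (i, j)"] by (simp add: chain_def pos_at_len[OF x] x_arr[OF x])
  qed (simp add: chain_def pos_at_len[OF x] Tobj_len x_obj[OF x])
  finally show "contraction 0 p x t = point H p x t" .
  have "at_time p x t 1 (real 0)"
    by (simp add: at_time_def mean_pos_0[OF x])
  then have "contraction 1 p x t = point H p (chain p x 0) t"
    by (simp only: contraction_eq[OF x t] slide_point_of_nat[OF x t])
  also have "\<dots> = point H p (comp_func truncate0 x) t"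
    by (rule point_cong) (simp_all add: chain_def pos_at_0[OF x] comp_func_def truncate0_def)
  finally show "contraction 1 p x t = classifying_map H truncate0 (point H p x t)"
    by (simp add: classifying_map_point[OF cat_functor_truncate0 x])
next
  fix \<tau> :: real and m n \<alpha> and x x' :: "('o, 'a) diagram" and t
  assume \<tau>: "0 \<le> \<tau>" "\<tau> \<le> 1" and \<alpha>: "\<alpha> \<in> mono_maps m n" and x: "cat_functor (ordinal n) H x"
    and x': "cat_functor (ordinal m) H x'" and t: "t \<in> standard_simplex m"
    and o: "\<And>i. i \<le> m \<Longrightarrow> FObj x' i = FObj x (\<alpha> i)"
    and a: "\<And>i j. \<lbrakk>i \<le> j; j \<le> m\<rbrakk> \<Longrightarrow> FArr x' (i, j) = FArr x (\<alpha> i, \<alpha> j)"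
  note st = simplex_map_in_standard_simplex[OF \<alpha> t]
  obtain r where r: "at_time n x (simplex_map m \<alpha> t) \<tau> r"
    using at_time_exists[OF x st \<tau>] by blast
  then have "0 \<le> r" by (simp add: at_time_def)
  then show "contraction \<tau> m x' t = contraction \<tau> n x (simplex_map m \<alpha> t)"
    using contraction_eq[OF x' t at_time_reindex[OF x x' \<alpha> r o a]] contraction_eq[OF x st r]
      slide_point_reindex[OF x x' \<alpha> t _ o a] by simp
qed (rule continuous_map_contraction)

end


section \<open>Zig-zags as sequences\<close>

text \<open>A zig-zag of length \<open>n\<close> is a sequence of \<open>2n + 1\<close> objects, barred ones at even and unbarred ones
  at odd positions, joined by \<open>2n\<close> arrows from even to odd positions.\<close>

definition zob :: "('o, 'a) zigzag \<Rightarrow> nat \<Rightarrow> 'o" where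
  "zob Y j = (if even j then bar Y (j div 2) else mid Y (Suc (j div 2)))"

definition zed :: "('o, 'a) zigzag \<Rightarrow> nat \<Rightarrow> 'a" where
  "zed Y j = (if even j then fwd Y (Suc (j div 2)) else bwd Y (Suc (j div 2)))"

definition zcomp :: "'a zigmor \<Rightarrow> nat \<Rightarrow> 'a" where
  "zcomp u j = (if even j then bar_mor u (j div 2) else mid_mor u (Suc (j div 2)))"

definition mkzig :: "nat \<Rightarrow> (nat \<Rightarrow> 'o) \<Rightarrow> (nat \<Rightarrow> 'a) \<Rightarrow> ('o, 'a) zigzag" where
  "mkzig n ob ed = \<lparr>bar = (\<lambda>i\<in>{0..n}. ob (2 * i)), mid = (\<lambda>i\<in>{1..n}. ob (2 * i - 1)),
     fwd = (\<lambda>i\<in>{1..n}. ed (2 * i - 2)), bwd = (\<lambda>i\<in>{1..n}. ed (2 * i - 1))\<rparr>"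

definition mkmor :: "nat \<Rightarrow> (nat \<Rightarrow> 'a) \<Rightarrow> 'a zigmor" where
  "mkmor n c = \<lparr>bar_mor = (\<lambda>i\<in>{0..n}. c (2 * i)), mid_mor = (\<lambda>i\<in>{1..n}. c (2 * i - 1))\<rparr>"

definition zig_seq :: "('o, 'a) cat \<Rightarrow> nat \<Rightarrow> (nat \<Rightarrow> 'o) \<Rightarrow> (nat \<Rightarrow> 'a) \<Rightarrow> bool" where
  "zig_seq D n ob ed \<longleftrightarrow> (\<forall>j\<le>2 * n. ob j \<in> Obj D) \<and> (\<forall>j<2 * n. ed j \<in> Arr D \<and>
     (if even j then Dom D (ed j) = ob j \<and> Cod D (ed j) = ob (Suc j)
      else Dom D (ed j) = ob (Suc j) \<and> Cod D (ed j) = ob j))"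

definition mor_seq ::
    "('o, 'a) cat \<Rightarrow> nat \<Rightarrow> ('o, 'a) zigzag \<Rightarrow> ('o, 'a) zigzag \<Rightarrow> (nat \<Rightarrow> 'a) \<Rightarrow> bool" where
  "mor_seq D n Y Z c \<longleftrightarrow>
     (\<forall>j\<le>2 * n. c j \<in> Arr D \<and> Dom D (c j) = zob Y j \<and> Cod D (c j) = zob Z j) \<and>
     (\<forall>j<2 * n. if even j then Comp D (zed Z j) (c j) = Comp D (c (Suc j)) (zed Y j)
      else Comp D (zed Z j) (c (Suc j)) = Comp D (c j) (zed Y j))"

lemma zob_0: "zob Y 0 = bar Y 0"
  by (simp add: zob_def)

lemma zob_mkzig: "j \<le> 2 * n \<Longrightarrow> zob (mkzig n ob ed) j = ob j"
  by (auto simp: zob_def mkzig_def elim!: evenE oddE)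

lemma zed_mkzig: "j < 2 * n \<Longrightarrow> zed (mkzig n ob ed) j = ed j"
  by (auto simp: zed_def mkzig_def elim!: evenE oddE)

lemma zcomp_mkmor: "j \<le> 2 * n \<Longrightarrow> zcomp (mkmor n c) j = c j"
  by (auto simp: zcomp_def mkmor_def elim!: evenE oddE)

lemma mkzig_cong:
  assumes "\<And>j. j \<le> 2 * n \<Longrightarrow> ob j = ob' j" "\<And>j. j < 2 * n \<Longrightarrow> ed j = ed' j"
  shows "mkzig n ob ed = mkzig n ob' ed'"
  by (auto simp: mkzig_def intro!: restrict_ext assms)

lemma mkmor_cong:
  assumes "\<And>j. j \<le> 2 * n \<Longrightarrow> c j = c' j"
  shows "mkmor n c = mkmor n c'"
  by (auto simp: mkmor_def intro!: restrict_ext assms)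

lemma odd_position:
  assumes "1 \<le> i" shows "odd (2 * i - 1)" "(2 * i - 1) div 2 = i - 1" "Suc (i - 1) = i"
    "Suc (2 * i - 2) = 2 * i - 1" "Suc (2 * i - 1) = 2 * i" "(2 * i - 2) div 2 = i - 1" "even (2 * i - 2)"
  using assms by presburger+

lemma mkzig_in_zigzags:
  assumes "zig_seq D n ob ed"
  shows "mkzig n ob ed \<in> zigzags D n"
proof -
  have o: "ob j \<in> Obj D" if "j \<le> 2 * n" for j using assms that by (simp add: zig_seq_def)
  have e: "ed j \<in> Arr D \<and> (if even j then Dom D (ed j) = ob j \<and> Cod D (ed j) = ob (Suc j)
      else Dom D (ed j) = ob (Suc j) \<and> Cod D (ed j) = ob j)" if "j < 2 * n" for j
    using assms that by (simp add: zig_seq_def)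
  have f: "ed (2 * i - 2) \<in> Arr D \<and> Dom D (ed (2 * i - 2)) = ob (2 * (i - 1))
      \<and> Cod D (ed (2 * i - 2)) = ob (2 * i - 1)"
    and b: "ed (2 * i - 1) \<in> Arr D \<and> Dom D (ed (2 * i - 1)) = ob (2 * i)
      \<and> Cod D (ed (2 * i - 1)) = ob (2 * i - 1)" if "i \<in> {1..n}" for i
  proof -
    have i: "1 \<le> i" "2 * i - 2 < 2 * n" "2 * i - 1 < 2 * n" "2 * (i - 1) = 2 * i - 2" using that by auto
    note p = odd_position[OF i(1)]
    show "ed (2 * i - 2) \<in> Arr D \<and> Dom D (ed (2 * i - 2)) = ob (2 * (i - 1))
        \<and> Cod D (ed (2 * i - 2)) = ob (2 * i - 1)"
      using e[OF i(2)] p(4,7) i(4) by presburger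
    show "ed (2 * i - 1) \<in> Arr D \<and> Dom D (ed (2 * i - 1)) = ob (2 * i)
        \<and> Cod D (ed (2 * i - 1)) = ob (2 * i - 1)"
      using e[OF i(3)] p(1,5) by presburger
  qed
  have "i - 1 \<in> {0..n}" if "i \<in> {1..n}" for i using that by auto
  then show ?thesis
    unfolding zigzags_def mkzig_def
    using o f b by (auto simp del: One_nat_def intro!: o)
qed

lemma zigzags_zig_seq:
  assumes "Y \<in> zigzags D n" shows "zig_seq D n (zob Y) (zed Y)"
proof -
  have Y: "\<And>i. i \<le> n \<Longrightarrow> bar Y i \<in> Obj D" "\<And>i. 1 \<le> i \<Longrightarrow> i \<le> n \<Longrightarrow> mid Y i \<in> Obj D"
    "\<And>i. 1 \<le> i \<Longrightarrow> i \<le> n \<Longrightarrow> fwd Y i \<in> Arr D \<and> bwd Y i \<in> Arr D \<and>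
      Dom D (fwd Y i) = bar Y (i - 1) \<and> Cod D (fwd Y i) = mid Y i \<and>
      Dom D (bwd Y i) = bar Y i \<and> Cod D (bwd Y i) = mid Y i"
    using assms by (auto simp: zigzags_def)
  have "zob Y j \<in> Obj D" if "j \<le> 2 * n" for j
    using that Y(1)[of "j div 2"] Y(2)[of "Suc (j div 2)"] by (auto simp: zob_def elim!: oddE)
  moreover have "zed Y j \<in> Arr D \<and>
     (if even j then Dom D (zed Y j) = zob Y j \<and> Cod D (zed Y j) = zob Y (Suc j)
      else Dom D (zed Y j) = zob Y (Suc j) \<and> Cod D (zed Y j) = zob Y j)" if "j < 2 * n" for j
    using that Y(3)[of "Suc (j div 2)"] by (auto simp: zob_def zed_def elim!: oddE)
  ultimately show ?thesis by (simp add: zig_seq_def)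
qed

lemma zigzag_eq_mkzig:
  assumes "Y \<in> zigzags D n" shows "Y = mkzig n (zob Y) (zed Y)"
proof (rule zigzag.equality)
  have Y: "bar Y \<in> extensional {0..n}" "mid Y \<in> extensional {1..n}"
    "fwd Y \<in> extensional {1..n}" "bwd Y \<in> extensional {1..n}"
    using assms by (auto simp: zigzags_def PiE_def)
  show "bar Y = bar (mkzig n (zob Y) (zed Y))"
    by (rule extensionalityI[OF Y(1)]) (auto simp: mkzig_def zob_def)
  show "mid Y = mid (mkzig n (zob Y) (zed Y))"
    by (rule extensionalityI[OF Y(2)]) (simp_all add: mkzig_def zob_def odd_position del: One_nat_def)
  show "fwd Y = fwd (mkzig n (zob Y) (zed Y))"
    by (rule extensionalityI[OF Y(3)]) (simp_all add: mkzig_def zed_def odd_position del: One_nat_def)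
  show "bwd Y = bwd (mkzig n (zob Y) (zed Y))"
    by (rule extensionalityI[OF Y(4)]) (simp_all add: mkzig_def zed_def odd_position del: One_nat_def)
qed simp

lemma zigmors_iff: "u \<in> zigmors D n Y Z \<longleftrightarrow> u = mkmor n (zcomp u) \<and> mor_seq D n Y Z (zcomp u)"
proof -
  have even: "(\<forall>j\<le>2 * n. P j) \<longleftrightarrow> (\<forall>i\<in>{0..n}. P (2 * i)) \<and> (\<forall>i\<in>{1..n}. P (2 * i - 1))" for P
  proof (intro iffI conjI ballI allI impI)
    fix j assume *: "(\<forall>i\<in>{0..n}. P (2 * i)) \<and> (\<forall>i\<in>{1..n}. P (2 * i - 1))" "j \<le> 2 * n"
    show "P j"
    proof (cases "even j")
      case True
      then obtain i where "j = 2 * i" ..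
      with * show ?thesis by simp
    next
      case False
      then obtain i where "j = 2 * i + 1" ..
      with * show ?thesis by (auto dest!: conjunct2 bspec[of _ _ "Suc i"])
    qed
  qed auto
  have lt: "(\<forall>j<2 * n. P j) \<longleftrightarrow> (\<forall>i\<in>{1..n}. P (2 * i - 2) \<and> P (2 * i - 1))" for P
  proof (intro iffI conjI ballI allI impI)
    fix j assume *: "\<forall>i\<in>{1..n}. P (2 * i - 2) \<and> P (2 * i - 1)" "j < 2 * n"
    show "P j"
    proof (cases "even j")
      case True
      then obtain i where "j = 2 * i" ..
      with * show ?thesis by (auto dest!: bspec[of _ _ "Suc i"])
    next
      case False
      then obtain i where "j = 2 * i + 1" ..
      with * show ?thesis by (auto dest!: bspec[of _ _ "Suc i"])
    qed
  qed auto
  have ext: "u = mkmor n (zcomp u) \<longleftrightarrow> bar_mor u \<in> extensional {0..n} \<and> mid_mor u \<in> extensional {1..n}"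
    (is "?L \<longleftrightarrow> ?R")
  proof
    assume ?L
    then have "bar_mor u = bar_mor (mkmor n (zcomp u))" "mid_mor u = mid_mor (mkmor n (zcomp u))"
      by simp_all
    then show ?R
      by (metis (no_types, lifting) mkmor_def restrict_extensional zigmor.select_convs)
  next
    assume R: ?R
    show ?L
    proof (rule zigmor.equality)
      show "bar_mor u = bar_mor (mkmor n (zcomp u))"
        by (rule extensionalityI[OF conjunct1[OF R]]) (auto simp: mkmor_def zcomp_def)
      show "mid_mor u = mid_mor (mkmor n (zcomp u))"
        by (rule extensionalityI[OF conjunct2[OF R]])
          (simp_all add: mkmor_def zcomp_def odd_position del: One_nat_def)
    qed simp
  qed
  have b: "zcomp u (2 * i) = bar_mor u i" "zob Y (2 * i) = bar Y i" "zob Z (2 * i) = bar Z i" for i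
    by (simp_all add: zcomp_def zob_def)
  have m: "zcomp u (2 * i - 1) = mid_mor u i" "zob Y (2 * i - 1) = mid Y i" "zob Z (2 * i - 1) = mid Z i"
    "zcomp u (2 * i - 2) = bar_mor u (i - 1)"
    "zed Y (2 * i - 2) = fwd Y i" "zed Z (2 * i - 2) = fwd Z i"
    "zed Y (2 * i - 1) = bwd Y i" "zed Z (2 * i - 1) = bwd Z i" if "1 \<le> i" for i
    using that by (cases i; simp add: zcomp_def zob_def zed_def)+
  show ?thesis
    unfolding ext mor_seq_def even lt
    using odd_position
    by (auto simp: zigmors_def PiE_iff b m simp del: One_nat_def)
qed


section \<open>Restriction along folds\<close>

text \<open>A fold collapses some of the arrows of a zig-zag and keeps the direction of the others. Both the
  functors \<open>\<Lambda>(\<phi>)\<close> and the truncations of zig-zags are given by restriction along folds.\<close>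

definition zigfold :: "(nat \<Rightarrow> nat) \<Rightarrow> bool" where
  "zigfold \<sigma> \<longleftrightarrow> collapse \<sigma> \<and> (\<forall>z. \<sigma> (Suc z) \<noteq> \<sigma> z \<longrightarrow> (even (\<sigma> z) \<longleftrightarrow> even z))"

definition pull :: "('o, 'a) cat \<Rightarrow> nat \<Rightarrow> (nat \<Rightarrow> nat) \<Rightarrow> ('o, 'a) zigzag \<Rightarrow> ('o, 'a) zigzag" where
  "pull D n \<sigma> Y = mkzig n (\<lambda>j. zob Y (\<sigma> j))
     (\<lambda>j. if \<sigma> (Suc j) = \<sigma> j then Ident D (zob Y (\<sigma> j)) else zed Y (\<sigma> j))"

lemma fold_collapse: "zigfold \<sigma> \<Longrightarrow> collapse \<sigma>"
  by (simp add: zigfold_def)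

lemma fold_mono: "zigfold \<sigma> \<Longrightarrow> i \<le> j \<Longrightarrow> \<sigma> i \<le> \<sigma> j"
  using collapse_mono[OF fold_collapse] by (simp add: monoD)

lemma fold_step:
  assumes "zigfold \<sigma>" "\<sigma> (Suc z) \<noteq> \<sigma> z"
  shows "\<sigma> (Suc z) = Suc (\<sigma> z)" "even (\<sigma> z) \<longleftrightarrow> even z"
  using assms by (auto simp: zigfold_def collapse_def)

lemma fold_min: "zigfold (min z)"
  by (auto simp: zigfold_def collapse_def min_def)

lemma zob_pull: "j \<le> 2 * n \<Longrightarrow> zob (pull D n \<sigma> Y) j = zob Y (\<sigma> j)"
  by (simp add: pull_def zob_mkzig)

lemma zed_pull:
  "j < 2 * n \<Longrightarrow> zed (pull D n \<sigma> Y) j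
    = (if \<sigma> (Suc j) = \<sigma> j then Ident D (zob Y (\<sigma> j)) else zed Y (\<sigma> j))"
  by (simp add: pull_def zed_mkzig)

lemma pull_cong:
  assumes "\<And>j. j \<le> 2 * n \<Longrightarrow> \<sigma> j = \<rho> j"
  shows "pull D n \<sigma> Y = pull D n \<rho> Y"
  unfolding pull_def by (rule mkzig_cong) (simp_all add: assms)

text \<open>Needed to see that \<open>zed Y (\<sigma> j)\<close> is an actual arrow of the zig-zag whenever \<open>pull\<close> refers to it.\<close>

lemma fold_step_le:
  assumes "zigfold \<sigma>" "\<sigma> (2 * n) \<le> m" "j < 2 * n" "\<sigma> (Suc j) \<noteq> \<sigma> j"
  shows "\<sigma> j < m"
  using fold_mono[OF assms(1), of "Suc j" "2 * n"] fold_step(1)[OF assms(1,4)] assms(2,3) by simp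

text \<open>Restriction is contravariantly functorial. Since \<open>\<Lambda>(\<phi>)\<close> and truncation are both restrictions, this
  settles the functoriality of \<open>\<Lambda>\<close> as well as the interplay of \<open>\<Lambda>(\<phi>)\<close> with truncation.\<close>

lemma pull_pull:
  assumes "zigfold \<sigma>" "\<sigma> (2 * n) \<le> 2 * m"
  shows "pull D n \<sigma> (pull D m \<rho> Y) = pull D n (\<lambda>j. \<rho> (\<sigma> j)) Y"
  unfolding pull_def[of D n]
proof (rule mkzig_cong)
  fix j assume j: "j \<le> 2 * n"
  show "zob (pull D m \<rho> Y) (\<sigma> j) = zob Y (\<rho> (\<sigma> j))"
    using fold_mono[OF assms(1) j] assms(2) by (simp add: zob_pull)
next
  fix j assume j: "j < 2 * n"
  show "(if \<sigma> (Suc j) = \<sigma> j then Ident D (zob (pull D m \<rho> Y) (\<sigma> j)) else zed (pull D m \<rho> Y) (\<sigma> j))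
      = (if \<rho> (\<sigma> (Suc j)) = \<rho> (\<sigma> j) then Ident D (zob Y (\<rho> (\<sigma> j))) else zed Y (\<rho> (\<sigma> j)))"
  proof (cases "\<sigma> (Suc j) = \<sigma> j")
    case True
    then show ?thesis
      using fold_mono[OF assms(1), of j "2 * n"] j assms(2) by (simp add: zob_pull)
  next
    case False
    then show ?thesis
      using fold_step_le[OF assms j False] fold_step(1)[OF assms(1) False] by (simp add: zed_pull)
  qed
qed

lemma pull_ident:
  assumes Y: "Y \<in> zigzags D n" and \<sigma>: "\<And>j. j \<le> 2 * n \<Longrightarrow> \<sigma> j = j"
  shows "pull D n \<sigma> Y = Y"
proof -
  have "pull D n \<sigma> Y = mkzig n (zob Y) (zed Y)"
    unfolding pull_def by (rule mkzig_cong) (simp_all add: \<sigma>)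
  with zigzag_eq_mkzig[OF Y] show ?thesis by simp
qed

context category begin

lemma pull_in_zigzags:
  assumes \<sigma>: "zigfold \<sigma>" "\<sigma> (2 * n) \<le> 2 * m" and Y: "Y \<in> zigzags C m"
  shows "pull C n \<sigma> Y \<in> zigzags C n"
  unfolding pull_def
proof (rule mkzig_in_zigzags)
  have Y: "\<And>j. j \<le> 2 * m \<Longrightarrow> zob Y j \<in> Obj C"
    "\<And>j. j < 2 * m \<Longrightarrow> zed Y j \<in> Arr C \<and>
     (if even j then Dom C (zed Y j) = zob Y j \<and> Cod C (zed Y j) = zob Y (Suc j)
      else Dom C (zed Y j) = zob Y (Suc j) \<and> Cod C (zed Y j) = zob Y j)"
    using zigzags_zig_seq[OF Y] by (auto simp: zig_seq_def)
  have le: "\<sigma> j \<le> 2 * m" if "j \<le> 2 * n" for j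
    using fold_mono[OF \<sigma>(1) that] \<sigma>(2) by simp
  show "zig_seq C n (\<lambda>j. zob Y (\<sigma> j))
      (\<lambda>j. if \<sigma> (Suc j) = \<sigma> j then Ident C (zob Y (\<sigma> j)) else zed Y (\<sigma> j))"
    unfolding zig_seq_def
  proof (intro conjI allI impI)
    fix j assume "j \<le> 2 * n" then show "zob Y (\<sigma> j) \<in> Obj C" using Y(1) le by simp
  next
    fix j assume j: "j < 2 * n"
    let ?e = "if \<sigma> (Suc j) = \<sigma> j then Ident C (zob Y (\<sigma> j)) else zed Y (\<sigma> j)"
    have "?e \<in> Arr C \<and> (if even j then Dom C ?e = zob Y (\<sigma> j) \<and> Cod C ?e = zob Y (\<sigma> (Suc j))
       else Dom C ?e = zob Y (\<sigma> (Suc j)) \<and> Cod C ?e = zob Y (\<sigma> j))"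
    proof (cases "\<sigma> (Suc j) = \<sigma> j")
      case True
      then show ?thesis
        using Y(1)[OF le[of j]] j by (simp add: Ident_in Dom_Ident Cod_Ident)
    next
      case False
      then show ?thesis
        using Y(2)[OF fold_step_le[OF \<sigma> j False]] fold_step[OF \<sigma>(1) False] by simp
    qed
    then show "?e \<in> Arr C" "if even j then Dom C ?e = zob Y (\<sigma> j) \<and> Cod C ?e = zob Y (\<sigma> (Suc j))
       else Dom C ?e = zob Y (\<sigma> (Suc j)) \<and> Cod C ?e = zob Y (\<sigma> j)" by blast+
  qed
qed

lemma mor_seq_pull:
  assumes \<sigma>: "zigfold \<sigma>" "\<sigma> (2 * n) \<le> 2 * m" and c: "mor_seq C m Y Z c"
  shows "mor_seq C n (pull C n \<sigma> Y) (pull C n \<sigma> Z) (\<lambda>j. c (\<sigma> j))"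
proof -
  have c1: "\<And>j. j \<le> 2 * m \<Longrightarrow> c j \<in> Arr C \<and> Dom C (c j) = zob Y j \<and> Cod C (c j) = zob Z j"
    and c2: "\<And>j. j < 2 * m \<Longrightarrow> if even j then Comp C (zed Z j) (c j) = Comp C (c (Suc j)) (zed Y j)
      else Comp C (zed Z j) (c (Suc j)) = Comp C (c j) (zed Y j)"
    using c by (auto simp: mor_seq_def)
  have le: "\<sigma> j \<le> 2 * m" if "j \<le> 2 * n" for j
    using fold_mono[OF \<sigma>(1) that] \<sigma>(2) by simp
  have "if even j then Comp C (zed (pull C n \<sigma> Z) j) (c (\<sigma> j)) = Comp C (c (\<sigma> (Suc j))) (zed (pull C n \<sigma> Y) j)
      else Comp C (zed (pull C n \<sigma> Z) j) (c (\<sigma> (Suc j))) = Comp C (c (\<sigma> j)) (zed (pull C n \<sigma> Y) j)"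
    if j: "j < 2 * n" for j
  proof (cases "\<sigma> (Suc j) = \<sigma> j")
    case True
    then show ?thesis
      using j c1[OF le[of j]] Ident_left[of "c (\<sigma> j)"] Ident_right[of "c (\<sigma> j)"] by (simp add: zed_pull)
  next
    case False
    then show ?thesis
      using j c2[OF fold_step_le[OF \<sigma> j False]] fold_step[OF \<sigma>(1) False] by (simp add: zed_pull)
  qed
  then show ?thesis
    using c1 le by (simp add: mor_seq_def zob_pull)
qed

lemma mor_seq_comp:
  assumes Y: "Y \<in> zigzags C n" and Z: "Z \<in> zigzags C n" and W: "W \<in> zigzags C n"
    and c: "mor_seq C n Y Z c" and d: "mor_seq C n Z W d"
  shows "mor_seq C n Y W (\<lambda>j. Comp C (d j) (c j))"
proof -
  note seq = zigzags_zig_seq[OF Y] zigzags_zig_seq[OF Z] zigzags_zig_seq[OF W]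
  have c1: "\<And>j. j \<le> 2 * n \<Longrightarrow> c j \<in> Arr C \<and> Dom C (c j) = zob Y j \<and> Cod C (c j) = zob Z j"
    and c2: "\<And>j. j < 2 * n \<Longrightarrow> if even j then Comp C (zed Z j) (c j) = Comp C (c (Suc j)) (zed Y j)
      else Comp C (zed Z j) (c (Suc j)) = Comp C (c j) (zed Y j)"
    using c by (auto simp: mor_seq_def)
  have d1: "\<And>j. j \<le> 2 * n \<Longrightarrow> d j \<in> Arr C \<and> Dom C (d j) = zob Z j \<and> Cod C (d j) = zob W j"
    and d2: "\<And>j. j < 2 * n \<Longrightarrow> if even j then Comp C (zed W j) (d j) = Comp C (d (Suc j)) (zed Z j)
      else Comp C (zed W j) (d (Suc j)) = Comp C (d j) (zed Z j)"
    using d by (auto simp: mor_seq_def)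
  have paste: "Comp C eW (Comp C d0 c0) = Comp C (Comp C d1 c1) eY"
    if "eY \<in> Arr C" "eZ \<in> Arr C" "eW \<in> Arr C" "c0 \<in> Arr C" "c1 \<in> Arr C" "d0 \<in> Arr C" "d1 \<in> Arr C"
      and "Dom C d0 = Cod C c0" "Dom C eW = Cod C d0" "Dom C eZ = Cod C c0" "Dom C d1 = Cod C eZ"
        "Dom C c1 = Cod C eY" "Dom C d1 = Cod C c1"
      and "Comp C eZ c0 = Comp C c1 eY" "Comp C eW d0 = Comp C d1 eZ" for eY eZ eW c0 c1 d0 d1
    using that Comp_assoc by metis
  have "if even j then Comp C (zed W j) (Comp C (d j) (c j)) = Comp C (Comp C (d (Suc j)) (c (Suc j))) (zed Y j)
      else Comp C (zed W j) (Comp C (d (Suc j)) (c (Suc j))) = Comp C (Comp C (d j) (c j)) (zed Y j)"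
    if j: "j < 2 * n" for j
  proof (cases "even j")
    case True
    have "Comp C (zed W j) (Comp C (d j) (c j)) = Comp C (Comp C (d (Suc j)) (c (Suc j))) (zed Y j)"
      by (rule paste[where eZ = "zed Z j"])
        (use True j seq c1[of j] c1[of "Suc j"] d1[of j] d1[of "Suc j"] c2[OF j] d2[OF j] in
          \<open>auto simp: zig_seq_def\<close>)
    with True show ?thesis by simp
  next
    case False
    have "Comp C (zed W j) (Comp C (d (Suc j)) (c (Suc j))) = Comp C (Comp C (d j) (c j)) (zed Y j)"
      by (rule paste[where eZ = "zed Z j"])
        (use False j seq c1[of j] c1[of "Suc j"] d1[of j] d1[of "Suc j"] c2[OF j] d2[OF j] in
          \<open>auto simp: zig_seq_def\<close>)
    with False show ?thesis by simp
  qed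
  then show ?thesis
    using c1 d1 by (simp add: mor_seq_def Comp_in Dom_Comp Cod_Comp)
qed

lemma mor_seq_ident:
  assumes "Y \<in> zigzags C n"
  shows "mor_seq C n Y Y (\<lambda>j. Ident C (zob Y j))"
  using zigzags_zig_seq[OF assms] Ident_left Ident_right
  unfolding zig_seq_def mor_seq_def
  by (auto simp: Ident_in Dom_Ident Cod_Ident) (metis Ident_left Ident_right Suc_leI less_imp_le_nat)+

end


section \<open>The fold of an arrow of the index category\<close>

text \<open>An arrow \<open>\<phi>: [m] \<rightarrow> [n]\<close> places the \<open>i\<close>-th step of a zig-zag of length \<open>m\<close> at the \<open>\<phi> i\<close>-th step
  of one of length \<open>n\<close>; on positions this is the map \<open>place \<phi>\<close> on \<open>{1..2m}\<close>. Its fold is the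
  right adjoint of \<open>place \<phi>\<close>, which makes it functorial in \<open>\<phi>\<close>.\<close>

definition place :: "(nat \<Rightarrow> nat) \<Rightarrow> nat \<Rightarrow> nat" where
  "place \<phi> q = (if even q then 2 * \<phi> (q div 2) else 2 * \<phi> (Suc (q div 2)) - 1)"

definition fold_of :: "nat \<Rightarrow> (nat \<Rightarrow> nat) \<Rightarrow> nat \<Rightarrow> nat" where
  "fold_of m \<phi> p = Max (insert 0 {q. 1 \<le> q \<and> q \<le> 2 * m \<and> place \<phi> q \<le> p})"

lemma place_cong:
  "(\<And>i. \<lbrakk>1 \<le> i; i \<le> m\<rbrakk> \<Longrightarrow> \<phi> i = \<psi> i) \<Longrightarrow> 1 \<le> q \<Longrightarrow> q \<le> 2 * m \<Longrightarrow> place \<phi> q = place \<psi> q"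
  by (auto simp: place_def elim!: evenE oddE)

text \<open>Numbers are compared by the positive numbers below them, the form in which the adjunction between
  \<open>place\<close> and \<open>fold_of\<close> delivers them; \<open>0\<close> is excluded because \<open>place\<close> is only meaningful on \<open>{1..2m}\<close>.\<close>

lemma le_fold_eqI:
  assumes "x \<le> k" "y \<le> k" "\<And>q::nat. \<lbrakk>1 \<le> q; q \<le> k\<rbrakk> \<Longrightarrow> q \<le> x \<longleftrightarrow> q \<le> y"
  shows "x = y"
  using assms(1,2) assms(3)[of x] assms(3)[of y] by (cases "x = 0"; cases "y = 0") auto

locale placement =
  fixes m n :: nat and \<phi> :: "nat \<Rightarrow> nat"
  assumes strict: "strict_mono_on {..m} \<phi>" and image: "\<phi> ` {..m} \<subseteq> {..n}"
begin

lemma less: "i < j \<Longrightarrow> j \<le> m \<Longrightarrow> \<phi> i < \<phi> j"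
  using strict by (simp add: strict_mono_on_def)

lemma le: "i \<le> j \<Longrightarrow> j \<le> m \<Longrightarrow> \<phi> i \<le> \<phi> j"
  using less[of i j] by (cases "i = j") auto

lemma le_iff: "i \<le> m \<Longrightarrow> j \<le> m \<Longrightarrow> \<phi> i \<le> \<phi> j \<longleftrightarrow> i \<le> j"
  using less[of j i] le[of i j] by (meson leD not_less)

lemma bound: "i \<le> m \<Longrightarrow> \<phi> i \<le> n"
  using image by auto

lemma pos: "1 \<le> i \<Longrightarrow> i \<le> m \<Longrightarrow> 1 \<le> \<phi> i"
  using less[of 0 i] by simp

lemma place_Suc:
  assumes "1 \<le> q" "q < 2 * m" shows "place \<phi> q < place \<phi> (Suc q)"
proof (cases "even q")
  case True
  then obtain i where "q = 2 * i" ..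
  with assms show ?thesis using less[of i "Suc i"] by (simp add: place_def)
next
  case False
  then obtain i where "q = 2 * i + 1" ..
  with assms show ?thesis using pos[of "Suc i"] by (simp add: place_def)
qed

lemma place_less: "1 \<le> q \<Longrightarrow> q < q' \<Longrightarrow> q' \<le> 2 * m \<Longrightarrow> place \<phi> q < place \<phi> q'"
proof (induction q' rule: less_induct)
  case (less q')
  then obtain r where r: "q' = Suc r" by (cases q') auto
  show ?case
  proof (cases "q = r")
    case True
    then show ?thesis using place_Suc less.prems r by simp
  next
    case False
    then have "place \<phi> q < place \<phi> r" using less.IH[of r] less.prems r by simp
    also have "place \<phi> r < place \<phi> (Suc r)" using less.prems r by (intro place_Suc) auto
    finally show ?thesis by (simp add: r)
  qed
qed

lemma fold_of_le: "fold_of m \<phi> p \<le> 2 * m"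
  unfolding fold_of_def by (subst Max_le_iff) auto

lemma le_fold_of_iff:
  assumes "1 \<le> q" "q \<le> 2 * m" shows "q \<le> fold_of m \<phi> p \<longleftrightarrow> place \<phi> q \<le> p"
proof
  let ?S = "{q. 1 \<le> q \<and> q \<le> 2 * m \<and> place \<phi> q \<le> p}"
  have fin: "finite (insert 0 ?S)" by simp
  show "q \<le> fold_of m \<phi> p" if "place \<phi> q \<le> p"
    unfolding fold_of_def by (rule Max_ge[OF fin]) (use assms that in simp)
  assume le: "q \<le> fold_of m \<phi> p"
  have "fold_of m \<phi> p \<in> insert 0 ?S"
    unfolding fold_of_def by (rule Max_in[OF fin]) simp
  then have "1 \<le> fold_of m \<phi> p" "fold_of m \<phi> p \<le> 2 * m" "place \<phi> (fold_of m \<phi> p) \<le> p"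
    using le assms(1) by auto
  then show "place \<phi> q \<le> p"
    using place_less[OF assms(1), of "fold_of m \<phi> p"] le by (cases "q = fold_of m \<phi> p") auto
qed

lemma place_ge_1: "1 \<le> q \<Longrightarrow> q \<le> 2 * m \<Longrightarrow> 1 \<le> place \<phi> q"
  using pos[of "q div 2"] pos[of "Suc (q div 2)"] by (auto simp: place_def elim!: evenE oddE)

lemma place_parity: "1 \<le> q \<Longrightarrow> q \<le> 2 * m \<Longrightarrow> even (place \<phi> q) \<longleftrightarrow> even q"
  using pos[of "Suc (q div 2)"] by (auto simp: place_def elim!: oddE)

lemma fold_of_0: "fold_of m \<phi> 0 = 0"
  by (rule le_fold_eqI[of _ "2 * m"]) (use fold_of_le place_ge_1 le_fold_of_iff in force)+

lemma fold_of_top: "fold_of m \<phi> (2 * n) = 2 * m"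
proof (rule le_fold_eqI[of _ "2 * m"])
  fix q assume q: "1 \<le> q" "q \<le> 2 * m"
  then have "place \<phi> q \<le> 2 * n"
    using bound[of "q div 2"] bound[of "Suc (q div 2)"] by (auto simp: place_def elim!: evenE oddE)
  with q show "q \<le> fold_of m \<phi> (2 * n) \<longleftrightarrow> q \<le> 2 * m" by (simp add: le_fold_of_iff)
qed (simp_all add: fold_of_le)

lemma fold_fold_of: "zigfold (fold_of m \<phi>)"
proof -
  have "fold_of m \<phi> (Suc z) = fold_of m \<phi> z
      \<or> (fold_of m \<phi> (Suc z) = Suc (fold_of m \<phi> z) \<and> (even (fold_of m \<phi> z) \<longleftrightarrow> even z))" for z
  proof -
    let ?a = "fold_of m \<phi> z" and ?b = "fold_of m \<phi> (Suc z)"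
    have ab: "?a \<le> ?b"
      using le_fold_of_iff[of ?a z] le_fold_of_iff[of ?a "Suc z"] fold_of_le[of z]
      by (cases "?a = 0") auto
    show ?thesis
    proof (cases "?a = ?b")
      case False
      then have b: "1 \<le> ?b" "?b \<le> 2 * m" using ab fold_of_le[of "Suc z"] by auto
      have pb: "place \<phi> ?b = Suc z"
        using le_fold_of_iff[OF b, of "Suc z"] le_fold_of_iff[OF b, of z] False ab by auto
      have "?b - 1 \<le> ?a"
      proof (cases "?b = 1")
        case False
        then have "1 \<le> ?b - 1" "?b - 1 \<le> 2 * m" "?b - 1 < ?b" using b by auto
        then show ?thesis
          using le_fold_of_iff[of "?b - 1" z] place_less[of "?b - 1" ?b] b pb by simp
      qed simp
      with False ab have "?b = Suc ?a" by auto
      moreover have "even ?b \<longleftrightarrow> even (Suc z)" using place_parity[OF b] pb by simp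
      ultimately show ?thesis by simp
    qed simp
  qed
  then show ?thesis unfolding zigfold_def collapse_def by (metis n_not_Suc_n)
qed

lemma le_pos_iff: "i \<le> m \<Longrightarrow> 1 \<le> i \<Longrightarrow> i \<le> Defs.pos m \<phi> j \<longleftrightarrow> \<phi> i \<le> j"
proof
  let ?S = "{i. i \<le> m \<and> \<phi> i \<le> j}"
  have fin: "finite (insert 0 ?S)" by simp
  assume i: "i \<le> m" "1 \<le> i"
  show "i \<le> Defs.pos m \<phi> j" if "\<phi> i \<le> j"
    unfolding Defs.pos_def by (rule Max_ge[OF fin]) (use i that in simp)
  assume le: "i \<le> Defs.pos m \<phi> j"
  have "Defs.pos m \<phi> j \<in> insert 0 ?S"
    unfolding Defs.pos_def by (rule Max_in[OF fin]) simp
  then have "Defs.pos m \<phi> j \<le> m" "\<phi> (Defs.pos m \<phi> j) \<le> j" using i le by auto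
  then show "\<phi> i \<le> j" using placement.le[OF placement_axioms le] by simp
qed

lemma pos_le: "Defs.pos m \<phi> j \<le> m"
  unfolding Defs.pos_def by (subst Max_le_iff) auto

lemma pos_image:
  assumes "i \<in> {1..m}" shows "Defs.pos m \<phi> (\<phi> i) = i"
proof (rule le_fold_eqI[OF pos_le])
  fix q assume "1 \<le> q" "q \<le> m"
  then show "q \<le> Defs.pos m \<phi> (\<phi> i) \<longleftrightarrow> q \<le> i" using assms by (simp add: le_pos_iff le_iff)
qed (use assms in simp)

lemma fold_of_even: "fold_of m \<phi> (2 * j) = 2 * Defs.pos m \<phi> j"
proof (rule le_fold_eqI[OF fold_of_le])
  show "2 * Defs.pos m \<phi> j \<le> 2 * m" using pos_le by simp
  fix q assume q: "1 \<le> q" "q \<le> 2 * m"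
  show "q \<le> fold_of m \<phi> (2 * j) \<longleftrightarrow> q \<le> 2 * Defs.pos m \<phi> j"
    unfolding le_fold_of_iff[OF q]
  proof (cases "even q")
    case True
    then obtain i where "q = 2 * i" ..
    with q show "place \<phi> q \<le> 2 * j \<longleftrightarrow> q \<le> 2 * Defs.pos m \<phi> j"
      using le_pos_iff[of i j] by (simp add: place_def)
  next
    case False
    then obtain i where i: "q = 2 * i + 1" ..
    have "q \<le> 2 * Defs.pos m \<phi> j \<longleftrightarrow> Suc i \<le> Defs.pos m \<phi> j" using i by auto
    moreover have "place \<phi> q \<le> 2 * j \<longleftrightarrow> \<phi> (Suc i) \<le> j" using i by (auto simp: place_def)
    ultimately show "place \<phi> q \<le> 2 * j \<longleftrightarrow> q \<le> 2 * Defs.pos m \<phi> j"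
      using le_pos_iff[of "Suc i" j] q i by simp
  qed
qed

lemma fold_of_odd:
  assumes j: "1 \<le> j"
  shows "fold_of m \<phi> (2 * j - 1)
    = (if j \<in> \<phi> ` {1..m} then 2 * Defs.pos m \<phi> j - 1 else 2 * Defs.pos m \<phi> j)"
proof (rule le_fold_eqI[OF fold_of_le])
  let ?p = "Defs.pos m \<phi> j" and ?r = "if j \<in> \<phi> ` {1..m} then 2 * Defs.pos m \<phi> j - 1 else 2 * Defs.pos m \<phi> j"
  show "?r \<le> 2 * m" using pos_le[of j] by auto
  fix q assume q: "1 \<le> q" "q \<le> 2 * m"
  show "q \<le> fold_of m \<phi> (2 * j - 1) \<longleftrightarrow> q \<le> ?r"
    unfolding le_fold_of_iff[OF q]
  proof (cases "even q")
    case True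
    then obtain i where i: "q = 2 * i" ..
    have P: "place \<phi> q \<le> 2 * j - 1 \<longleftrightarrow> \<phi> i < j" using j i by (auto simp: place_def)
    show "place \<phi> q \<le> 2 * j - 1 \<longleftrightarrow> q \<le> ?r"
    proof (cases "j \<in> \<phi> ` {1..m}")
      case True
      then obtain l where l: "j = \<phi> l" "l \<in> {1..m}" by blast
      then have "q \<le> ?r \<longleftrightarrow> i < l" using pos_image[of l] i True by auto
      also have "\<dots> \<longleftrightarrow> \<phi> i < j" using l q i le_iff[of l i] by (auto simp: not_le[symmetric])
      finally show ?thesis using P by simp
    next
      case False
      then have "\<phi> i \<noteq> j" using q i by auto
      then show ?thesis using P False le_pos_iff[of i j] q i by auto
    qed
  next
    case False
    then obtain i where i: "q = 2 * i + 1" ..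
    have P: "place \<phi> q \<le> 2 * j - 1 \<longleftrightarrow> \<phi> (Suc i) \<le> j" using i j by (auto simp: place_def)
    have "q \<le> ?r \<longleftrightarrow> Suc i \<le> ?p" using i by auto
    then show "place \<phi> q \<le> 2 * j - 1 \<longleftrightarrow> q \<le> ?r" using P le_pos_iff[of "Suc i" j] q i by simp
  qed
qed

end

lemma fold_of_comp:
  assumes "placement m n \<phi>" "placement n k \<psi>" and \<omega>: "\<And>i. i \<le> m \<Longrightarrow> \<omega> i = \<psi> (\<phi> i)"
    and "placement m k \<omega>"
  shows "fold_of m \<omega> p = fold_of m \<phi> (fold_of n \<psi> p)"
proof -
  interpret A: placement m n \<phi> by fact
  interpret B: placement n k \<psi> by fact
  interpret G: placement m k \<omega> by fact
  show ?thesis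
  proof (rule le_fold_eqI[OF G.fold_of_le A.fold_of_le])
    fix q assume q: "1 \<le> q" "q \<le> 2 * m"
    have "place \<omega> q = place \<psi> (place \<phi> q)"
    proof (cases "even q")
      case True
      then obtain i where "q = 2 * i" ..
      with q show ?thesis by (simp add: place_def \<omega>)
    next
      case False
      then obtain i where i: "q = 2 * i + 1" ..
      have "1 \<le> \<phi> (Suc i)" using A.pos[of "Suc i"] q i by simp
      with i q show ?thesis using odd_position[of "\<phi> (Suc i)"] by (simp add: place_def \<omega>)
    qed
    moreover have "1 \<le> place \<phi> q" "place \<phi> q \<le> 2 * n"
      using A.place_ge_1[OF q] A.le_fold_of_iff[OF q, of "2 * n"] A.fold_of_top q by auto
    ultimately show "q \<le> fold_of m \<omega> p \<longleftrightarrow> q \<le> fold_of m \<phi> (fold_of n \<psi> p)"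
      using q by (simp add: G.le_fold_of_iff A.le_fold_of_iff B.le_fold_of_iff)
  qed
qed

lemma placement_ident: "(\<And>i. i \<le> m \<Longrightarrow> \<phi> i = i) \<Longrightarrow> placement m m \<phi>"
  by unfold_locales (auto simp: strict_mono_on_def)

lemma fold_of_ident:
  assumes "\<And>i. i \<le> m \<Longrightarrow> \<phi> i = i"
  shows "fold_of m \<phi> p = min p (2 * m)"
proof -
  interpret placement m m \<phi> using assms by (rule placement_ident)
  show ?thesis
  proof (rule le_fold_eqI[OF fold_of_le])
    fix q assume q: "1 \<le> q" "q \<le> 2 * m"
    have "place \<phi> q = place (\<lambda>i. i) q" by (rule place_cong[OF assms q]) simp
    also have "\<dots> = q" by (auto simp: place_def elim!: evenE oddE)
    finally show "q \<le> fold_of m \<phi> p \<longleftrightarrow> q \<le> min p (2 * m)" using q by (simp add: le_fold_of_iff)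
  qed simp
qed

definition hom_fold :: "(nat, nat \<Rightarrow> nat) hom \<Rightarrow> nat \<Rightarrow> nat" where
  "hom_fold h = fold_of (src h) (dat h)"

text \<open>At even positions \<open>2 j\<close> the fold is twice the index \<open>pos\<close> of the barred entry. The arrows on both sides of
  the odd position \<open>2 j - 1\<close> survive exactly if \<open>j\<close> is in the image of \<open>{1..m}\<close>.\<close>

lemma Lam_zigzag_eq_pull:
  assumes "placement (src h) (tgt h) (dat h)"
  shows "Lam_zigzag D h Y = pull D (tgt h) (hom_fold h) Y"
proof -
  interpret placement "src h" "tgt h" "dat h" by fact
  let ?s = "Defs.pos (src h) (dat h)" and ?S = "dat h ` {1..src h}" and ?f = "fold_of (src h) (dat h)"
  have e: "?f (2 * j) = 2 * ?s j" for j by (rule fold_of_even)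
  have o: "?f (2 * j - 1) = (if j \<in> ?S then 2 * ?s j - 1 else 2 * ?s j)" if "1 \<le> j" for j
    by (rule fold_of_odd[OF that])
  have S: "1 \<le> ?s j" if "j \<in> ?S" for j using that pos_image by auto
  have ev: "zob Y (2 * i) = bar Y i" for i by (simp add: zob_def)
  have od: "zob Y (2 * i - 1) = mid Y i" "zed Y (2 * i - 1) = bwd Y i" "zed Y (2 * i - 2) = fwd Y i"
    if "1 \<le> i" for i
    using that by (cases i; simp add: zob_def zed_def)+
  have f: "(if ?f (Suc (2 * j - 2)) = ?f (2 * j - 2) then Ident D (zob Y (?f (2 * j - 2)))
        else zed Y (?f (2 * j - 2)))
      = (if j \<in> ?S then fwd Y (?s j) else Ident D (bar Y (?s j)))" if j: "1 \<le> j" for j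
  proof -
    have a: "2 * j - 2 = 2 * (j - 1)" by simp
    have b: "?f (Suc (2 * j - 2)) = ?f (2 * j - 2) \<or> ?f (Suc (2 * j - 2)) = Suc (?f (2 * j - 2))"
      using fold_collapse[OF fold_fold_of] unfolding collapse_def by blast
    \<comment> \<open>The fold is even at \<open>2 j - 2\<close>, so the step to \<open>2 j - 1\<close> survives iff the fold is odd there.\<close>
    have c: "even (?f (2 * j - 2))" unfolding a e by simp
    have d: "?f (Suc (2 * j - 2)) = (if j \<in> ?S then 2 * ?s j - 1 else 2 * ?s j)"
      unfolding odd_position(4)[OF j] by (rule o[OF j])
    show ?thesis
    proof (cases "j \<in> ?S")
      case True
      then have "odd (?f (Suc (2 * j - 2)))" using d odd_position(1)[OF S[OF True]] by simp
      then have "?f (Suc (2 * j - 2)) \<noteq> ?f (2 * j - 2)" using c by metis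
      moreover from this have "?f (2 * j - 2) = 2 * ?s j - 2" using b d True S[OF True] by simp
      ultimately show ?thesis using True od(3)[OF S[OF True]] by simp
    next
      case False
      then have "even (?f (Suc (2 * j - 2)))" using d by simp
      then have eq: "?f (Suc (2 * j - 2)) = ?f (2 * j - 2)" using b c by (metis even_Suc)
      with d False have "?f (2 * j - 2) = 2 * ?s j" by simp
      with eq False show ?thesis by (simp add: ev)
    qed
  qed
  have g: "(if ?f (Suc (2 * j - 1)) = ?f (2 * j - 1) then Ident D (zob Y (?f (2 * j - 1)))
        else zed Y (?f (2 * j - 1)))
      = (if j \<in> ?S then bwd Y (?s j) else Ident D (bar Y (?s j)))" if j: "1 \<le> j" for j
  proof -
    have d: "?f (Suc (2 * j - 1)) = 2 * ?s j" unfolding odd_position(5)[OF j] by (rule e)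
    show ?thesis
    proof (cases "j \<in> ?S")
      case True
      have "2 * ?s j \<noteq> 2 * ?s j - 1" using S[OF True] by simp
      then show ?thesis using True d o[OF j] od(2)[OF S[OF True]] by (simp del: One_nat_def)
    next
      case False
      then show ?thesis using d o[OF j] by (simp add: ev)
    qed
  qed
  have m: "zob Y (?f (2 * j - 1)) = (if j \<in> ?S then mid Y (?s j) else bar Y (?s j))" if j: "1 \<le> j" for j
    using o[OF j] od(1)[OF S, of j] ev by simp
  show ?thesis
    unfolding Lam_zigzag_def pull_def mkzig_def hom_fold_def Let_def
    by (intro arg_cong4[where f = "\<lambda>a b c d. \<lparr>bar = a, mid = b, fwd = c, bwd = d\<rparr>"] restrict_ext)
      (simp only: e ev, (rule m[symmetric] f[symmetric] g[symmetric], simp)+)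
qed

lemma Lam_zigmor_eq:
  assumes "placement (src h) (tgt h) (dat h)"
  shows "Lam_zigmor h u = mkmor (tgt h) (\<lambda>j. zcomp u (hom_fold h j))"
proof -
  interpret placement "src h" "tgt h" "dat h" by fact
  let ?s = "Defs.pos (src h) (dat h)" and ?S = "dat h ` {1..src h}" and ?f = "fold_of (src h) (dat h)"
  have e: "zcomp u (?f (2 * j)) = bar_mor u (?s j)" for j by (simp add: fold_of_even zcomp_def)
  have o: "zcomp u (?f (2 * j - 1)) = (if j \<in> ?S then mid_mor u (?s j) else bar_mor u (?s j))"
    if j: "1 \<le> j" for j
  proof (cases "j \<in> ?S")
    case True
    then have "1 \<le> ?s j" using pos_image by auto
    then show ?thesis
      using True odd_position[of "?s j"] by (simp add: fold_of_odd[OF j] zcomp_def del: One_nat_def)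
  next
    case False
    then show ?thesis by (simp add: fold_of_odd[OF j] zcomp_def del: One_nat_def)
  qed
  show ?thesis
    unfolding Lam_zigmor_def mkmor_def hom_fold_def Let_def
    by (intro arg_cong2[where f = "\<lambda>a b. \<lparr>bar_mor = a, mid_mor = b\<rparr>"] restrict_ext)
      (simp_all only: e o atLeastAtMost_iff)
qed


section \<open>The index categories\<close>

lemma Delta_arrowsD:
  assumes "h \<in> Delta_arrows s"
  shows "placement (src h) (tgt h) (dat h)" "dat h \<in> extensional {..src h}"
  using assms by (cases s; auto simp: placement_def strict_mono_on_def)+

lemma Delta_simps:
  "Obj (Delta s) = UNIV" "Arr (Delta s) = Delta_arrows s" "Dom (Delta s) = src" "Cod (Delta s) = tgt"
  "Ident (Delta s) n = Hom n (\<lambda>i\<in>{..n}. i) n"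
  "Comp (Delta s) g h = Hom (src h) (compose {..src h} (dat g) (dat h)) (tgt g)"
  by (simp_all add: Delta_def)

lemma Delta_Le_unique:
  "\<lbrakk>g \<in> Delta_arrows Le; h \<in> Delta_arrows Le; src g = src h; tgt g = tgt h\<rbrakk> \<Longrightarrow> g = h"
  by auto

lemma Delta_Comp_in:
  assumes g: "g \<in> Delta_arrows s" and h: "h \<in> Delta_arrows s" and "src g = tgt h"
  shows "Comp (Delta s) g h \<in> Delta_arrows s"
proof (cases s)
  case Inj
  interpret G: placement "src g" "tgt g" "dat g" by (rule Delta_arrowsD(1)[OF g])
  interpret K: placement "src h" "tgt h" "dat h" by (rule Delta_arrowsD(1)[OF h])
  have "strict_mono_on {..src h} (compose {..src h} (dat g) (dat h))"
    using assms(3) by (auto simp: strict_mono_on_def compose_def intro!: G.less K.less K.bound)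
  moreover have "compose {..src h} (dat g) (dat h) ` {..src h} \<subseteq> {..tgt g}"
    using assms(3) K.bound G.bound by (auto simp: compose_def)
  ultimately show ?thesis
    using Inj by (auto simp: Delta_simps)
next
  case Le
  from h Le obtain m n where h': "h = Hom m (\<lambda>i\<in>{..m}. n - m + i) n" and mn: "m \<le> n"
    by (simp only: Delta_arrows.simps) blast
  from g Le obtain n' k where g': "g = Hom n' (\<lambda>i\<in>{..n'}. k - n' + i) k" "n' \<le> k"
    by (simp only: Delta_arrows.simps) blast
  have n': "n' = n" using assms(3) unfolding h' g'(1) hom.sel .
  have "compose {..m} (\<lambda>i\<in>{..n}. k - n + i) (\<lambda>i\<in>{..m}. n - m + i) = (\<lambda>i\<in>{..m}. k - m + i)"
    unfolding compose_def
  proof (rule restrict_ext)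
    fix i assume "i \<in> {..m}"
    then have "n - m + i \<le> n" "k - n + (n - m + i) = k - m + i" using mn g'(2) n' by auto
    with \<open>i \<in> {..m}\<close> show "(\<lambda>i\<in>{..n}. k - n + i) ((\<lambda>i\<in>{..m}. n - m + i) i) = k - m + i"
      by (simp only: restrict_apply' atMost_iff)
  qed
  then have "Comp (Delta s) g h = Hom m (\<lambda>i\<in>{..m}. k - m + i) k"
    unfolding h' g'(1) n' Delta_simps hom.sel by simp
  then show ?thesis
    using Le mn g'(2) unfolding n' by (simp only: Delta_arrows.simps) (blast intro: le_trans)
qed

lemma Delta_Ident_in: "Ident (Delta s) n \<in> Delta_arrows s"
  by (cases s) (auto simp: Delta_simps strict_mono_on_def)

lemma category_Delta: "category (Delta s)"
proof
  fix g assume g: "g \<in> Arr (Delta s)"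
  then have g: "g \<in> Delta_arrows s" by (simp add: Delta_simps)
  interpret placement "src g" "tgt g" "dat g" by (rule Delta_arrowsD(1)[OF g])
  have "compose {..src g} (\<lambda>i\<in>{..tgt g}. i) (dat g) = dat g"
    "compose {..src g} (dat g) (\<lambda>i\<in>{..src g}. i) = dat g"
    by (rule extensionalityI[OF _ Delta_arrowsD(2)[OF g]]; simp add: compose_def bound)+
  then show "Comp (Delta s) (Ident (Delta s) (Cod (Delta s) g)) g = g"
    "Comp (Delta s) g (Ident (Delta s) (Dom (Delta s) g)) = g"
    by (cases g; simp add: Delta_simps)+
next
  fix g h k
  assume gh: "g \<in> Arr (Delta s)" "h \<in> Arr (Delta s)" "k \<in> Arr (Delta s)"
    "Dom (Delta s) h = Cod (Delta s) g" "Dom (Delta s) k = Cod (Delta s) h"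
  then interpret placement "src g" "tgt g" "dat g" by (intro Delta_arrowsD(1)) (simp add: Delta_simps)
  show "Comp (Delta s) k (Comp (Delta s) h g) = Comp (Delta s) (Comp (Delta s) k h) g"
    using gh bound by (auto simp: Delta_simps compose_def fun_eq_iff)
next
  fix g h
  assume "g \<in> Arr (Delta s)" "h \<in> Arr (Delta s)" "Dom (Delta s) h = Cod (Delta s) g"
  then show "Comp (Delta s) h g \<in> Arr (Delta s)"
    using Delta_Comp_in[of h s g] by (simp add: Delta_simps(2-4))
qed (use Delta_Ident_in in \<open>simp_all add: Delta_simps\<close>)

lemma Delta_Ident_Comp:
  assumes "h \<in> Delta_arrows s"
  shows "Comp (Delta s) (Ident (Delta s) (tgt h)) h = h" "Comp (Delta s) h (Ident (Delta s) (src h)) = h"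
  using category.Ident_left[OF category_Delta, of h s] category.Ident_right[OF category_Delta, of h s] assms
  by (simp_all add: Delta_simps(2-4))

lemma src_tgt_Ident: "src (Ident (Delta s) n) = n" "tgt (Ident (Delta s) n) = n"
  by (simp_all add: Delta_simps)

text \<open>For \<open>Le\<close> the object \<open>[0]\<close> is initial, so the constant functor maps to the identity. For \<open>Inj\<close> it has
  several arrows to \<open>[n]\<close>, none of them natural in \<open>[n]\<close>; but the arrow to the new vertex of the cone is natural,
  and so is the inclusion of \<open>[n]\<close> into its cone.\<close>

definition const0 :: "shape \<Rightarrow> (nat, (nat, nat \<Rightarrow> nat) hom, nat, (nat, nat \<Rightarrow> nat) hom) func" where
  "const0 s = \<lparr>FObj = (\<lambda>_. 0), FArr = (\<lambda>_. Ident (Delta s) 0)\<rparr>"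

lemma cat_functor_const0: "cat_functor (Delta s) (Delta s) (const0 s)"
proof (intro cat_functor.intro cat_functor_axioms.intro category_Delta)
  show "FArr (const0 s) (Comp (Delta s) g h) = Comp (Delta s) (FArr (const0 s) g) (FArr (const0 s) h)" for g h
    using Delta_Ident_Comp(1)[OF Delta_Ident_in[of s 0]] by (simp add: const0_def src_tgt_Ident)
qed (simp_all add: const0_def Delta_simps(1-4) Delta_Ident_in src_tgt_Ident)

definition cone_arrow :: "(nat, nat \<Rightarrow> nat) hom \<Rightarrow> (nat, nat \<Rightarrow> nat) hom" where
  "cone_arrow h = Hom (Suc (src h))
     (\<lambda>i\<in>{..Suc (src h)}. if i = 0 then 0 else Suc (dat h (i - 1))) (Suc (tgt h))"

definition cone_func :: "(nat, (nat, nat \<Rightarrow> nat) hom, nat, (nat, nat \<Rightarrow> nat) hom) func" where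
  "cone_func = \<lparr>FObj = Suc, FArr = cone_arrow\<rparr>"

lemma cat_functor_cone_func: "cat_functor (Delta Inj) (Delta Inj) cone_func"
proof (intro cat_functor.intro cat_functor_axioms.intro category_Delta)
  fix h assume "h \<in> Arr (Delta Inj)"
  then have h: "h \<in> Delta_arrows Inj" by (simp add: Delta_simps)
  interpret placement "src h" "tgt h" "dat h" by (rule Delta_arrowsD(1)[OF h])
  show "FArr cone_func h \<in> Arr (Delta Inj)"
    by (auto simp: cone_func_def cone_arrow_def Delta_simps strict_mono_on_def intro!: less bound)
  fix g assume "g \<in> Arr (Delta Inj)" and gh: "Dom (Delta Inj) g = Cod (Delta Inj) h"
  have "compose {..Suc (src h)}
      (\<lambda>i\<in>{..Suc (src g)}. if i = 0 then 0 else Suc (dat g (i - 1)))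
      (\<lambda>i\<in>{..Suc (src h)}. if i = 0 then 0 else Suc (dat h (i - 1)))
    = (\<lambda>i\<in>{..Suc (src h)}. if i = 0 then 0 else Suc (compose {..src h} (dat g) (dat h) (i - 1)))"
    unfolding compose_def using gh bound by (intro restrict_ext) (auto simp: Delta_simps)
  then show "FArr cone_func (Comp (Delta Inj) g h) = Comp (Delta Inj) (FArr cone_func g) (FArr cone_func h)"
    by (simp add: cone_func_def cone_arrow_def Delta_simps cong: if_cong)
next
  fix n
  have "(\<lambda>i\<in>{..Suc n}. if i = 0 then 0 else Suc ((\<lambda>i\<in>{..n}. i) (i - 1))) = (\<lambda>i\<in>{..Suc n}. i)"
    by (intro restrict_ext) auto
  then show "FArr cone_func (Ident (Delta Inj) n) = Ident (Delta Inj) (FObj cone_func n)"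
    by (simp add: cone_func_def cone_arrow_def Delta_simps cong: if_cong)
qed (simp_all add: cone_func_def cone_arrow_def Delta_simps)

lemma nat_trans_id_cone:
  "nat_trans (Delta Inj) (Delta Inj) id_func cone_func (\<lambda>n. Hom n (\<lambda>i\<in>{..n}. Suc i) (Suc n))"
  unfolding nat_trans_def
proof (intro conjI ballI cat_functor_cone_func cat_functor_id_func category_Delta)
  fix h assume "h \<in> Arr (Delta Inj)"
  then have "h \<in> Delta_arrows Inj" by (simp add: Delta_simps)
  then interpret placement "src h" "tgt h" "dat h" by (rule Delta_arrowsD(1))
  have "compose {..src h} (\<lambda>i\<in>{..tgt h}. Suc i) (dat h)
    = compose {..src h} (\<lambda>i\<in>{..Suc (src h)}. if i = 0 then 0 else Suc (dat h (i - 1))) (\<lambda>i\<in>{..src h}. Suc i)"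
    unfolding compose_def using bound by (intro restrict_ext) auto
  then show "Comp (Delta Inj) (Hom (Cod (Delta Inj) h) (\<lambda>i\<in>{..Cod (Delta Inj) h}. Suc i) (Suc (Cod (Delta Inj) h)))
       (FArr id_func h)
     = Comp (Delta Inj) (FArr cone_func h)
         (Hom (Dom (Delta Inj) h) (\<lambda>i\<in>{..Dom (Delta Inj) h}. Suc i) (Suc (Dom (Delta Inj) h)))"
    by (simp add: cone_func_def cone_arrow_def Delta_simps id_func_def)
qed (auto simp: Delta_simps id_func_def cone_func_def strict_mono_on_def)

lemma nat_trans_const0_cone:
  "nat_trans (Delta Inj) (Delta Inj) (const0 Inj) cone_func (\<lambda>n. Hom 0 (\<lambda>i\<in>{..0}. 0) (Suc n))"
  unfolding nat_trans_def
proof (intro conjI ballI cat_functor_cone_func cat_functor_const0)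
  fix h assume "h \<in> Arr (Delta Inj)"
  have "compose {0} (\<lambda>i\<in>{0}. 0) (\<lambda>i\<in>{0}. i)
    = compose {0} (\<lambda>i\<in>{..Suc (src h)}. if i = 0 then 0 else Suc (dat h (i - 1))) (\<lambda>i\<in>{0}. 0)"
    unfolding compose_def by (intro restrict_ext) auto
  then show "Comp (Delta Inj) (Hom 0 (\<lambda>i\<in>{..0}. 0) (Suc (Cod (Delta Inj) h))) (FArr (const0 Inj) h)
     = Comp (Delta Inj) (FArr cone_func h) (Hom 0 (\<lambda>i\<in>{..0}. 0) (Suc (Dom (Delta Inj) h)))"
    by (simp add: cone_func_def cone_arrow_def const0_def Delta_simps)
qed (auto simp: Delta_simps const0_def cone_func_def strict_mono_on_def)

lemma nat_trans_const0_id: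
  "nat_trans (Delta Le) (Delta Le) (const0 Le) id_func (\<lambda>n. Hom 0 (\<lambda>i\<in>{..0}. n - 0 + i) n)"
  unfolding nat_trans_def
proof (intro conjI ballI cat_functor_id_func cat_functor_const0 category_Delta)
  have t: "Hom 0 (\<lambda>i\<in>{..0}. n - 0 + i) n \<in> Delta_arrows Le" for n
    by (simp only: Delta_arrows.simps) blast
  fix h assume "h \<in> Arr (Delta Le)"
  then have h: "h \<in> Delta_arrows Le" by (simp add: Delta_simps(2))
  show "Comp (Delta Le) (Hom 0 (\<lambda>i\<in>{..0}. Cod (Delta Le) h - 0 + i) (Cod (Delta Le) h)) (FArr (const0 Le) h)
     = Comp (Delta Le) (FArr id_func h) (Hom 0 (\<lambda>i\<in>{..0}. Dom (Delta Le) h - 0 + i) (Dom (Delta Le) h))"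
    unfolding Delta_simps(3,4) const0_def id_func_def func.simps
    by (rule Delta_Le_unique; (rule Delta_Comp_in[OF t Delta_Ident_in] Delta_Comp_in[OF h t])?)
      (simp_all add: src_tgt_Ident Delta_simps(5,6))
next
  fix n
  show "Hom 0 (\<lambda>i\<in>{..0}. n - 0 + i) n \<in> Arr (Delta Le)"
    unfolding Delta_simps(2) Delta_arrows.simps by blast
qed (simp_all add: Delta_simps(3,4) const0_def id_func_def)

lemma hom_fold_Ident: "hom_fold (Ident (Delta s) n) p = min p (2 * n)"
  by (simp add: hom_fold_def Delta_simps fold_of_ident)

lemma hom_fold_Comp:
  assumes "g \<in> Delta_arrows s" "h \<in> Delta_arrows s" "src g = tgt h"
  shows "hom_fold (Comp (Delta s) g h) p = hom_fold h (hom_fold g p)"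
proof -
  note gh = Delta_Comp_in[OF assms]
  show ?thesis
    unfolding hom_fold_def
    using fold_of_comp[OF Delta_arrowsD(1)[OF assms(2)] Delta_arrowsD(1)[OF assms(1), unfolded assms(3)] _
        Delta_arrowsD(1)[OF gh, unfolded Delta_simps hom.sel], of p]
    by (simp add: Delta_simps compose_def assms(3))
qed

lemma hom_fold_props:
  assumes "h \<in> Delta_arrows s"
  shows "zigfold (hom_fold h)" "hom_fold h (2 * tgt h) = 2 * src h" "hom_fold h 0 = 0"
    "j \<le> 2 * tgt h \<Longrightarrow> hom_fold h j \<le> 2 * src h"
    "Lam_zigzag D h Y = pull D (tgt h) (hom_fold h) Y"
    "Lam_zigmor h u = mkmor (tgt h) (\<lambda>j. zcomp u (hom_fold h j))"
proof -
  interpret placement "src h" "tgt h" "dat h" by (rule Delta_arrowsD(1)[OF assms])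
  show "zigfold (hom_fold h)" "hom_fold h (2 * tgt h) = 2 * src h" "hom_fold h 0 = 0"
    "j \<le> 2 * tgt h \<Longrightarrow> hom_fold h j \<le> 2 * src h"
    by (simp_all add: hom_fold_def[abs_def] fold_fold_of fold_of_top fold_of_0 fold_of_le)
  show "Lam_zigzag D h Y = pull D (tgt h) (hom_fold h) Y"
    "Lam_zigmor h u = mkmor (tgt h) (\<lambda>j. zcomp u (hom_fold h j))"
    by (rule Lam_zigzag_eq_pull Lam_zigmor_eq, rule placement_axioms)+
qed


section \<open>The category \<open>\<H>\<^sub>\<star>(f)\<close>\<close>

text \<open>The arrow of \<open>\<H>\<^sub>\<star>(f)\<close> over \<open>a\<close> and \<open>h\<close> whose component at the position \<open>j\<close> is \<open>c j\<close>. Every arrow has this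
  form, with data satisfying \<open>harr_data\<close>, so that identities between arrows can be checked position by
  position.\<close>

definition harr ::
    "('o2, 'a2) cat \<Rightarrow> 'a1 \<Rightarrow> ('o2, 'a2) zigzag \<Rightarrow> (nat, nat \<Rightarrow> nat) hom \<Rightarrow> (nat \<Rightarrow> 'a2)
     \<Rightarrow> ('o2, 'a2) zigzag \<Rightarrow> 'a1 \<times> ('o2, 'a2) starhom" where
  "harr D a Y h c Z =
     (a, Hom (src h, Y) (h, Hom (Lam_zigzag D h Y) (mkmor (tgt h) c) Z) (tgt h, Z))"

lemma harr_eqI:
  assumes "a = a'" "h = h'" "Y = Y'" "Z = Z'" "\<And>j. j \<le> 2 * tgt h \<Longrightarrow> c j = c' j"
  shows "harr D a Y h c Z = harr D a' Y' h' c' Z'"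
  using mkmor_cong[of "tgt h" c c'] assms by (simp add: harr_def)

lemma mkmor_Comp:
  "\<lparr>bar_mor = (\<lambda>i\<in>{0..n}. Comp D (bar_mor u i) (bar_mor v i)),
    mid_mor = (\<lambda>i\<in>{1..n}. Comp D (mid_mor u i) (mid_mor v i))\<rparr>
   = mkmor n (\<lambda>j. Comp D (zcomp u j) (zcomp v j))"
  by (auto simp: mkmor_def zcomp_def odd_position simp del: One_nat_def intro!: restrict_ext)

lemma mkmor_Ident:
  "\<lparr>bar_mor = (\<lambda>i\<in>{0..n}. Ident D (bar Y i)), mid_mor = (\<lambda>i\<in>{1..n}. Ident D (mid Y i))\<rparr>
   = mkmor n (\<lambda>j. Ident D (zob Y j))"
  by (auto simp: mkmor_def zob_def odd_position simp del: One_nat_def intro!: restrict_ext)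

locale zigzag_pullback =
  fixes s :: shape and C :: "('o1, 'a1) cat" and D :: "('o2, 'a2) cat" and f :: "('o1, 'a1, 'o2, 'a2) func"
  assumes cat_functor_f: "cat_functor C D f"
begin

sublocale f: cat_functor C D f by (rule cat_functor_f)

abbreviation "H \<equiv> H_cat s C D f"

definition harr_data ::
    "'a1 \<Rightarrow> ('o2, 'a2) zigzag \<Rightarrow> (nat, nat \<Rightarrow> nat) hom \<Rightarrow> (nat \<Rightarrow> 'a2) \<Rightarrow> ('o2, 'a2) zigzag \<Rightarrow> bool" where
  "harr_data a Y h c Z \<longleftrightarrow> a \<in> Arr C \<and> h \<in> Delta_arrows s \<and> Y \<in> zigzags D (src h) \<and> Z \<in> zigzags D (tgt h) \<and>
     mor_seq D (tgt h) (pull D (tgt h) (hom_fold h) Y) Z c \<and> FArr f a = c 0"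

lemma Obj_H: "Obj H = {(X, n, Y). X \<in> Obj C \<and> Y \<in> zigzags D n \<and> FObj f X = zob Y 0}"
  by (auto simp: H_cat_def pullback_cat_def Lam_star_def grothendieck_def Lam_def Delta_simps p0_def zob_0)

lemma pull_hom_fold_in:
  "\<lbrakk>h \<in> Delta_arrows s; Y \<in> zigzags D (src h)\<rbrakk> \<Longrightarrow> pull D (tgt h) (hom_fold h) Y \<in> zigzags D (tgt h)"
  using f.B.pull_in_zigzags[of "hom_fold h" "tgt h" "src h"] hom_fold_props(1,2)[of h s] by simp

lemma harr_in:
  assumes "harr_data a Y h c Z" shows "harr D a Y h c Z \<in> Arr H"
proof -
  have d: "a \<in> Arr C" "h \<in> Delta_arrows s" "Y \<in> zigzags D (src h)" "Z \<in> zigzags D (tgt h)"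
    "mor_seq D (tgt h) (pull D (tgt h) (hom_fold h) Y) Z c" "FArr f a = c 0"
    using assms by (auto simp: harr_data_def)
  note L = hom_fold_props(5)[OF d(2), of D Y]
  have "mkmor (tgt h) (zcomp (mkmor (tgt h) c)) = mkmor (tgt h) c"
    by (rule mkmor_cong) (rule zcomp_mkmor)
  moreover have "mor_seq D (tgt h) (pull D (tgt h) (hom_fold h) Y) Z (zcomp (mkmor (tgt h) c))"
    using d(5) by (simp add: mor_seq_def zcomp_mkmor)
  ultimately have "mkmor (tgt h) c \<in> zigmors D (tgt h) (Lam_zigzag D h Y) Z"
    unfolding zigmors_iff L by simp
  moreover have "bar_mor (mkmor (tgt h) c) 0 = c 0" by (simp add: mkmor_def)
  ultimately show ?thesis
    using d pull_hom_fold_in[OF d(2,3)]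
    by (simp add: H_cat_def pullback_cat_def Lam_star_def grothendieck_def Lam_def Delta_simps p0_def
        Lam_func_def harr_def L)
qed

lemma Arr_HE:
  assumes "w \<in> Arr H"
  obtains a Y h c Z where "harr_data a Y h c Z" "w = harr D a Y h c Z"
proof -
  obtain a b where w: "w = (a, b)" "a \<in> Arr C" "b \<in> Arr (Lam_star s D)" "FArr f a = FArr p0 b"
    using assms by (auto simp: H_cat_def pullback_cat_def)
  have Lam: "Obj (Lam D n) = zigzags D n" "Dom (Lam D n) = src" "Cod (Lam D n) = tgt" for n
    by (simp_all add: Lam_def)
  obtain n Y h u k Z where "b = Hom (n, Y) (h, u) (k, Z)" "h \<in> Arr (Delta s)" "Dom (Delta s) h = n"
      "Cod (Delta s) h = k" "Y \<in> Obj (Lam D n)" "Z \<in> Obj (Lam D k)" "u \<in> Arr (Lam D k)"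
      "Dom (Lam D k) u = FObj (Lam_func D h) Y" "Cod (Lam D k) u = Z"
    using w(3) unfolding Lam_star_def grothendieck_def cat.simps mem_Collect_eq by (elim exE conjE) rule
  then have b: "b = Hom (src h, Y) (h, u) (tgt h, Z)" "h \<in> Delta_arrows s"
      "Y \<in> zigzags D (src h)" "Z \<in> zigzags D (tgt h)" "u \<in> Arr (Lam D (tgt h))"
      "src u = Lam_zigzag D h Y" "tgt u = Z"
    by (simp_all add: Lam Delta_simps(2-4) Lam_func_def)
  then obtain v where u: "u = Hom (Lam_zigzag D h Y) v Z" "v \<in> zigmors D (tgt h) (Lam_zigzag D h Y) Z"
    by (auto simp: Lam_def)
  note L = hom_fold_props(5)[OF b(2), of D Y]
  have v: "v = mkmor (tgt h) (zcomp v)" "mor_seq D (tgt h) (pull D (tgt h) (hom_fold h) Y) Z (zcomp v)"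
    using u(2) unfolding zigmors_iff L by auto
  show ?thesis
  proof (rule that)
    show "harr_data a Y h (zcomp v) Z"
      using w b v u(1) by (simp add: harr_data_def p0_def zcomp_def)
    show "w = harr D a Y h (zcomp v) Z"
      using w(1) b(1) u(1) v(1) by (simp add: harr_def)
  qed
qed

lemma Dom_harr: "Dom H (harr D a Y h c Z) = (Dom C a, src h, Y)"
  and Cod_harr: "Cod H (harr D a Y h c Z) = (Cod C a, tgt h, Z)"
  by (simp_all add: H_cat_def pullback_cat_def Lam_star_def grothendieck_def harr_def)

lemma Ident_H:
  assumes "Y \<in> zigzags D n"
  shows "Ident H (X, n, Y) = harr D (Ident C X) Y (Ident (Delta s) n) (\<lambda>j. Ident D (zob Y j)) Y"
proof -
  have "Lam_zigzag D (Ident (Delta s) n) Y = Y"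
    unfolding hom_fold_props(5)[OF Delta_Ident_in]
    by (simp add: Delta_simps(5)) (rule pull_ident[OF assms], simp add: hom_fold_Ident[where s = s, unfolded Delta_simps])
  then show ?thesis
    using mkmor_Ident[where n = n and D = D and Y = Y]
    by (simp add: H_cat_def pullback_cat_def Lam_star_def grothendieck_def Lam_def harr_def Delta_simps)
qed

text \<open>Composition in the Grothendieck construction applies \<open>\<Lambda>(h')\<close> to the first arrow before composing in
  \<open>\<Lambda>\<^sub>n D\<close>; on components this is precomposition with the fold of \<open>h'\<close>.\<close>

lemma Comp_harr:
  assumes "harr_data b Y' h' c' Z" "harr_data a Y h c Y'" "src h' = tgt h"
  shows "Comp H (harr D b Y' h' c' Z) (harr D a Y h c Y')
    = harr D (Comp C b a) Y (Comp (Delta s) h' h) (\<lambda>j. Comp D (c' j) (c (hom_fold h' j))) Z"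
proof -
  have h: "h \<in> Delta_arrows s" "h' \<in> Delta_arrows s" using assms by (auto simp: harr_data_def)
  note hh = Delta_Comp_in[OF h(2,1) assms(3)]
  have "Lam_zigzag D h' (Lam_zigzag D h Y)
      = pull D (tgt h') (hom_fold h') (pull D (src h') (hom_fold h) Y)"
    by (simp add: hom_fold_props(5)[OF h(1)] hom_fold_props(5)[OF h(2)] assms(3))
  also have "\<dots> = pull D (tgt h') (\<lambda>j. hom_fold h (hom_fold h' j)) Y"
    using hom_fold_props(1,2)[OF h(2)] by (intro pull_pull) auto
  also have "\<dots> = Lam_zigzag D (Comp (Delta s) h' h) Y"
    unfolding hom_fold_props(5)[OF hh]
    by (simp add: hom_fold_Comp[OF h(2,1) assms(3), abs_def]) (simp add: Delta_simps)
  finally have 1: "Lam_zigzag D h' (Lam_zigzag D h Y) = Lam_zigzag D (Comp (Delta s) h' h) Y" .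
  have 2: "mkmor (tgt h') (\<lambda>j. Comp D (zcomp (mkmor (tgt h') c') j) (zcomp (Lam_zigmor h' (mkmor (tgt h) c)) j))
      = mkmor (tgt h') (\<lambda>j. Comp D (c' j) (c (hom_fold h' j)))"
    using hom_fold_props(4)[OF h(2)] assms(3)
    by (intro mkmor_cong) (simp add: zcomp_mkmor hom_fold_props(6)[OF h(2)])
  have c: "src (Comp (Delta s) h' h) = src h" "tgt (Comp (Delta s) h' h) = tgt h'"
    by (simp_all add: Delta_simps)
  show ?thesis
    unfolding harr_def c 1[symmetric] 2[symmetric] mkmor_Comp[symmetric]
    by (simp add: H_cat_def pullback_cat_def Lam_star_def grothendieck_def Lam_func_def)
      (simp add: Lam_def)
qed

lemma harr_dataD:
  assumes "harr_data a Y h c Z"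
  shows "a \<in> Arr C" "h \<in> Delta_arrows s" "Y \<in> zigzags D (src h)" "Z \<in> zigzags D (tgt h)"
    "mor_seq D (tgt h) (pull D (tgt h) (hom_fold h) Y) Z c" "FArr f a = c 0"
    "\<And>j. j \<le> 2 * tgt h \<Longrightarrow> c j \<in> Arr D \<and> Dom D (c j) = zob Y (hom_fold h j) \<and> Cod D (c j) = zob Z j"
    "FObj f (Dom C a) = zob Y 0" "FObj f (Cod C a) = zob Z 0"
proof -
  show d: "a \<in> Arr C" "h \<in> Delta_arrows s" "Y \<in> zigzags D (src h)" "Z \<in> zigzags D (tgt h)"
    "mor_seq D (tgt h) (pull D (tgt h) (hom_fold h) Y) Z c" "FArr f a = c 0"
    using assms by (auto simp: harr_data_def)
  show c: "c j \<in> Arr D \<and> Dom D (c j) = zob Y (hom_fold h j) \<and> Cod D (c j) = zob Z j"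
    if "j \<le> 2 * tgt h" for j
    using d(5) that by (simp add: mor_seq_def zob_pull)
  show "FObj f (Dom C a) = zob Y 0" "FObj f (Cod C a) = zob Z 0"
    using f.Dom_FArr[OF d(1)] f.Cod_FArr[OF d(1)] c[of 0] d(6) hom_fold_props(3)[OF d(2)] by auto
qed

lemma harr_data_Comp:
  assumes b: "harr_data b Y' h' c' Z" and a: "harr_data a Y h c Y'" and h: "src h' = tgt h"
    and ba: "Dom C b = Cod C a"
  shows "harr_data (Comp C b a) Y (Comp (Delta s) h' h) (\<lambda>j. Comp D (c' j) (c (hom_fold h' j))) Z"
proof -
  note A = harr_dataD[OF a] and B = harr_dataD[OF b]
  note F = hom_fold_props[OF B(2)]
  have t: "src (Comp (Delta s) h' h) = src h" "tgt (Comp (Delta s) h' h) = tgt h'"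
    by (simp_all add: Delta_simps)
  have "mor_seq D (tgt h') (pull D (tgt h') (hom_fold h') (pull D (src h') (hom_fold h) Y))
      (pull D (tgt h') (hom_fold h') Y') (\<lambda>j. c (hom_fold h' j))"
    using F(1,2) A(5) by (intro f.B.mor_seq_pull) (auto simp: h)
  moreover have "pull D (tgt h') (hom_fold h') (pull D (src h') (hom_fold h) Y)
      = pull D (tgt h') (hom_fold (Comp (Delta s) h' h)) Y"
    using F(1,2) hom_fold_Comp[OF B(2) A(2) h] by (simp add: pull_pull[of _ _ "src h'"] fun_eq_iff cong: pull_cong)
  ultimately have "mor_seq D (tgt h') (pull D (tgt h') (hom_fold (Comp (Delta s) h' h)) Y) Z
      (\<lambda>j. Comp D (c' j) (c (hom_fold h' j)))"
    using B(4,5) pull_hom_fold_in[OF B(2,3)] pull_hom_fold_in[OF Delta_Comp_in[OF B(2) A(2) h]] A(3)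
    by (intro f.B.mor_seq_comp[of _ _ "pull D (tgt h') (hom_fold h') Y'"]) (simp_all add: t)
  moreover have "FArr f (Comp C b a) = Comp D (c' 0) (c (hom_fold h' 0))"
    using A(1,6) B(1,6) ba F(3) by (simp add: f.FArr_Comp)
  ultimately show ?thesis
    using A B Delta_Comp_in[OF B(2) A(2) h] ba by (simp add: harr_data_def t f.A.Comp_in)
qed

lemma harr_data_Ident:
  assumes "X \<in> Obj C" "Y \<in> zigzags D n" "FObj f X = zob Y 0"
  shows "harr_data (Ident C X) Y (Ident (Delta s) n) (\<lambda>j. Ident D (zob Y j)) Y"
proof -
  have "pull D n (hom_fold (Ident (Delta s) n)) Y = Y"
    by (rule pull_ident[OF assms(2)]) (simp add: hom_fold_Ident)
  moreover have "src (Ident (Delta s) n) = n" "tgt (Ident (Delta s) n) = n" by (simp_all add: Delta_simps)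
  ultimately show ?thesis
    using assms f.B.mor_seq_ident[OF assms(2)]
    by (simp add: harr_data_def f.A.Ident_in Delta_Ident_in f.FArr_Ident)
qed

lemma category_H: "category H"
proof
  fix w assume "w \<in> Arr H"
  then obtain a Y h c Z where w: "harr_data a Y h c Z" "w = harr D a Y h c Z" by (rule Arr_HE)
  note A = harr_dataD[OF w(1)]
  show "Dom H w \<in> Obj H" "Cod H w \<in> Obj H"
    using A by (auto simp: w(2) Dom_harr Cod_harr Obj_H f.A.Dom_in f.A.Cod_in)
  note st = src_tgt_Ident
  note I = Delta_Ident_Comp[OF A(2)]
  have l: "harr_data (Ident C (Cod C a)) Z (Ident (Delta s) (tgt h)) (\<lambda>j. Ident D (zob Z j)) Z"
    and r: "harr_data (Ident C (Dom C a)) Y (Ident (Delta s) (src h)) (\<lambda>j. Ident D (zob Y j)) Y"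
    using A by (auto intro!: harr_data_Ident f.A.Dom_in f.A.Cod_in)
  show "Comp H (Ident H (Cod H w)) w = w"
    unfolding w(2) Cod_harr Ident_H[OF A(4)] Comp_harr[OF l w(1) st(1)]
  proof (rule harr_eqI)
    fix j assume "j \<le> 2 * tgt (Comp (Delta s) (Ident (Delta s) (tgt h)) h)"
    then have "j \<le> 2 * tgt h" by (simp add: I)
    then show "Comp D (Ident D (zob Z j)) (c (hom_fold (Ident (Delta s) (tgt h)) j)) = c j"
      using A(7)[of j] f.B.Ident_left[of "c j"] by (simp add: hom_fold_Ident)
  qed (simp_all add: I A f.A.Ident_left)
  show "Comp H w (Ident H (Dom H w)) = w"
    unfolding w(2) Dom_harr Ident_H[OF A(3)] Comp_harr[OF w(1) r st(2)[symmetric]]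
  proof (rule harr_eqI)
    fix j assume "j \<le> 2 * tgt (Comp (Delta s) h (Ident (Delta s) (src h)))"
    then have "j \<le> 2 * tgt h" by (simp add: I)
    then show "Comp D (c j) (Ident D (zob Y (hom_fold h j))) = c j"
      using A(7)[of j] f.B.Ident_right[of "c j"] by simp
  qed (simp_all add: I A f.A.Ident_right)
next
  fix x assume "x \<in> Obj H"
  then obtain X n Y where x: "x = (X, n, Y)" "X \<in> Obj C" "Y \<in> zigzags D n" "FObj f X = zob Y 0"
    by (auto simp: Obj_H)
  show "Ident H x \<in> Arr H"
    unfolding x(1) Ident_H[OF x(3)] by (rule harr_in[OF harr_data_Ident[OF x(2-4)]])
  show "Dom H (Ident H x) = x" "Cod H (Ident H x) = x"
    unfolding x(1) Ident_H[OF x(3)] Dom_harr Cod_harr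
    using x(2) by (simp_all add: Delta_simps f.A.Dom_Ident f.A.Cod_Ident)
next
  fix v w assume "v \<in> Arr H" "w \<in> Arr H" and vw: "Dom H w = Cod H v"
  from \<open>v \<in> Arr H\<close> obtain a Y h c Z where v: "harr_data a Y h c Z" "v = harr D a Y h c Z" by (rule Arr_HE)
  from \<open>w \<in> Arr H\<close> obtain b Z' h' c' W where w: "harr_data b Z' h' c' W" "w = harr D b Z' h' c' W" by (rule Arr_HE)
  have e: "Dom C b = Cod C a" "src h' = tgt h" "Z' = Z"
    using vw by (simp_all add: v(2) w(2) Dom_harr Cod_harr)
  have w: "harr_data b Z h' c' W" "w = harr D b Z h' c' W" using w e by simp_all
  note A = harr_dataD[OF v(1)] and B = harr_dataD[OF w(1)]
  note k = harr_data_Comp[OF w(1) v(1) e(2,1)]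
  show "Comp H w v \<in> Arr H" "Dom H (Comp H w v) = Dom H v" "Cod H (Comp H w v) = Cod H w"
    unfolding v(2) w(2) Comp_harr[OF w(1) v(1) e(2)] using harr_in[OF k] A(1) B(1) e(1)
    by (simp_all add: Dom_harr Cod_harr f.A.Dom_Comp f.A.Cod_Comp) (simp_all add: Delta_simps)
  fix x assume "x \<in> Arr H" and xw: "Dom H x = Cod H w"
  from \<open>x \<in> Arr H\<close> obtain d W' h'' c'' V where x: "harr_data d W' h'' c'' V" "x = harr D d W' h'' c'' V" by (rule Arr_HE)
  have e': "Dom C d = Cod C b" "src h'' = tgt h'" "W' = W"
    using xw by (simp_all add: x(2) w(2) Dom_harr Cod_harr)
  have x: "harr_data d W h'' c'' V" "x = harr D d W h'' c'' V" using x e' by simp_all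
  note G = harr_dataD[OF x(1)]
  note k' = harr_data_Comp[OF x(1) w(1) e'(2,1)]
  have t: "src h'' = tgt (Comp (Delta s) h' h)" "src (Comp (Delta s) h'' h') = tgt h"
    using e e' by (simp_all add: Delta_simps)
  show "Comp H x (Comp H w v) = Comp H (Comp H x w) v"
    unfolding v(2) w(2) x(2) Comp_harr[OF w(1) v(1) e(2)] Comp_harr[OF x(1) w(1) e'(2)]
      Comp_harr[OF x(1) k t(1)] Comp_harr[OF k' v(1) t(2)]
  proof (rule harr_eqI)
    show "Comp C d (Comp C b a) = Comp C (Comp C d b) a"
      using A(1) B(1) G(1) e(1) e'(1) by (rule f.A.Comp_assoc)
    show "Comp (Delta s) h'' (Comp (Delta s) h' h) = Comp (Delta s) (Comp (Delta s) h'' h') h"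
      using A(2) B(2) G(2) e(2) e'(2) by (intro category.Comp_assoc[OF category_Delta]) (simp_all add: Delta_simps(2-4))
    fix j assume "j \<le> 2 * tgt (Comp (Delta s) h'' (Comp (Delta s) h' h))"
    then have j: "j \<le> 2 * tgt h''" by (simp add: Delta_simps)
    let ?j' = "hom_fold h'' j" and ?j'' = "hom_fold h' (hom_fold h'' j)"
    have j': "?j' \<le> 2 * tgt h'" using hom_fold_props(4)[OF G(2) j] e'(2) by simp
    have j'': "?j'' \<le> 2 * tgt h" using hom_fold_props(4)[OF B(2) j'] e(2) by simp
    show "Comp D (c'' j) (Comp D (c' ?j') (c (hom_fold h' ?j')))
        = Comp D (Comp D (c'' j) (c' ?j')) (c (hom_fold (Comp (Delta s) h'' h') j))"
      using G(7)[OF j] B(7)[OF j'] A(7)[OF j'']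
      by (simp add: hom_fold_Comp[OF G(2) B(2) e'(2)] f.B.Comp_assoc)
  qed simp_all
qed

lemma cat_functor_q: "cat_functor H C q_func"
proof (intro cat_functor.intro cat_functor_axioms.intro category_H f.A.category_axioms)
  fix x assume "x \<in> Obj H"
  then obtain X n Y where x: "x = (X, n, Y)" "X \<in> Obj C" "Y \<in> zigzags D n"
    by (auto simp: Obj_H)
  show "FObj q_func x \<in> Obj C" using x by (simp add: q_func_def)
  show "FArr q_func (Ident H x) = Ident C (FObj q_func x)"
    unfolding x(1) Ident_H[OF x(3)] by (simp add: q_func_def harr_def)
next
  fix w assume "w \<in> Arr H"
  then obtain a Y h c Z where w: "harr_data a Y h c Z" "w = harr D a Y h c Z" by (rule Arr_HE)
  show "FArr q_func w \<in> Arr C" "Dom C (FArr q_func w) = FObj q_func (Dom H w)"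
    "Cod C (FArr q_func w) = FObj q_func (Cod H w)"
    using harr_dataD(1)[OF w(1)] unfolding w(2) Dom_harr Cod_harr by (simp_all add: q_func_def harr_def)
next
  fix v w
  show "FArr q_func (Comp H w v) = Comp C (FArr q_func w) (FArr q_func v)"
    by (cases v; cases w) (simp add: q_func_def H_cat_def pullback_cat_def)
qed

end


section \<open>Truncating zig-zags\<close>

lemma min_collapse:
  fixes z :: nat
  assumes "zigfold \<sigma>"
  shows "\<sigma> (min z j) = min (\<sigma> z) (\<sigma> j)"
  using fold_mono[OF assms, of z j] fold_mono[OF assms, of j z] by (auto simp: min_def)

context category begin

text \<open>Position \<open>z\<close> is connected to position \<open>z + 1\<close> by the \<open>z\<close>-th arrow of the zig-zag; applied to all
  positions beyond \<open>z\<close> it compares two consecutive truncations.\<close>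

lemma mor_seq_truncation_step:
  assumes Y: "Y \<in> zigzags C n"
  shows "mor_seq C n (pull C n (min (if even z then z else Suc z)) Y)
     (pull C n (min (if even z then Suc z else z)) Y)
     (\<lambda>j. if j \<le> z then Ident C (zob Y j) else zed Y z)"
proof -
  have o: "\<And>j. j \<le> 2 * n \<Longrightarrow> zob Y j \<in> Obj C"
    and e: "\<And>j. j < 2 * n \<Longrightarrow> zed Y j \<in> Arr C"
      "\<And>j. j < 2 * n \<Longrightarrow> even j \<Longrightarrow> Dom C (zed Y j) = zob Y j \<and> Cod C (zed Y j) = zob Y (Suc j)"
      "\<And>j. j < 2 * n \<Longrightarrow> odd j \<Longrightarrow> Dom C (zed Y j) = zob Y (Suc j) \<and> Cod C (zed Y j) = zob Y j"
    using zigzags_zig_seq[OF Y] by (auto simp: zig_seq_def)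
  have i: "Comp C (zed Y j) (Ident C (Dom C (zed Y j))) = zed Y j"
    "Comp C (Ident C (Cod C (zed Y j))) (zed Y j) = zed Y j" if "j < 2 * n" for j
    using e(1)[OF that] Ident_left Ident_right by auto
  have m: "\<And>j. j \<le> z \<Longrightarrow> min z j = j \<and> min (Suc z) j = j"
    "\<And>j. z < j \<Longrightarrow> min z j = z \<and> min (Suc z) j = Suc z" by auto
  have 1: "(if j \<le> z then Ident C (zob Y j) else zed Y z) \<in> Arr C
      \<and> Dom C (if j \<le> z then Ident C (zob Y j) else zed Y z) = zob (pull C n (min (if even z then z else Suc z)) Y) j
      \<and> Cod C (if j \<le> z then Ident C (zob Y j) else zed Y z) = zob (pull C n (min (if even z then Suc z else z)) Y) j"
    if "j \<le> 2 * n" for j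
  proof (cases "j \<le> z")
    case True
    then show ?thesis using o[OF that] m(1)[OF True] by (simp add: zob_pull that Ident_in Dom_Ident Cod_Ident)
  next
    case False
    then have "z < j" "z < 2 * n" using that by auto
    then show ?thesis using m(2)[of j] e(1)[of z] e(2)[of z] e(3)[of z] by (simp add: zob_pull that)
  qed
  consider "even z" | "odd z" by blast
  then have 2: "if even j then
        Comp C (zed (pull C n (min (if even z then Suc z else z)) Y) j) (if j \<le> z then Ident C (zob Y j) else zed Y z)
        = Comp C (if Suc j \<le> z then Ident C (zob Y (Suc j)) else zed Y z) (zed (pull C n (min (if even z then z else Suc z)) Y) j)
      else
        Comp C (zed (pull C n (min (if even z then Suc z else z)) Y) j) (if Suc j \<le> z then Ident C (zob Y (Suc j)) else zed Y z)
        = Comp C (if j \<le> z then Ident C (zob Y j) else zed Y z) (zed (pull C n (min (if even z then z else Suc z)) Y) j)"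
    if j: "j < 2 * n" for j
  proof cases
    case 1
    consider "j < z" | "j = z" | "z < j" by linarith
    then show ?thesis
    proof cases
      case a: 1
      then show ?thesis using j e(2,3)[OF j] i[OF j] m(1)[of j] m(1)[of "Suc j"] 1
        by (cases "even j") (simp_all add: zed_pull)
    next
      case a: 2
      then show ?thesis using j e(2)[OF j] i[OF j] m(1)[of j] m(2)[of "Suc j"] 1 by (simp add: zed_pull)
    next
      case a: 3
      then have "z < 2 * n" using j by simp
      then show ?thesis using a j e(2)[of z] i[of z] m(2)[of j] m(2)[of "Suc j"] 1 by (simp add: zed_pull)
    qed
  next
    case 2
    consider "j < z" | "j = z" | "z < j" by linarith
    then show ?thesis
    proof cases
      case a: 1
      then show ?thesis using j e(2,3)[OF j] i[OF j] m(1)[of j] m(1)[of "Suc j"] 2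
        by (cases "even j") (simp_all add: zed_pull)
    next
      case a: 2
      then show ?thesis using j e(3)[OF j] i[OF j] m(1)[of j] m(2)[of "Suc j"] 2 by (simp add: zed_pull)
    next
      case a: 3
      then have "z < 2 * n" using j by simp
      then show ?thesis using a j e(3)[of z] i[of z] m(2)[of j] m(2)[of "Suc j"] 2 by (simp add: zed_pull)
    qed
  qed
  show ?thesis
    unfolding mor_seq_def using 1 2 by blast
qed

end

context zigzag_pullback begin

definition obj_len :: "'o1 \<times> ('o2, 'a2) starobj \<Rightarrow> nat" where
  "obj_len x = 2 * fst (snd x)"

definition arr_fold :: "'a1 \<times> ('o2, 'a2) starhom \<Rightarrow> nat \<Rightarrow> nat" where
  "arr_fold w = hom_fold (fst (dat (snd w)))"

definition trunc_obj :: "nat \<Rightarrow> 'o1 \<times> ('o2, 'a2) starobj \<Rightarrow> 'o1 \<times> ('o2, 'a2) starobj" where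
  "trunc_obj z = (\<lambda>(X, n, Y). (X, n, pull D n (min z) Y))"

definition trunc_arr :: "nat \<Rightarrow> 'a1 \<times> ('o2, 'a2) starhom \<Rightarrow> 'a1 \<times> ('o2, 'a2) starhom" where
  "trunc_arr z = (\<lambda>(a, b). let h = fst (dat b) in
     harr D a (pull D (src h) (min (hom_fold h z)) (snd (src b))) h
       (\<lambda>j. zcomp (dat (snd (dat b))) (min z j)) (pull D (tgt h) (min z) (snd (tgt b))))"

definition trunc_step :: "nat \<Rightarrow> 'o1 \<times> ('o2, 'a2) starobj \<Rightarrow> 'a1 \<times> ('o2, 'a2) starhom" where
  "trunc_step z = (\<lambda>(X, n, Y).
     harr D (Ident C X) (pull D n (min (if even z then z else Suc z)) Y) (Ident (Delta s) n)
       (\<lambda>j. if j \<le> z then Ident D (zob Y j) else zed Y z)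
       (pull D n (min (if even z then Suc z else z)) Y))"

lemma obj_len_eq: "obj_len (X, n, Y) = 2 * n"
  by (simp add: obj_len_def)

lemma trunc_obj_eq: "trunc_obj z (X, n, Y) = (X, n, pull D n (min z) Y)"
  by (simp add: trunc_obj_def)

lemma arr_fold_harr: "arr_fold (harr D a Y h c Z) = hom_fold h"
  by (simp add: arr_fold_def harr_def)

lemma trunc_arr_harr:
  "trunc_arr z (harr D a Y h c Z) = harr D a (pull D (src h) (min (hom_fold h z)) Y) h
     (\<lambda>j. c (min z j)) (pull D (tgt h) (min z) Z)"
  by (simp add: trunc_arr_def harr_def Let_def) (rule mkmor_cong, simp add: zcomp_mkmor)

lemma harr_data_cong:
  assumes c: "harr_data a Y h c Z" and d: "\<And>j. j \<le> 2 * tgt h \<Longrightarrow> c j = d j"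
  shows "harr_data a Y h d Z"
proof -
  let ?n = "tgt h" and ?V = "pull D (tgt h) (hom_fold h) Y"
  have "mor_seq D ?n ?V Z d"
    unfolding mor_seq_def
  proof (intro conjI allI impI)
    fix j assume j: "j < 2 * ?n"
    have "if even j then Comp D (zed Z j) (c j) = Comp D (c (Suc j)) (zed ?V j)
        else Comp D (zed Z j) (c (Suc j)) = Comp D (c j) (zed ?V j)"
      using c j by (simp add: harr_data_def mor_seq_def)
    moreover have "c j = d j" "c (Suc j) = d (Suc j)" using d j by simp_all
    ultimately show "if even j then Comp D (zed Z j) (d j) = Comp D (d (Suc j)) (zed ?V j)
        else Comp D (zed Z j) (d (Suc j)) = Comp D (d j) (zed ?V j)" by (cases "even j") simp_all
  qed (use c d in \<open>auto simp: harr_data_def mor_seq_def\<close>)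
  then show ?thesis
    using c d[of 0] by (simp add: harr_data_def)
qed

lemma pull_min_in: "Y \<in> zigzags D n \<Longrightarrow> pull D n (min z) Y \<in> zigzags D n"
  by (rule f.B.pull_in_zigzags[OF fold_min]) auto

text \<open>Truncating at \<open>hom_fold h z\<close> before applying \<open>\<Lambda>(h)\<close> is the same as truncating at \<open>z\<close> afterwards, because
  \<open>hom_fold h\<close> is monotone and so commutes with minima.\<close>

lemma harr_data_trunc:
  assumes "harr_data a Y h c Z"
  shows "harr_data a (pull D (src h) (min (hom_fold h z)) Y) h (\<lambda>j. c (min z j)) (pull D (tgt h) (min z) Z)"
proof -
  note A = harr_dataD[OF assms]
  note F = hom_fold_props[OF A(2)]
  have "pull D (tgt h) (hom_fold h) (pull D (src h) (min (hom_fold h z)) Y)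
      = pull D (tgt h) (\<lambda>j. min (hom_fold h z) (hom_fold h j)) Y"
    using F(1,2) by (intro pull_pull) auto
  also have "\<dots> = pull D (tgt h) (\<lambda>j. hom_fold h (min z j)) Y"
    by (simp add: min_collapse[OF F(1)])
  also have "\<dots> = pull D (tgt h) (min z) (pull D (tgt h) (hom_fold h) Y)"
    by (rule pull_pull[symmetric]) (simp_all add: fold_min)
  finally have eq: "pull D (tgt h) (hom_fold h) (pull D (src h) (min (hom_fold h z)) Y)
      = pull D (tgt h) (min z) (pull D (tgt h) (hom_fold h) Y)" .
  have "mor_seq D (tgt h) (pull D (tgt h) (min z) (pull D (tgt h) (hom_fold h) Y))
      (pull D (tgt h) (min z) Z) (\<lambda>j. c (min z j))"
    using A(5) by (intro f.B.mor_seq_pull fold_min) auto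
  then show ?thesis
    using A by (simp add: harr_data_def eq pull_min_in)
qed

lemma harr_data_trunc_step:
  assumes "X \<in> Obj C" "Y \<in> zigzags D n" "FObj f X = zob Y 0"
  shows "harr_data (Ident C X) (pull D n (min (if even z then z else Suc z)) Y) (Ident (Delta s) n)
       (\<lambda>j. if j \<le> z then Ident D (zob Y j) else zed Y z)
       (pull D n (min (if even z then Suc z else z)) Y)"
proof -
  have "pull D n (hom_fold (Ident (Delta s) n)) W = W" if "W \<in> zigzags D n" for W
    by (rule pull_ident[OF that]) (simp add: hom_fold_Ident)
  moreover have "src (Ident (Delta s) n) = n" "tgt (Ident (Delta s) n) = n" by (simp_all add: Delta_simps)
  ultimately show ?thesis
    using assms f.B.mor_seq_truncation_step[OF assms(2), of z]
    unfolding harr_data_def by (simp add: f.A.Ident_in Delta_Ident_in f.FArr_Ident pull_min_in)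
qed

text \<open>At a position \<open>j \<le> z\<close> the truncation steps are identities. At all later positions the square is that of
  \<open>c\<close> for the arrow from \<open>z\<close> to \<open>z + 1\<close>, which in \<open>\<Lambda>(h)(Y)\<close> is an identity exactly if \<open>hom_fold h\<close> collapses it.\<close>

lemma trunc_step_natural:
  fixes z :: nat
  assumes w: "harr_data a Y h c Z"
  defines "e \<equiv> (if hom_fold h (Suc z) = hom_fold h z
      then Ident H (trunc_obj (hom_fold h z) (Dom C a, src h, Y))
      else trunc_step (hom_fold h z) (Dom C a, src h, Y))"
  shows "even z \<Longrightarrow> Comp H (trunc_step z (Cod C a, tgt h, Z)) (trunc_arr z (harr D a Y h c Z))
      = Comp H (trunc_arr (Suc z) (harr D a Y h c Z)) e"
    and "odd z \<Longrightarrow> Comp H (trunc_step z (Cod C a, tgt h, Z)) (trunc_arr (Suc z) (harr D a Y h c Z))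
      = Comp H (trunc_arr z (harr D a Y h c Z)) e"
proof -
  note A = harr_dataD[OF w]
  note F = hom_fold_props[OF A(2)]
  \<comment> \<open>The step points from \<open>?z\<close> to \<open>?z'\<close>, which covers both parities at once.\<close>
  let ?\<sigma> = "hom_fold h" and ?z = "if even z then z else Suc z" and ?z' = "if even z then Suc z else z"
  have objs: "Dom C a \<in> Obj C" "Cod C a \<in> Obj C" using A(1) by (simp_all add: f.A.Dom_in f.A.Cod_in)
  define d where "d = (\<lambda>i. if ?\<sigma> (Suc z) = ?\<sigma> z then Ident D (zob Y (min (?\<sigma> z) i))
      else if i \<le> ?\<sigma> z then Ident D (zob Y i) else zed Y (?\<sigma> z))"
  have e: "e = harr D (Ident C (Dom C a)) (pull D (src h) (min (?\<sigma> ?z)) Y) (Ident (Delta s) (src h)) d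
        (pull D (src h) (min (?\<sigma> ?z')) Y)"
    and de: "harr_data (Ident C (Dom C a)) (pull D (src h) (min (?\<sigma> ?z)) Y) (Ident (Delta s) (src h)) d
        (pull D (src h) (min (?\<sigma> ?z')) Y)"
  proof -
    have "e = harr D (Ident C (Dom C a)) (pull D (src h) (min (?\<sigma> ?z)) Y) (Ident (Delta s) (src h)) d
        (pull D (src h) (min (?\<sigma> ?z')) Y)
      \<and> harr_data (Ident C (Dom C a)) (pull D (src h) (min (?\<sigma> ?z)) Y) (Ident (Delta s) (src h)) d
        (pull D (src h) (min (?\<sigma> ?z')) Y)"
    proof (cases "?\<sigma> (Suc z) = ?\<sigma> z")
      case True
      let ?W = "pull D (src h) (min (?\<sigma> z)) Y"
      have W: "?W \<in> zigzags D (src h)" by (rule pull_min_in[OF A(3)])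
      have z: "?\<sigma> ?z = ?\<sigma> z" "?\<sigma> ?z' = ?\<sigma> z" using True by auto
      have "e = harr D (Ident C (Dom C a)) ?W (Ident (Delta s) (src h)) (\<lambda>j. Ident D (zob ?W j)) ?W"
        unfolding e_def using True by (simp add: trunc_obj_eq Ident_H[OF W])
      also have "\<dots> = harr D (Ident C (Dom C a)) ?W (Ident (Delta s) (src h)) d ?W"
        by (rule harr_eqI) (simp_all add: d_def True zob_pull src_tgt_Ident)
      finally have 1: "e = harr D (Ident C (Dom C a)) ?W (Ident (Delta s) (src h)) d ?W" .
      have "harr_data (Ident C (Dom C a)) ?W (Ident (Delta s) (src h)) (\<lambda>j. Ident D (zob ?W j)) ?W"
        using A(8) by (intro harr_data_Ident objs W) (simp add: zob_pull)
      then have "harr_data (Ident C (Dom C a)) ?W (Ident (Delta s) (src h)) d ?W"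
        by (rule harr_data_cong) (simp add: src_tgt_Ident zob_pull d_def True)
      with 1 z show ?thesis by simp
    next
      case False
      note st = fold_step[OF F(1) False]
      have z: "?\<sigma> ?z = (if even (?\<sigma> z) then ?\<sigma> z else Suc (?\<sigma> z))"
        "?\<sigma> ?z' = (if even (?\<sigma> z) then Suc (?\<sigma> z) else ?\<sigma> z)" using st by auto
      have d: "d = (\<lambda>i. if i \<le> ?\<sigma> z then Ident D (zob Y i) else zed Y (?\<sigma> z))"
        using False by (simp add: d_def)
      show ?thesis
        unfolding z d e_def using False harr_data_trunc_step[OF objs(1) A(3,8), of "?\<sigma> z"]
        by (simp add: trunc_step_def)
    qed
    then show "e = harr D (Ident C (Dom C a)) (pull D (src h) (min (?\<sigma> ?z)) Y) (Ident (Delta s) (src h)) d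
        (pull D (src h) (min (?\<sigma> ?z')) Y)"
      "harr_data (Ident C (Dom C a)) (pull D (src h) (min (?\<sigma> ?z)) Y) (Ident (Delta s) (src h)) d
        (pull D (src h) (min (?\<sigma> ?z')) Y)" by blast+
  qed
  note T = harr_data_trunc[OF w]
  note S = harr_data_trunc_step[OF objs(2) A(4,9), of z]
  let ?c = "\<lambda>j. if j \<le> z then Ident D (zob Z j) else zed Z z"
  have sq: "Comp D (?c j) (c (min ?z j)) = Comp D (c (min ?z' j)) (d (?\<sigma> j))" if j: "j \<le> 2 * tgt h" for j
  proof (cases "j \<le> z")
    case True
    have "?\<sigma> j \<le> ?\<sigma> z" by (rule fold_mono[OF F(1) True])
    then have "d (?\<sigma> j) = Ident D (zob Y (?\<sigma> j))" by (simp add: d_def min_def)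
    moreover have "min ?z j = j" "min ?z' j = j" using True by auto
    ultimately show ?thesis
      using True A(7)[OF j] f.B.Ident_left[of "c j"] f.B.Ident_right[of "c j"] by simp
  next
    case False
    then have z: "z < 2 * tgt h" "min ?z j = ?z" "min ?z' j = ?z'" using j by auto
    have "d (?\<sigma> j) = zed (pull D (tgt h) ?\<sigma> Y) z"
    proof (cases "?\<sigma> (Suc z) = ?\<sigma> z")
      case True
      have "?\<sigma> z \<le> ?\<sigma> j" using False by (intro fold_mono[OF F(1)]) simp
      then show ?thesis using True z(1) by (simp add: d_def zed_pull)
    next
      case nc: False
      have "?\<sigma> (Suc z) \<le> ?\<sigma> j" using False by (intro fold_mono[OF F(1)]) simp
      then show ?thesis using nc fold_step(1)[OF F(1) nc] z(1) by (simp add: d_def zed_pull)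
    qed
    then show ?thesis
      using False z A(5) by (auto simp: mor_seq_def)
  qed
  have main: "Comp H (trunc_step z (Cod C a, tgt h, Z)) (trunc_arr ?z (harr D a Y h c Z))
      = Comp H (trunc_arr ?z' (harr D a Y h c Z)) e"
  proof -
    have "Comp H (trunc_step z (Cod C a, tgt h, Z)) (trunc_arr ?z (harr D a Y h c Z))
      = harr D (Comp C (Ident C (Cod C a)) a) (pull D (src h) (min (?\<sigma> ?z)) Y)
          (Comp (Delta s) (Ident (Delta s) (tgt h)) h)
          (\<lambda>j. Comp D (?c j) (c (min ?z (hom_fold (Ident (Delta s) (tgt h)) j))))
          (pull D (tgt h) (min ?z') Z)"
      unfolding trunc_arr_harr trunc_step_def prod.case
      by (rule Comp_harr[OF S T src_tgt_Ident(1)])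
    also have "\<dots> = harr D (Comp C a (Ident C (Dom C a))) (pull D (src h) (min (?\<sigma> ?z)) Y)
          (Comp (Delta s) h (Ident (Delta s) (src h)))
          (\<lambda>j. Comp D (c (min ?z' j)) (d (?\<sigma> j)))
          (pull D (tgt h) (min ?z') Z)"
    proof (rule harr_eqI)
      fix j assume "j \<le> 2 * tgt (Comp (Delta s) (Ident (Delta s) (tgt h)) h)"
      then have j: "j \<le> 2 * tgt h" by (simp add: Delta_Ident_Comp[OF A(2)])
      then show "Comp D (?c j) (c (min ?z (hom_fold (Ident (Delta s) (tgt h)) j)))
          = Comp D (c (min ?z' j)) (d (?\<sigma> j))"
        using sq[OF j] by (simp add: hom_fold_Ident min_absorb1)
    qed (simp_all add: f.A.Ident_left f.A.Ident_right A(1) Delta_Ident_Comp[OF A(2)])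
    also have "\<dots> = Comp H (trunc_arr ?z' (harr D a Y h c Z)) e"
      unfolding trunc_arr_harr e
      by (rule Comp_harr[OF T de src_tgt_Ident(2)[symmetric], symmetric])
    finally show ?thesis .
  qed
  show "even z \<Longrightarrow> Comp H (trunc_step z (Cod C a, tgt h, Z)) (trunc_arr z (harr D a Y h c Z))
      = Comp H (trunc_arr (Suc z) (harr D a Y h c Z)) e"
    "odd z \<Longrightarrow> Comp H (trunc_step z (Cod C a, tgt h, Z)) (trunc_arr (Suc z) (harr D a Y h c Z))
      = Comp H (trunc_arr z (harr D a Y h c Z)) e"
    using main by simp_all
qed

text \<open>The zig-zag of an object \<open>(X, [n], Y)\<close> consists of its truncations, joined by \<open>trunc_step\<close>.\<close>

sublocale sliding H obj_len arr_fold trunc_obj trunc_arr trunc_step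
proof (intro sliding.intro sliding_axioms.intro category_H)
  fix w assume "w \<in> Arr H"
  then obtain a Y h c Z where w: "harr_data a Y h c Z" "w = harr D a Y h c Z" by (rule Arr_HE)
  note A = harr_dataD[OF w(1)]
  note F = hom_fold_props[OF A(2)]
  note E = w(2) Dom_harr Cod_harr arr_fold_harr obj_len_eq trunc_obj_eq trunc_arr_harr
  show "arr_fold w 0 = 0" "arr_fold w (obj_len (Cod H w)) = obj_len (Dom H w)" "collapse (arr_fold w)"
    using F(1,2,3) by (simp_all add: E fold_collapse)
  show "trunc_arr (obj_len (Cod H w)) w = w"
    unfolding E by (rule harr_eqI) (simp_all add: F(2) pull_ident[OF A(3)] pull_ident[OF A(4)])
  fix z
  show "even (arr_fold w z) \<longleftrightarrow> even z" if "arr_fold w (Suc z) \<noteq> arr_fold w z"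
    using fold_step(2)[OF F(1), of z] that by (simp add: E)
  show "trunc_arr z w \<in> Arr H" unfolding E by (rule harr_in[OF harr_data_trunc[OF w(1)]])
  show "Dom H (trunc_arr z w) = trunc_obj (arr_fold w z) (Dom H w)"
    "Cod H (trunc_arr z w) = trunc_obj z (Cod H w)" by (simp_all add: E)
  show "Comp H (trunc_step z (Cod H w)) (trunc_arr z w) = Comp H (trunc_arr (Suc z) w)
        (if arr_fold w (Suc z) = arr_fold w z then Ident H (trunc_obj (arr_fold w z) (Dom H w))
         else trunc_step (arr_fold w z) (Dom H w))" if "even z"
    using trunc_step_natural(1)[OF w(1) that] by (simp only: w(2) Dom_harr Cod_harr arr_fold_harr)
  show "Comp H (trunc_step z (Cod H w)) (trunc_arr (Suc z) w) = Comp H (trunc_arr z w)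
        (if arr_fold w (Suc z) = arr_fold w z then Ident H (trunc_obj (arr_fold w z) (Dom H w))
         else trunc_step (arr_fold w z) (Dom H w))" if "odd z"
    using trunc_step_natural(2)[OF w(1) that] by (simp only: w(2) Dom_harr Cod_harr arr_fold_harr)
  fix v assume "v \<in> Arr H" and vw: "Dom H v = Cod H w"
  then obtain b Z' h' c' W where v: "harr_data b Z' h' c' W" "v = harr D b Z' h' c' W"
    using Arr_HE by blast
  have e: "Dom C b = Cod C a" "src h' = tgt h" "Z' = Z"
    using vw by (simp_all add: v(2) w(2) Dom_harr Cod_harr)
  have v: "harr_data b Z h' c' W" "v = harr D b Z h' c' W" using v e by simp_all
  note B = harr_dataD[OF v(1)]
  have t: "src (Comp (Delta s) h' h) = src h" "tgt (Comp (Delta s) h' h) = tgt h'"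
    by (simp_all add: Delta_simps)
  note hc = hom_fold_Comp[OF B(2) A(2) e(2)]
  show "arr_fold (Comp H v w) z = arr_fold w (arr_fold v z)"
    unfolding v(2) w(2) Comp_harr[OF v(1) w(1) e(2)] arr_fold_harr by (rule hc)
  have T: "harr_data b (pull D (tgt h) (min (hom_fold h' z)) Z) h' (\<lambda>j. c' (min z j)) (pull D (tgt h') (min z) W)"
    using harr_data_trunc[OF v(1), of z] by (simp add: e(2))
  show "trunc_arr z (Comp H v w) = Comp H (trunc_arr z v) (trunc_arr (arr_fold v z) w)"
    unfolding v(2) w(2) Comp_harr[OF v(1) w(1) e(2)] arr_fold_harr trunc_arr_harr t hc e(2)
      Comp_harr[OF T harr_data_trunc[OF w(1)] e(2)]
    by (rule harr_eqI) (simp_all add: min_collapse[OF hom_fold_props(1)[OF B(2)]])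
next
  fix x assume "x \<in> Obj H"
  then obtain X n Y where x: "x = (X, n, Y)" "X \<in> Obj C" "Y \<in> zigzags D n" "FObj f X = zob Y 0"
    by (auto simp: Obj_H)
  show "trunc_obj (obj_len x) x = x"
    by (simp add: x(1) obj_len_eq trunc_obj_eq pull_ident[OF x(3)])
  fix z
  have W: "pull D n (min z) Y \<in> zigzags D n" by (rule pull_min_in[OF x(3)])
  show "trunc_obj z x \<in> Obj H"
    using x W by (simp add: trunc_obj_eq Obj_H zob_pull)
  show "trunc_arr z (Ident H x) = Ident H (trunc_obj z x)"
    unfolding x(1) trunc_obj_eq Ident_H[OF x(3)] Ident_H[OF W] trunc_arr_harr
  proof (rule harr_eqI)
    show "pull D (src (Ident (Delta s) n)) (min (hom_fold (Ident (Delta s) n) z)) Y = pull D n (min z) Y"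
      unfolding src_tgt_Ident by (rule pull_cong) (simp add: hom_fold_Ident)
  qed (simp_all add: src_tgt_Ident zob_pull)
  show "trunc_step z x \<in> Arr H"
    unfolding x(1) trunc_step_def prod.case by (rule harr_in[OF harr_data_trunc_step[OF x(2-4)]])
  show "even z \<Longrightarrow> Dom H (trunc_step z x) = trunc_obj z x \<and> Cod H (trunc_step z x) = trunc_obj (Suc z) x"
    "odd z \<Longrightarrow> Dom H (trunc_step z x) = trunc_obj (Suc z) x \<and> Cod H (trunc_step z x) = trunc_obj z x"
    using x(2) by (simp_all add: x(1) trunc_step_def Dom_harr Cod_harr trunc_obj_eq src_tgt_Ident
        f.A.Dom_Ident f.A.Cod_Ident)
qed


section \<open>Constant zig-zags\<close>

text \<open>Replacing \<open>(X, [n], Y)\<close> by the constant zig-zag on \<open>f(X)\<close> of length \<open>E(n)\<close> is functorial in \<open>(X, [n], Y)\<close>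
  for each endofunctor \<open>E\<close> of the index category, and natural in \<open>E\<close>: constant zig-zags are preserved by all
  \<open>\<Lambda>(\<phi>)\<close>.\<close>

definition const_zig :: "nat \<Rightarrow> 'o2 \<Rightarrow> ('o2, 'a2) zigzag" where
  "const_zig n X = mkzig n (\<lambda>_. X) (\<lambda>_. Ident D X)"

definition const_func ::
    "(nat, (nat, nat \<Rightarrow> nat) hom, nat, (nat, nat \<Rightarrow> nat) hom) func
     \<Rightarrow> ('o1 \<times> ('o2, 'a2) starobj, 'a1 \<times> ('o2, 'a2) starhom,
         'o1 \<times> ('o2, 'a2) starobj, 'a1 \<times> ('o2, 'a2) starhom) func" where
  "const_func E = \<lparr>
     FObj = (\<lambda>(X, n, Y). (X, FObj E n, const_zig (FObj E n) (FObj f X))),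
     FArr = (\<lambda>(a, b). harr D a (const_zig (FObj E (fst (src b))) (FObj f (Dom C a)))
       (FArr E (fst (dat b))) (\<lambda>_. FArr f a) (const_zig (FObj E (fst (tgt b))) (FObj f (Cod C a))))\<rparr>"

lemma zob_const_zig: "j \<le> 2 * n \<Longrightarrow> zob (const_zig n X) j = X"
  by (simp add: const_zig_def zob_mkzig)

lemma zed_const_zig: "j < 2 * n \<Longrightarrow> zed (const_zig n X) j = Ident D X"
  by (simp add: const_zig_def zed_mkzig)

lemma const_zig_in: "X \<in> Obj D \<Longrightarrow> const_zig n X \<in> zigzags D n"
  unfolding const_zig_def
  by (rule mkzig_in_zigzags) (simp add: zig_seq_def f.B.Ident_in f.B.Dom_Ident f.B.Cod_Ident)

lemma pull_const_zig:
  assumes "zigfold \<sigma>" "\<sigma> (2 * n) \<le> 2 * m"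
  shows "pull D n \<sigma> (const_zig m X) = const_zig n X"
  unfolding pull_def const_zig_def[of n]
proof (rule mkzig_cong)
  fix j assume "j \<le> 2 * n"
  then show "zob (const_zig m X) (\<sigma> j) = X"
    using fold_mono[OF assms(1), of j "2 * n"] assms(2) by (simp add: zob_const_zig)
next
  fix j assume j: "j < 2 * n"
  then show "(if \<sigma> (Suc j) = \<sigma> j then Ident D (zob (const_zig m X) (\<sigma> j)) else zed (const_zig m X) (\<sigma> j))
      = Ident D X"
    using fold_mono[OF assms(1), of j "2 * n"] assms fold_step_le[OF assms j]
    by (simp add: zob_const_zig zed_const_zig)
qed

lemma harr_data_const:
  assumes a: "a \<in> Arr C" and h: "h \<in> Delta_arrows s"
  shows "harr_data a (const_zig (src h) (FObj f (Dom C a))) h (\<lambda>_. FArr f a)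
    (const_zig (tgt h) (FObj f (Cod C a)))"
proof -
  note F = hom_fold_props[OF h]
  have o: "FObj f (Dom C a) \<in> Obj D" "FObj f (Cod C a) \<in> Obj D"
    using a by (simp_all add: f.FObj_in f.A.Dom_in f.A.Cod_in)
  have "mor_seq D (tgt h) (const_zig (tgt h) (FObj f (Dom C a))) (const_zig (tgt h) (FObj f (Cod C a)))
      (\<lambda>_. FArr f a)"
    using a f.B.Ident_left[of "FArr f a"] f.B.Ident_right[of "FArr f a"]
    by (simp add: mor_seq_def zob_const_zig zed_const_zig f.FArr_in f.Dom_FArr f.Cod_FArr)
  then show ?thesis
    using a h o F(1,2) by (simp add: harr_data_def pull_const_zig const_zig_in)
qed

lemma const_func_harr:
  assumes E: "cat_functor (Delta s) (Delta s) E" and h: "h \<in> Delta_arrows s"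
  shows "FArr (const_func E) (harr D a Y h c Z) = harr D a
    (const_zig (src (FArr E h)) (FObj f (Dom C a))) (FArr E h) (\<lambda>_. FArr f a)
    (const_zig (tgt (FArr E h)) (FObj f (Cod C a)))"
  using cat_functor.Dom_FArr[OF E, of h] cat_functor.Cod_FArr[OF E, of h] h
  by (simp add: const_func_def) (simp add: harr_def Delta_simps)

lemma FArr_Delta_in:
  assumes "cat_functor (Delta s) (Delta s) E" "h \<in> Delta_arrows s"
  shows "FArr E h \<in> Delta_arrows s" "src (FArr E h) = FObj E (src h)" "tgt (FArr E h) = FObj E (tgt h)"
  using cat_functor.FArr_in[OF assms(1), of h] cat_functor.Dom_FArr[OF assms(1), of h]
    cat_functor.Cod_FArr[OF assms(1), of h] assms(2) by (simp_all add: Delta_simps)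

lemma Comp_const_harr:
  assumes a: "a \<in> Arr C" and b: "b \<in> Arr C" and ba: "Dom C b = Cod C a"
    and h: "h \<in> Delta_arrows s" and g: "g \<in> Delta_arrows s" and gh: "src g = tgt h"
  shows "Comp H (harr D b (const_zig (src g) (FObj f (Dom C b))) g (\<lambda>_. FArr f b) (const_zig (tgt g) (FObj f (Cod C b))))
      (harr D a (const_zig (src h) (FObj f (Dom C a))) h (\<lambda>_. FArr f a) (const_zig (tgt h) (FObj f (Cod C a))))
    = harr D (Comp C b a) (const_zig (src h) (FObj f (Dom C a))) (Comp (Delta s) g h) (\<lambda>_. FArr f (Comp C b a))
        (const_zig (tgt g) (FObj f (Cod C b)))"
proof -
  have B: "harr_data b (const_zig (tgt h) (FObj f (Cod C a))) g (\<lambda>_. FArr f b) (const_zig (tgt g) (FObj f (Cod C b)))"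
    using harr_data_const[OF b g] by (simp add: gh ba)
  show ?thesis
    unfolding gh ba Comp_harr[OF B harr_data_const[OF a h] gh] f.FArr_Comp[OF a b ba] ..
qed

lemma const_Ident:
  assumes "X \<in> Obj C"
  shows "Ident H (X, n, const_zig n (FObj f X)) = harr D (Ident C X) (const_zig n (FObj f X))
    (Ident (Delta s) n) (\<lambda>_. FArr f (Ident C X)) (const_zig n (FObj f X))"
  using Ident_H[OF const_zig_in[OF f.FObj_in[OF assms]], of X n]
  by (simp, intro harr_eqI) (simp_all add: f.FArr_Ident[OF assms] src_tgt_Ident zob_const_zig)

lemma cat_functor_const_func:
  assumes E: "cat_functor (Delta s) (Delta s) E"
  shows "cat_functor H H (const_func E)"
proof (intro cat_functor.intro cat_functor_axioms.intro category_H)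
  fix x assume "x \<in> Obj H"
  then obtain X n Y where x: "x = (X, n, Y)" "X \<in> Obj C" "Y \<in> zigzags D n" "FObj f X = zob Y 0"
    by (auto simp: Obj_H)
  show "FObj (const_func E) x \<in> Obj H"
    using x(1,2) by (simp add: const_func_def Obj_H const_zig_in f.FObj_in zob_const_zig)
  have "FArr E (Ident (Delta s) n) = Ident (Delta s) (FObj E n)"
    using cat_functor.FArr_Ident[OF E, of n] by (simp add: Delta_simps(1))
  then show "FArr (const_func E) (Ident H x) = Ident H (FObj (const_func E) x)"
    unfolding x(1) Ident_H[OF x(3)] const_func_harr[OF E Delta_Ident_in]
    using x(2) by (simp add: const_func_def const_Ident src_tgt_Ident f.A.Dom_Ident f.A.Cod_Ident)
next
  fix w assume "w \<in> Arr H"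
  then obtain a Y h c Z where w: "harr_data a Y h c Z" "w = harr D a Y h c Z" by (rule Arr_HE)
  note A = harr_dataD[OF w(1)]
  note Eh = FArr_Delta_in[OF E A(2)]
  note W = w(2) const_func_harr[OF E A(2)]
  show "FArr (const_func E) w \<in> Arr H"
    unfolding W by (rule harr_in[OF harr_data_const[OF A(1) Eh(1)]])
  show "Dom H (FArr (const_func E) w) = FObj (const_func E) (Dom H w)"
    "Cod H (FArr (const_func E) w) = FObj (const_func E) (Cod H w)"
    unfolding W Dom_harr Cod_harr by (simp_all add: const_func_def Eh)
  fix v assume "v \<in> Arr H" and vw: "Dom H v = Cod H w"
  then obtain b Z' h' c' V where v: "harr_data b Z' h' c' V" "v = harr D b Z' h' c' V"
    using Arr_HE by blast
  have e: "Dom C b = Cod C a" "src h' = tgt h" "Z' = Z"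
    using vw by (simp_all add: v(2) w(2) Dom_harr Cod_harr)
  have v: "harr_data b Z h' c' V" "v = harr D b Z h' c' V" using v e by simp_all
  note B = harr_dataD[OF v(1)]
  note Eh' = FArr_Delta_in[OF E B(2)]
  have "FArr E (Comp (Delta s) h' h) = Comp (Delta s) (FArr E h') (FArr E h)"
    using cat_functor.FArr_Comp[OF E, of h h'] A(2) B(2) e(2) by (simp add: Delta_simps(2-4))
  moreover have "src (FArr E h') = tgt (FArr E h)" by (simp add: Eh Eh' e(2))
  moreover have "src (Comp (Delta s) g k) = src k" "tgt (Comp (Delta s) g k) = tgt g" for g k
    by (simp_all add: Delta_simps)
  ultimately show "FArr (const_func E) (Comp H v w) = Comp H (FArr (const_func E) v) (FArr (const_func E) w)"
    unfolding v(2) w(2) Comp_harr[OF v(1) w(1) e(2)] const_func_harr[OF E A(2)] const_func_harr[OF E B(2)]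
      const_func_harr[OF E Delta_Comp_in[OF B(2) A(2) e(2)]]
    using Comp_const_harr[OF A(1) B(1) e(1) Eh(1) Eh'(1)] A(1) B(1) e(1)
    by (simp add: f.A.Dom_Comp f.A.Cod_Comp)
qed

lemma nat_trans_const_func:
  assumes \<theta>: "nat_trans (Delta s) (Delta s) E E' \<theta>"
  shows "nat_trans H H (const_func E) (const_func E') (\<lambda>(X, n, Y).
    harr D (Ident C X) (const_zig (FObj E n) (FObj f X)) (\<theta> n) (\<lambda>_. FArr f (Ident C X))
      (const_zig (FObj E' n) (FObj f X)))"
proof -
  have E: "cat_functor (Delta s) (Delta s) E" and E': "cat_functor (Delta s) (Delta s) E'"
    and t: "\<And>n. \<theta> n \<in> Delta_arrows s \<and> src (\<theta> n) = FObj E n \<and> tgt (\<theta> n) = FObj E' n"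
    and n: "\<And>h. h \<in> Delta_arrows s \<Longrightarrow>
      Comp (Delta s) (\<theta> (tgt h)) (FArr E h) = Comp (Delta s) (FArr E' h) (\<theta> (src h))"
    using \<theta> by (auto simp: nat_trans_def Delta_simps(1-4))
  let ?\<eta> = "\<lambda>(X, n, Y). harr D (Ident C X) (const_zig (FObj E n) (FObj f X)) (\<theta> n)
    (\<lambda>_. FArr f (Ident C X)) (const_zig (FObj E' n) (FObj f X))"
  have eta: "?\<eta> (X, n, Y) = harr D (Ident C X) (const_zig (src (\<theta> n)) (FObj f (Dom C (Ident C X)))) (\<theta> n)
    (\<lambda>_. FArr f (Ident C X)) (const_zig (tgt (\<theta> n)) (FObj f (Cod C (Ident C X))))" if "X \<in> Obj C" for X n Y
    using that t by (simp add: f.A.Dom_Ident f.A.Cod_Ident)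
  show ?thesis
    unfolding nat_trans_def
  proof (intro conjI ballI cat_functor_const_func E E')
    fix x assume "x \<in> Obj H"
    then obtain X n Y where x: "x = (X, n, Y)" "X \<in> Obj C"
      by (auto simp: Obj_H)
    show "?\<eta> x \<in> Arr H"
      unfolding x(1) eta[OF x(2)] using t x(2) by (intro harr_in harr_data_const) (auto simp: f.A.Ident_in)
    show "Dom H (?\<eta> x) = FObj (const_func E) x" "Cod H (?\<eta> x) = FObj (const_func E') x"
      using t x(2) by (simp_all add: x(1) Dom_harr Cod_harr const_func_def f.A.Dom_Ident f.A.Cod_Ident)
  next
    fix w assume "w \<in> Arr H"
    then obtain a Y h c Z where w: "harr_data a Y h c Z" "w = harr D a Y h c Z" by (rule Arr_HE)
    note A = harr_dataD[OF w(1)]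
    note Eh = FArr_Delta_in[OF E A(2)] and Eh' = FArr_Delta_in[OF E' A(2)]
    have o: "Dom C a \<in> Obj C" "Cod C a \<in> Obj C" using A(1) by (simp_all add: f.A.Dom_in f.A.Cod_in)
    have "Comp H (?\<eta> (Cod H w)) (FArr (const_func E) w)
        = harr D a (const_zig (FObj E (src h)) (FObj f (Dom C a))) (Comp (Delta s) (\<theta> (tgt h)) (FArr E h))
            (\<lambda>_. FArr f a) (const_zig (FObj E' (tgt h)) (FObj f (Cod C a)))"
      unfolding w(2) Cod_harr eta[OF o(2)] const_func_harr[OF E A(2)]
      using Comp_const_harr[OF A(1) f.A.Ident_in[OF o(2)], of "FArr E h" "\<theta> (tgt h)"] t[of "tgt h"] Eh A(1) o
      by (simp add: f.A.Dom_Ident f.A.Cod_Ident f.A.Ident_left)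
    moreover have "Comp H (FArr (const_func E') w) (?\<eta> (Dom H w))
        = harr D a (const_zig (FObj E (src h)) (FObj f (Dom C a))) (Comp (Delta s) (FArr E' h) (\<theta> (src h)))
            (\<lambda>_. FArr f a) (const_zig (FObj E' (tgt h)) (FObj f (Cod C a)))"
      unfolding w(2) Dom_harr eta[OF o(1)] const_func_harr[OF E' A(2)]
      using Comp_const_harr[OF f.A.Ident_in[OF o(1)] A(1), of "\<theta> (src h)" "FArr E' h"] t[of "src h"] Eh' A(1) o
      by (simp add: f.A.Dom_Ident f.A.Cod_Ident f.A.Ident_right)
    ultimately show "Comp H (?\<eta> (Cod H w)) (FArr (const_func E) w) = Comp H (FArr (const_func E') w) (?\<eta> (Dom H w))"
      using n[OF A(2)] by simp
  qed
qed

text \<open>Truncating at \<open>0\<close> keeps the length and leaves only the first barred entry, which is \<open>f(X)\<close>.\<close>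

lemma truncate0_eq_const_func:
  "x \<in> Obj H \<Longrightarrow> FObj truncate0 x = FObj (const_func id_func) x"
  "w \<in> Arr H \<Longrightarrow> FArr truncate0 w = FArr (const_func id_func) w"
proof -
  have p: "pull D n (min 0) Y = const_zig n (zob Y 0)" for n Y
    unfolding pull_def const_zig_def by (rule mkzig_cong) simp_all
  show "FObj truncate0 x = FObj (const_func id_func) x" if "x \<in> Obj H" for x
    using that by (auto simp: Obj_H truncate0_def trunc_obj_eq const_func_def id_func_def p)
  show "FArr truncate0 w = FArr (const_func id_func) w" if wH: "w \<in> Arr H" for w
  proof -
    from wH obtain a Y h c Z where w: "harr_data a Y h c Z" "w = harr D a Y h c Z" by (rule Arr_HE)
    note A = harr_dataD[OF w(1)]
    show ?thesis
      unfolding w(2) const_func_harr[OF cat_functor_id_func[OF category_Delta] A(2)]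
      using A(6,8,9) hom_fold_props(3)[OF A(2)] by (simp add: truncate0_def trunc_arr_harr p id_func_def)
  qed
qed

lemma i_func_eq:
  "FObj (i_func s C f) X = (X, 0, const_zig 0 (FObj f X))"
  "FArr (i_func s C f) a = harr D a (const_zig 0 (FObj f (Dom C a))) (Ident (Delta s) 0)
     (\<lambda>_. FArr f a) (const_zig 0 (FObj f (Cod C a)))"
proof -
  have z: "zigzag0 X = const_zig 0 X" for X
    by (auto simp: zigzag0_def const_zig_def mkzig_def restrict_def)
  have m: "zigmor0 b = mkmor 0 (\<lambda>_. b)" for b :: 'a2
    by (auto simp: zigmor0_def mkmor_def restrict_def)
  have "Lam_zigzag D (Ident (Delta s) 0) (const_zig 0 X) = const_zig 0 X" for X
    using hom_fold_props(1,2)[OF Delta_Ident_in[of s 0]]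
    by (simp add: hom_fold_props(5)[OF Delta_Ident_in] src_tgt_Ident pull_const_zig)
  then show "FObj (i_func s C f) X = (X, 0, const_zig 0 (FObj f X))"
    "FArr (i_func s C f) a = harr D a (const_zig 0 (FObj f (Dom C a))) (Ident (Delta s) 0)
       (\<lambda>_. FArr f a) (const_zig 0 (FObj f (Cod C a)))"
    by (simp_all add: i_func_def z m Let_def harr_def src_tgt_Ident)
qed

lemma cat_functor_i: "cat_functor C H (i_func s C f)"
proof (intro cat_functor.intro cat_functor_axioms.intro category_H f.A.category_axioms)
  fix X assume X: "X \<in> Obj C"
  then show "FObj (i_func s C f) X \<in> Obj H"
    by (simp add: i_func_eq Obj_H const_zig_in f.FObj_in zob_const_zig)
  show "FArr (i_func s C f) (Ident C X) = Ident H (FObj (i_func s C f) X)"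
    using X by (simp add: i_func_eq const_Ident f.A.Dom_Ident f.A.Cod_Ident)
next
  fix a assume a: "a \<in> Arr C"
  show "FArr (i_func s C f) a \<in> Arr H"
    unfolding i_func_eq using harr_in[OF harr_data_const[OF a Delta_Ident_in[of s 0]]] by (simp add: src_tgt_Ident)
  show "Dom H (FArr (i_func s C f) a) = FObj (i_func s C f) (Dom C a)"
    "Cod H (FArr (i_func s C f) a) = FObj (i_func s C f) (Cod C a)"
    by (simp_all add: i_func_eq Dom_harr Cod_harr src_tgt_Ident)
  fix b assume "b \<in> Arr C" "Dom C b = Cod C a"
  then show "FArr (i_func s C f) (Comp C b a) = Comp H (FArr (i_func s C f) b) (FArr (i_func s C f) a)"
    using Comp_const_harr[OF a _ _ Delta_Ident_in[of s 0] Delta_Ident_in[of s 0], of b]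
      Delta_Ident_Comp(1)[OF Delta_Ident_in[of s 0]] a
    by (simp add: i_func_eq src_tgt_Ident f.A.Dom_Comp f.A.Cod_Comp)
qed

lemma comp_i_q_eq_const_func:
  "x \<in> Obj H \<Longrightarrow> FObj (comp_func (i_func s C f) q_func) x = FObj (const_func (const0 s)) x"
  "w \<in> Arr H \<Longrightarrow> FArr (comp_func (i_func s C f) q_func) w = FArr (const_func (const0 s)) w"
proof -
  show "x \<in> Obj H \<Longrightarrow> FObj (comp_func (i_func s C f) q_func) x = FObj (const_func (const0 s)) x"
    by (auto simp: Obj_H comp_func_def q_func_def i_func_eq const_func_def const0_def)
  assume "w \<in> Arr H"
  then obtain a Y h c Z where w: "harr_data a Y h c Z" "w = harr D a Y h c Z" by (rule Arr_HE)
  have "fst w = a" by (simp add: w(2) harr_def)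
  then show "FArr (comp_func (i_func s C f) q_func) w = FArr (const_func (const0 s)) w"
    unfolding w(2) const_func_harr[OF cat_functor_const0 harr_dataD(2)[OF w(1)]]
    by (simp add: comp_func_def q_func_def i_func_eq const0_def src_tgt_Ident)
qed

end


section \<open>The homotopy equivalence\<close>

lemma classifying_map_cong:
  assumes F: "cat_functor A B F"
    and o: "\<And>X. X \<in> Obj A \<Longrightarrow> FObj F' X = FObj F X" and a: "\<And>a. a \<in> Arr A \<Longrightarrow> FArr F' a = FArr F a"
    and c: "c \<in> topspace (classifying_space A)"
  shows "classifying_map B F' c = classifying_map B F c"
  using c
proof (rule topspace_classifying_space)
  fix n x t assume x: "cat_functor (ordinal n) A x" and c: "c = point A n x t"
  have "point B n (comp_func F' x) t = point B n (comp_func F x) t"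
    by (rule point_cong)
      (auto simp: comp_func_def Obj_ordinal Arr_ordinal intro!: o a
        cat_functor.FObj_in[OF x] cat_functor.FArr_in[OF x])
  with c x F cat_functor_cong[OF F o a] show ?thesis
    by (simp add: classifying_map_point)
qed

lemma nat_trans_refl:
  assumes "cat_functor A B F"
  shows "nat_trans A B F F (\<lambda>X. Ident B (FObj F X))"
proof -
  interpret cat_functor A B F by fact
  have "Comp B (Ident B (FObj F (Cod A a))) (FArr F a) = Comp B (FArr F a) (Ident B (FObj F (Dom A a)))"
    if "a \<in> Arr A" for a
    using that FArr_in B.Ident_left[of "FArr F a"] B.Ident_right[of "FArr F a"]
    by (simp add: Dom_FArr Cod_FArr)
  then show ?thesis
    using assms FObj_in by (simp add: nat_trans_def B.Ident_in B.Dom_Ident B.Cod_Ident)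
qed

lemma continuous_map_classifying_map:
  assumes "cat_functor A B F"
  shows "continuous_map (classifying_space A) (classifying_space B) (classifying_map B F)"
  using nat_trans_imp_B_homotopic[OF nat_trans_refl[OF assms]]
  unfolding B_homotopic_def by (blast dest: homotopic_with_imp_continuous_maps)

lemma classifying_map_id_func:
  "\<lbrakk>category A; c \<in> topspace (classifying_space A)\<rbrakk> \<Longrightarrow> classifying_map A id_func c = c"
  by (rule classifying_map_eq_id[OF cat_functor_id_func]) (simp_all add: id_func_def)

lemma homotopic_with_cong_topspace:
  assumes h: "homotopic_with (\<lambda>_. True) X Y u v"
    and u: "\<And>x. x \<in> topspace X \<Longrightarrow> u' x = u x" and v: "\<And>x. x \<in> topspace X \<Longrightarrow> v' x = v x"
  shows "homotopic_with (\<lambda>_. True) X Y u' v'"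
proof -
  have c: "continuous_map X Y u" "continuous_map X Y v"
    using homotopic_with_imp_continuous_maps[OF h] by blast+
  have "homotopic_with (\<lambda>_. True) X Y u u'" "homotopic_with (\<lambda>_. True) X Y v v'"
    using c u v by (auto intro: homotopic_with_equal)
  with h show ?thesis
    by (meson homotopic_with_symD homotopic_with_trans)
qed

context zigzag_pullback begin

lemma B_homotopic_const_func_const0: "B_homotopic H H (const_func id_func) (const_func (const0 s))"
proof (cases s)
  case Inj
  have "B_homotopic H H (const_func id_func) (const_func cone_func)"
    "B_homotopic H H (const_func (const0 s)) (const_func cone_func)"
    by (rule nat_trans_imp_B_homotopic, rule nat_trans_const_func,
        use nat_trans_id_cone nat_trans_const0_cone in \<open>simp only: Inj\<close>)+
  then show ?thesis
    unfolding B_homotopic_def by (meson homotopic_with_symD homotopic_with_trans)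
next
  case Le
  have "B_homotopic H H (const_func (const0 s)) (const_func id_func)"
    by (rule nat_trans_imp_B_homotopic, rule nat_trans_const_func,
        use nat_trans_const0_id in \<open>simp only: Le\<close>)
  then show ?thesis
    unfolding B_homotopic_def by (rule homotopic_with_symD)
qed

text \<open>The chain is \<open>id \<simeq> T\<^sub>0\<close>, which is \<open>const_func id_func\<close>, and then \<open>const_func id_func \<simeq> const_func (const0 s)\<close>,
  which is \<open>i \<circ> q\<close>.\<close>

lemma homotopic_id_i_q:
  "homotopic_with (\<lambda>_. True) (classifying_space H) (classifying_space H)
     (classifying_map H (comp_func (i_func s C f) q_func)) (\<lambda>c. c)"
proof -
  have "classifying_map H truncate0 c = classifying_map H (const_func id_func) c"
    if "c \<in> topspace (classifying_space H)" for c
    using that cat_functor_const_func[OF cat_functor_id_func[OF category_Delta]]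
    by (intro classifying_map_cong) (simp_all add: truncate0_eq_const_func)
  note T = this
  have 1: "homotopic_with (\<lambda>_. True) (classifying_space H) (classifying_space H) (\<lambda>c. c)
      (classifying_map H (const_func id_func))"
    by (rule homotopic_with_cong_topspace[OF homotopic_id_truncate0]) (simp_all add: T)
  have "classifying_map H (comp_func (i_func s C f) q_func) c = classifying_map H (const_func (const0 s)) c"
    if "c \<in> topspace (classifying_space H)" for c
    using that cat_functor_const_func[OF cat_functor_const0]
    by (intro classifying_map_cong) (simp_all add: comp_i_q_eq_const_func)
  note Q = this
  have 2: "homotopic_with (\<lambda>_. True) (classifying_space H) (classifying_space H)
      (classifying_map H (const_func (const0 s))) (\<lambda>c. c)"
    using 1 B_homotopic_const_func_const0 unfolding B_homotopic_def
    by (meson homotopic_with_symD homotopic_with_trans)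
  show ?thesis
    by (rule homotopic_with_cong_topspace[OF 2]) (simp_all add: Q)
qed

end

theorem proposition2p7:
  fixes s :: shape
    and C :: "('o1, 'a1) cat"
    and D :: "('o2, 'a2) cat"
    and f :: "('o1, 'a1, 'o2, 'a2) func"
  assumes "category C"
    and "category D"
    and "cat_functor C D f"
  defines "H \<equiv> H_cat s C D f"
    and "i \<equiv> i_func s C f"
    and "q \<equiv> q_func"
  shows "cat_functor C H i \<and>
         cat_functor H C q \<and>
         continuous_map (classifying_space C) (classifying_space H) (classifying_map H i) \<and>
         continuous_map (classifying_space H) (classifying_space C) (classifying_map C q) \<and>
         homotopic_with (\<lambda>_. True) (classifying_space C) (classifying_space C)
           (classifying_map C q \<circ> classifying_map H i) id \<and>
         homotopic_with (\<lambda>_. True) (classifying_space H) (classifying_space H)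
           (classifying_map H i \<circ> classifying_map C q) id \<and>
         B_homotopy_equivalent C H"
proof -
  interpret zigzag_pullback s C D f by (rule zigzag_pullback.intro) fact
  have i: "cat_functor C H i" unfolding H_def i_def by (rule cat_functor_i)
  have q: "cat_functor H C q" unfolding H_def q_def by (rule cat_functor_q)
  have qi: "cat_functor C C (comp_func q i)" by (rule cat_functor_comp_func[OF i q])
  have "classifying_map C (comp_func q i) c = c" if "c \<in> topspace (classifying_space C)" for c
    using that
    by (intro classifying_map_eq_id[OF qi])
      (auto simp: comp_func_def q_def i_def q_func_def i_func_def Let_def)
  then have C: "homotopic_with (\<lambda>_. True) (classifying_space C) (classifying_space C)
      (classifying_map C (comp_func q i)) (\<lambda>c. c)"
    by (intro homotopic_with_equal continuous_map_classifying_map qi) auto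
  have H: "homotopic_with (\<lambda>_. True) (classifying_space H) (classifying_space H)
      (classifying_map H (comp_func i q)) (\<lambda>c. c)"
    unfolding H_def i_def q_def by (rule homotopic_id_i_q)
  have "homotopic_with (\<lambda>_. True) (classifying_space C) (classifying_space C)
      (classifying_map C q \<circ> classifying_map H i) id"
    by (rule homotopic_with_cong_topspace[OF C]) (simp_all add: classifying_map_comp_func[OF i q])
  moreover have "homotopic_with (\<lambda>_. True) (classifying_space H) (classifying_space H)
      (classifying_map H i \<circ> classifying_map C q) id"
    by (rule homotopic_with_cong_topspace[OF H]) (simp_all add: classifying_map_comp_func[OF q i])
  moreover have "B_homotopic C C (comp_func q i) id_func"
    unfolding B_homotopic_def
    by (rule homotopic_with_cong_topspace[OF C]) (simp_all add: classifying_map_id_func assms(1))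
  moreover have "B_homotopic H H (comp_func i q) id_func"
    unfolding B_homotopic_def
    by (rule homotopic_with_cong_topspace[OF H])
      (simp_all add: H_def classifying_map_id_func category_H)
  ultimately show ?thesis
    unfolding B_homotopy_equivalent_def
    using i q continuous_map_classifying_map[OF i] continuous_map_classifying_map[OF q] by blast
qed

end
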